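(* Assume CH. Let $\kappa$ be a cardinal, let $\mathbb{I}=\langle \mathcal{I}_\xi:\xi<\kappa\rangle$ be a sequence of P--ideals in $[\omega_1]^{\le\aleph_0}$, and for each $\xi$ fix a generating sequence $\langle A^\xi_\alpha:\alpha<\omega_1\rangle$ for $\mathcal{I}_\xi$. Then the notion of forcing $P(\mathbb{I})$ (defined from these generating sequences) satisfies the $\aleph_2$--p.i.c.
   Context: $[\omega_1]^{\le\aleph_0}$ is the set of countable subsets of $\omega_1$; $A\subseteq^* B$ means $A\setminus B$ is finite, and $A=^*B$ means $A\subseteq^*B$ and $B\subseteq^*A$. A P--ideal in $[\omega_1]^{\le\aleph_0}$ is a set $\mathcal{I}\subseteq[\omega_1]^{\le\aleph_0}$ closed under finite unions, under subsets, and under $=^*$, such that for any $A_n\in\mathcal{I}$ ($n\in\omega$) there is $A\in\mathcal{I}$ with $A_n\subseteq^*A$ for all $n$. A generating sequence for $\mathcal{I}$ is $\langle A_\alpha:\alpha<\omega_1\rangle$ with $A_\alpha\subseteq\alpha$, $A_\alpha\subseteq^*A_\beta$ for $\alpha<\beta$, and every $A\in\mathcal{I}$ a subset of some $A_\alpha$. A promise is a function $f$ with $\mathrm{dom} f$ an uncountable subset of $\omega_1$ and $f(\alpha)$ a finite subset of $\alpha$. A condition in $P(\mathbb{I})$ is a pair $p=(a_p,\Phi_p)$ where $a_p$ is a function with countable domain $\subseteq\kappa\times\omega_1$ and range $\subseteq 2$, such that for each $\xi<\kappa$ the set $[p]_\xi=\{\zeta<\omega_1:a_p(\xi,\zeta)=1\}$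 belongs to $\mathcal{I}_\xi$, and $\Phi_p$ is a countable set of pairs $(v,f)$ with $v\subseteq\kappa$ finite and $f$ a promise. $q\le p$ iff $a_q\supseteq a_p$, $\Phi_q\supseteq\Phi_p$, and for every $(v,f)\in\Phi_p$ the set $Y(v,f,q,p)=\{\alpha\in\mathrm{dom} f:(\forall\xi\in v)\,[q]_\xi\setminus[p]_\xi\subseteq A^\xi_\alpha\setminus f(\alpha)\}$ is uncountable and $(v,f\restriction Y(v,f,q,p))\in\Phi_q$. $P$ satisfies the $\aleph_2$--p.i.c. if, for $\lambda$ a large enough regular cardinal: whenever $i<j<\aleph_2$, $N_i,N_j$ are countable elementary submodels of $H(\lambda)$ with $i\in N_i$, $j\in N_j$, $N_i\cap\aleph_2\subseteq j$, $N_i\cap i=N_j\cap j$, $h:N_i\to N_j$ is an isomorphism with $h(i)=j$ and $h$ the identity on $N_i\cap N_j$, $P\in N_i\cap N_j$, and $p\in N_i\cap P$, then there is $q\in P$ such that $q\Vdash(\forall r\in N_i\cap P)[r\in\dot G\leftrightarrow h(r)\in\dot G]$, $q\Vdash p\in\dot G$, and $q$ is $(N_i,P)$--generic ($\dot G$ the name for the generic filter).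
   Formalization: Each A^ξ_α is additionally required to belong to I_ξ, which the stated definition of generating sequence omits; without it the claim fails, e.g. for κ = 1, the ideal of finite sets and A_α = α. *)

theory Defs
  imports "HOL-Library.Countable_Set" "HOL-Library.Equipollence"
begin

section \<open>A universe of sets\<close>

text \<open>
  HOL has no type of all sets, so the set-theoretic universe is a type of the following class.
  Its elements are the sets of second-order ZFC; choice is inherited from HOL.  A collection
  \<open>X :: 'a set\<close> is an actual set of the universe iff \<open>X \<in> range elts\<close>.  Separation and replacement
  range over all HOL sets and functions, so on sets of the universe HOL's notions of
  function, (un)countability and equipollence agree with the internal ones.
\<close>

class set_universe =
  fixes elts :: "'a \<Rightarrow> 'a set"
  assumes extensionality: "elts x = elts y \<Longrightarrow> x = y"
    and foundation: "wf {(x, y). x \<in> elts y}"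
    and separation: "X \<subseteq> elts x \<Longrightarrow> X \<in> range elts"
    and pairing: "{x, y} \<in> range elts"
    and union: "(\<Union>y\<in>elts x. elts y) \<in> range elts"
    and powerset: "{y. elts y \<subseteq> elts x} \<in> range elts"
    and replacement: "f ` elts x \<in> range elts"
    and infinity: "\<exists>x. infinite (elts x)"

text \<open>The set with extension \<open>X\<close>; unspecified if \<open>X\<close> is a proper class.\<close>

definition set_of :: "'v::set_universe set \<Rightarrow> 'v" where
  "set_of X = inv elts X"

lemma elts_set_of [simp]: "X \<in> range elts \<Longrightarrow> elts (set_of X) = X"
  unfolding set_of_def by (rule f_inv_into_f)

lemma set_of_elts [simp]: "set_of (elts x) = x"
  by (rule extensionality) simp

definition pair :: "'v::set_universe \<Rightarrow> 'v \<Rightarrow> 'v" where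
  "pair x y = set_of {set_of {x, x}, set_of {x, y}}"

lemma pair_inject [simp]: "pair x y = pair x' y' \<longleftrightarrow> x = x' \<and> y = y'"
proof
  have up: "elts (set_of {a, b}) = {a, b}" for a b :: 'a
    by (simp add: pairing)
  assume "pair x y = pair x' y'"
  then have "elts (pair x y) = elts (pair x' y')" by simp
  then have "{set_of {x, x}, set_of {x, y}} = {set_of {x', x'}, set_of {x', y'}}"
    by (simp add: pair_def up)
  then have "{elts (set_of {x, x}), elts (set_of {x, y})}
      = {elts (set_of {x', x'}), elts (set_of {x', y'})}"
    by (metis image_insert image_empty)
  then have "{{x, x}, {x, y}} = {{x', x'}, {x', y'}}"
    by (simp only: up)
  then show "x = x' \<and> y = y'" by (auto simp: doubleton_eq_iff)
qed auto

definition first :: "'v::set_universe \<Rightarrow> 'v" where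
  "first z = (THE x. \<exists>y. z = pair x y)"

definition second :: "'v::set_universe \<Rightarrow> 'v" where
  "second z = (THE y. \<exists>x. z = pair x y)"

lemma first_pair [simp]: "first (pair x y) = x"
  and second_pair [simp]: "second (pair x y) = y"
  by (auto simp: first_def second_def)

definition is_function :: "'v::set_universe \<Rightarrow> bool" where
  "is_function f \<longleftrightarrow> (\<forall>z\<in>elts f. \<exists>x y. z = pair x y)
     \<and> (\<forall>x y y'. pair x y \<in> elts f \<and> pair x y' \<in> elts f \<longrightarrow> y = y')"

definition fdom :: "'v::set_universe \<Rightarrow> 'v set" where
  "fdom f = {x. \<exists>y. pair x y \<in> elts f}"

definition fran :: "'v::set_universe \<Rightarrow> 'v set" where
  "fran f = {y. \<exists>x. pair x y \<in> elts f}"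

definition app :: "'v::set_universe \<Rightarrow> 'v \<Rightarrow> 'v" where
  "app f x = (THE y. pair x y \<in> elts f)"

definition restriction :: "'v::set_universe \<Rightarrow> 'v set \<Rightarrow> 'v" where
  "restriction f X = set_of {pair x y | x y. pair x y \<in> elts f \<and> x \<in> X}"


section \<open>Ordinals and cardinals\<close>

text \<open>Von Neumann ordinals: \<open>\<alpha> < \<beta>\<close> is \<open>\<alpha> \<in> elts \<beta>\<close>, and \<open>\<alpha> \<le> \<beta>\<close> is \<open>elts \<alpha> \<subseteq> elts \<beta>\<close>.\<close>

definition transitive_set :: "'v::set_universe \<Rightarrow> bool" where
  "transitive_set x \<longleftrightarrow> (\<forall>y\<in>elts x. elts y \<subseteq> elts x)"

definition Ordinal :: "'v::set_universe \<Rightarrow> bool" where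
  "Ordinal \<alpha> \<longleftrightarrow> transitive_set \<alpha> \<and> (\<forall>\<beta>\<in>elts \<alpha>. transitive_set \<beta>)"

definition Cardinal :: "'v::set_universe \<Rightarrow> bool" where
  "Cardinal \<kappa> \<longleftrightarrow> Ordinal \<kappa> \<and> (\<forall>\<alpha>\<in>elts \<kappa>. elts \<alpha> \<prec> elts \<kappa>)"

definition Regular_cardinal :: "'v::set_universe \<Rightarrow> bool" where
  "Regular_cardinal \<kappa> \<longleftrightarrow> Cardinal \<kappa> \<and> infinite (elts \<kappa>)
     \<and> (\<forall>X \<subseteq> elts \<kappa>. X \<prec> elts \<kappa> \<longrightarrow> (\<exists>\<beta>\<in>elts \<kappa>. X \<subseteq> elts \<beta>))"

definition omega1 :: "'v::set_universe" where
  "omega1 = set_of {\<alpha>. Ordinal \<alpha> \<and> countable (elts \<alpha>)}"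

definition omega2 :: "'v::set_universe" where
  "omega2 = set_of {\<alpha>. Ordinal \<alpha> \<and> elts \<alpha> \<lesssim> elts (omega1 :: 'v)}"

definition zero :: "'v::set_universe" where
  "zero = set_of {}"

definition one :: "'v::set_universe" where
  "one = set_of {zero, zero}"


section \<open>P-ideals\<close>

definition almost_subset :: "'a set \<Rightarrow> 'a set \<Rightarrow> bool" (infix \<open>\<subseteq>\<^sup>*\<close> 50) where
  "A \<subseteq>\<^sup>* B \<longleftrightarrow> finite (A - B)"

definition almost_eq :: "'a set \<Rightarrow> 'a set \<Rightarrow> bool" (infix \<open>=\<^sup>*\<close> 50) where
  "A =\<^sup>* B \<longleftrightarrow> A \<subseteq>\<^sup>* B \<and> B \<subseteq>\<^sup>* A"

definition countable_subsets_omega1 :: "'v::set_universe set set" where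
  "countable_subsets_omega1 = {X. X \<subseteq> elts omega1 \<and> countable X}"

definition P_ideal :: "'v::set_universe set set \<Rightarrow> bool" where
  "P_ideal I \<longleftrightarrow> I \<subseteq> countable_subsets_omega1
     \<and> (\<forall>F \<subseteq> I. finite F \<longrightarrow> \<Union>F \<in> I)
     \<and> (\<forall>X\<in>I. \<forall>Y \<subseteq> X. Y \<in> I)
     \<and> (\<forall>X\<in>I. \<forall>Y \<in> countable_subsets_omega1. Y =\<^sup>* X \<longrightarrow> Y \<in> I)
     \<and> (\<forall>A :: nat \<Rightarrow> 'v set. (\<forall>n. A n \<in> I) \<longrightarrow> (\<exists>B\<in>I. \<forall>n. A n \<subseteq>\<^sup>* B))"

text \<open>
  A generating sequence for \<open>I\<close> consists of members of \<open>I\<close>.  (For \<open>I\<close> the finite sets and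
  \<open>A \<alpha> = \<alpha>\<close>, the remaining clauses hold but the forcing below is not proper.)
\<close>

definition generating_sequence :: "'v::set_universe set set \<Rightarrow> ('v \<Rightarrow> 'v set) \<Rightarrow> bool" where
  "generating_sequence I A \<longleftrightarrow>
     (\<forall>\<alpha>\<in>elts omega1. A \<alpha> \<in> I \<and> A \<alpha> \<subseteq> elts \<alpha>)
     \<and> (\<forall>\<beta>\<in>elts omega1. \<forall>\<alpha>\<in>elts \<beta>. A \<alpha> \<subseteq>\<^sup>* A \<beta>)
     \<and> (\<forall>X\<in>I. \<exists>\<alpha>\<in>elts omega1. X \<subseteq> A \<alpha>)"


section \<open>The notion of forcing\<close>

text \<open>
  A notion of forcing is a single set, the pair of its underlying set and its order
  (as a set of pairs); this is the object that models are required to contain.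
\<close>

definition carrier :: "'v::set_universe \<Rightarrow> 'v set" where
  "carrier P = elts (first P)"

definition below :: "'v::set_universe \<Rightarrow> 'v \<Rightarrow> 'v \<Rightarrow> bool" where
  "below P q p \<longleftrightarrow> q \<in> carrier P \<and> p \<in> carrier P \<and> pair q p \<in> elts (second P)"

definition promise :: "'v::set_universe \<Rightarrow> bool" where
  "promise f \<longleftrightarrow> is_function f \<and> fdom f \<subseteq> elts omega1 \<and> uncountable (fdom f)
     \<and> (\<forall>\<alpha>\<in>fdom f. elts (app f \<alpha>) \<subseteq> elts \<alpha> \<and> finite (elts (app f \<alpha>)))"

text \<open>\<open>column p \<xi>\<close> is \<open>[p]\<^sub>\<xi>\<close>, where \<open>p = (a\<^sub>p, \<Phi>\<^sub>p)\<close>.\<close>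

definition column :: "'v::set_universe \<Rightarrow> 'v \<Rightarrow> 'v set" where
  "column p \<xi> = {\<zeta>\<in>elts omega1. pair (pair \<xi> \<zeta>) one \<in> elts (first p)}"

definition is_condition :: "'v::set_universe \<Rightarrow> ('v \<Rightarrow> 'v set set) \<Rightarrow> 'v \<Rightarrow> bool" where
  "is_condition \<kappa> I p \<longleftrightarrow> (\<exists>a \<Phi>. p = pair a \<Phi>
     \<and> is_function a \<and> countable (fdom a)
     \<and> fdom a \<subseteq> {pair \<xi> \<zeta> | \<xi> \<zeta>. \<xi> \<in> elts \<kappa> \<and> \<zeta> \<in> elts omega1}
     \<and> fran a \<subseteq> {zero, one}
     \<and> (\<forall>\<xi>\<in>elts \<kappa>. column p \<xi> \<in> I \<xi>)
     \<and> countable (elts \<Phi>)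
     \<and> (\<forall>z\<in>elts \<Phi>. \<exists>v f. z = pair v f \<and> elts v \<subseteq> elts \<kappa> \<and> finite (elts v) \<and> promise f))"

definition Y_set ::
  "('v::set_universe \<Rightarrow> 'v \<Rightarrow> 'v set) \<Rightarrow> 'v \<Rightarrow> 'v \<Rightarrow> 'v \<Rightarrow> 'v \<Rightarrow> 'v set" where
  "Y_set A v f q p =
     {\<alpha>\<in>fdom f. \<forall>\<xi>\<in>elts v. column q \<xi> - column p \<xi> \<subseteq> A \<xi> \<alpha> - elts (app f \<alpha>)}"

definition extends :: "('v::set_universe \<Rightarrow> 'v \<Rightarrow> 'v set) \<Rightarrow> 'v \<Rightarrow> 'v \<Rightarrow> bool" where
  "extends A q p \<longleftrightarrow> elts (first p) \<subseteq> elts (first q) \<and> elts (second p) \<subseteq> elts (second q)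
     \<and> (\<forall>v f. pair v f \<in> elts (second p) \<longrightarrow>
          uncountable (Y_set A v f q p)
          \<and> pair v (restriction f (Y_set A v f q p)) \<in> elts (second q))"

text \<open>\<open>P_forcing \<kappa> I A\<close> is \<open>P(I)\<close>, defined from the generating sequences \<open>A \<xi>\<close> of the \<open>I \<xi>\<close>.\<close>

definition P_forcing ::
  "'v::set_universe \<Rightarrow> ('v \<Rightarrow> 'v set set) \<Rightarrow> ('v \<Rightarrow> 'v \<Rightarrow> 'v set) \<Rightarrow> 'v" where
  "P_forcing \<kappa> I A =
     pair (set_of {p. is_condition \<kappa> I p})
          (set_of {pair q p | q p. is_condition \<kappa> I q \<and> is_condition \<kappa> I p \<and> extends A q p})"


section \<open>Formulas of set theory, satisfaction and forcing\<close>

text \<open>De Bruijn indices; an assignment \<open>s :: nat \<Rightarrow> 'v\<close> is extended at \<open>0\<close> by \<open>case_nat x s\<close>.\<close>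

datatype fm = Mem nat nat | Eq nat nat | Neg fm | Conj fm fm | All fm

definition Imp :: "fm \<Rightarrow> fm \<Rightarrow> fm" where
  "Imp \<phi> \<psi> = Neg (Conj \<phi> (Neg \<psi>))"

definition Iff :: "fm \<Rightarrow> fm \<Rightarrow> fm" where
  "Iff \<phi> \<psi> = Conj (Imp \<phi> \<psi>) (Imp \<psi> \<phi>)"

primrec sat :: "'v::set_universe set \<Rightarrow> (nat \<Rightarrow> 'v) \<Rightarrow> fm \<Rightarrow> bool" where
  "sat M s (Mem m n) \<longleftrightarrow> s m \<in> elts (s n)"
| "sat M s (Eq m n) \<longleftrightarrow> s m = s n"
| "sat M s (Neg \<phi>) \<longleftrightarrow> \<not> sat M s \<phi>"
| "sat M s (Conj \<phi> \<psi>) \<longleftrightarrow> sat M s \<phi> \<and> sat M s \<psi>"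
| "sat M s (All \<phi>) \<longleftrightarrow> (\<forall>x\<in>M. sat M (case_nat x s) \<phi>)"

definition elementary_submodel :: "'v::set_universe set \<Rightarrow> 'v set \<Rightarrow> bool" where
  "elementary_submodel N M \<longleftrightarrow> N \<noteq> {} \<and> N \<subseteq> M
     \<and> (\<forall>\<phi> s. range s \<subseteq> N \<longrightarrow> (sat N s \<phi> \<longleftrightarrow> sat M s \<phi>))"

definition trcl_elts :: "'v::set_universe \<Rightarrow> 'v set" where
  "trcl_elts x = {y. (y, x) \<in> {(u, w). u \<in> elts w}\<^sup>+}"

text \<open>\<open>H(\<lambda>)\<close>\<close>

definition hereditary :: "'v::set_universe \<Rightarrow> 'v set" where
  "hereditary l = {x. trcl_elts x \<prec> elts l}"

text \<open>
  Every set serves as a \<open>P\<close>-name: only its elements of the form \<open>pair \<sigma> s\<close> with \<open>s \<in> carrier P\<close>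
  are taken into account, hereditarily.  The forcing relation for atomic formulas is the usual
  one, defined by recursion on names: \<open>p\<close> forces \<open>\<tau> = \<sigma>\<close> iff for all \<open>(\<pi>, s) \<in> \<tau>\<close> every
  \<open>r \<le> p, s\<close> forces \<open>\<pi> \<in> \<sigma>\<close>, and symmetrically.  As \<open>elts\<close> is well-founded, the fixed point is unique,
  and an inductive definition gives the same relation as recursion.
\<close>

inductive forces_eq :: "'v::set_universe \<Rightarrow> 'v \<Rightarrow> 'v \<Rightarrow> 'v \<Rightarrow> bool" for P where
  forces_eqI:
  "p \<in> carrier P \<Longrightarrow>
   (\<And>\<pi> s r. pair \<pi> s \<in> elts \<tau> \<Longrightarrow> below P r p \<Longrightarrow> below P r s \<Longrightarrow>
      \<exists>q \<rho> t. below P q r \<and> pair \<rho> t \<in> elts \<sigma> \<and> below P q t \<and> forces_eq P q \<pi> \<rho>) \<Longrightarrow>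
   (\<And>\<rho> t r. pair \<rho> t \<in> elts \<sigma> \<Longrightarrow> below P r p \<Longrightarrow> below P r t \<Longrightarrow>
      \<exists>q \<pi> s. below P q r \<and> pair \<pi> s \<in> elts \<tau> \<and> below P q s \<and> forces_eq P q \<pi> \<rho>) \<Longrightarrow>
   forces_eq P p \<tau> \<sigma>"

definition forces_mem :: "'v::set_universe \<Rightarrow> 'v \<Rightarrow> 'v \<Rightarrow> 'v \<Rightarrow> bool" where
  "forces_mem P p \<pi> \<tau> \<longleftrightarrow> p \<in> carrier P \<and>
     (\<forall>r. below P r p \<longrightarrow>
        (\<exists>q \<sigma> s. below P q r \<and> pair \<sigma> s \<in> elts \<tau> \<and> below P q s \<and> forces_eq P q \<pi> \<sigma>))"

primrec forces :: "'v::set_universe \<Rightarrow> 'v \<Rightarrow> (nat \<Rightarrow> 'v) \<Rightarrow> fm \<Rightarrow> bool" where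
  "forces P p s (Mem m n) \<longleftrightarrow> forces_mem P p (s m) (s n)"
| "forces P p s (Eq m n) \<longleftrightarrow> forces_eq P p (s m) (s n)"
| "forces P p s (Neg \<phi>) \<longleftrightarrow> (\<forall>q. below P q p \<longrightarrow> \<not> forces P q s \<phi>)"
| "forces P p s (Conj \<phi> \<psi>) \<longleftrightarrow> forces P p s \<phi> \<and> forces P p s \<psi>"
| "forces P p s (All \<phi>) \<longleftrightarrow> (\<forall>\<tau>. forces P p (case_nat \<tau> s) \<phi>)"

text \<open>
  The canonical name of a ground-model set.  All conditions are used as second components, so
  that no largest condition is needed.
\<close>

definition check_name :: "'v::set_universe \<Rightarrow> 'v \<Rightarrow> 'v" where
  "check_name P = wfrec {(y, x). y \<in> elts x}
     (\<lambda>rec x. set_of {pair (rec y) p | y p. y \<in> elts x \<and> p \<in> carrier P})"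

lemma check_name_unfold:
  "check_name P x = set_of {pair (check_name P y) p | y p. y \<in> elts x \<and> p \<in> carrier P}"
proof -
  have adm: "adm_wf {(y, x). y \<in> elts x}
     (\<lambda>rec x. set_of {pair (rec y) p | y p. y \<in> elts x \<and> p \<in> carrier P})"
    unfolding adm_wf_def by (intro allI impI arg_cong[where f = set_of]) force
  show ?thesis
    unfolding check_name_def by (subst wfrec_fixpoint[OF foundation adm]) simp
qed

text \<open>The canonical name of the generic filter.\<close>

definition generic_name :: "'v::set_universe \<Rightarrow> 'v" where
  "generic_name P = set_of {pair (check_name P p) p | p. p \<in> carrier P}"


section \<open>The \<open>\<aleph>\<^sub>2\<close>-p.i.c.\<close>

definition dense_in :: "'v::set_universe \<Rightarrow> 'v set \<Rightarrow> bool" where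
  "dense_in P D \<longleftrightarrow> D \<subseteq> carrier P \<and> (\<forall>p\<in>carrier P. \<exists>d\<in>D. below P d p)"

definition predense_below :: "'v::set_universe \<Rightarrow> 'v set \<Rightarrow> 'v \<Rightarrow> bool" where
  "predense_below P D q \<longleftrightarrow>
     (\<forall>r. below P r q \<longrightarrow> (\<exists>d\<in>D. \<exists>s. below P s r \<and> below P s d))"

definition generic_condition :: "'v::set_universe set \<Rightarrow> 'v \<Rightarrow> 'v \<Rightarrow> bool" where
  "generic_condition N P q \<longleftrightarrow> q \<in> carrier P
     \<and> (\<forall>D\<in>N. dense_in P (elts D) \<longrightarrow> predense_below P (elts D \<inter> N) q)"

definition membership_iso :: "('v::set_universe \<Rightarrow> 'v) \<Rightarrow> 'v set \<Rightarrow> 'v set \<Rightarrow> bool" where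
  "membership_iso h M N \<longleftrightarrow> bij_betw h M N \<and> (\<forall>x\<in>M. \<forall>y\<in>M. h x \<in> elts (h y) \<longleftrightarrow> x \<in> elts y)"

text \<open>
  In the last clause the formula \<open>r \<in> G \<longleftrightarrow> h(r) \<in> G\<close> is evaluated with variables
  \<open>0, 1, 2\<close> naming \<open>r\<close>, \<open>h r\<close> and the generic filter.  The quantifier over \<open>r\<close> ranges over a
  ground-model set and so commutes with the forcing relation.
\<close>

definition aleph2_pic :: "'v::set_universe \<Rightarrow> bool" where
  "aleph2_pic P \<longleftrightarrow> (\<exists>l\<^sub>0. Cardinal l\<^sub>0 \<and> (\<forall>l. Regular_cardinal l \<and> elts l\<^sub>0 \<subseteq> elts l \<longrightarrow>
     (\<forall>i j Ni Nj h p.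
        j \<in> elts omega2 \<and> i \<in> elts j
        \<and> countable Ni \<and> elementary_submodel Ni (hereditary l)
        \<and> countable Nj \<and> elementary_submodel Nj (hereditary l)
        \<and> i \<in> Ni \<and> j \<in> Nj
        \<and> Ni \<inter> elts omega2 \<subseteq> elts j
        \<and> Ni \<inter> elts i = Nj \<inter> elts j
        \<and> membership_iso h Ni Nj \<and> h i = j \<and> (\<forall>x \<in> Ni \<inter> Nj. h x = x)
        \<and> P \<in> Ni \<inter> Nj \<and> p \<in> Ni \<inter> carrier P \<longrightarrow>
        (\<exists>q\<in>carrier P.
           (\<forall>r \<in> Ni \<inter> carrier P.
              forces P q
                (case_nat (check_name P r) (case_nat (check_name P (h r)) (\<lambda>_. generic_name P)))
                (Iff (Mem 0 2) (Mem 1 2)))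
           \<and> forces P q (case_nat (check_name P p) (\<lambda>_. generic_name P)) (Mem 0 1)
           \<and> generic_condition Ni P q))))"

end

theory Submission
  imports Defs
begin

text \<open>
  If \<open>p \<in> N\<close>, \<open>D \<in> N\<close> is dense and \<open>w\<close> is a finite set of columns, then for some \<open>\<beta>\<close> and every
  finite \<open>g\<close> there is \<open>q \<le> p\<close> in \<open>D\<close> whose new elements in the columns \<open>\<xi> \<in> w\<close> lie in \<open>A \<xi> \<beta> - g\<close>:
  otherwise uncountably many \<open>\<beta>\<close> would have a counterexample \<open>f \<beta>\<close>, and adding the promise \<open>(w, f)\<close>
  to \<open>p\<close> would prevent every extension into \<open>D\<close>.  To avoid defining \<open>A\<close> from \<open>P\<close> inside \<open>N\<close>, the
  sets \<open>A \<xi> \<beta>\<close> are recorded as the columns of a condition \<open>x\<close>, so that \<open>x\<close>, and then \<open>q\<close>, can be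
  found in \<open>N\<close> by elementarity.

  Fix \<open>\<gamma> < \<omega>\<^sub>1\<close> such that every column \<open>\<xi>\<close> of a condition in \<open>N\<^sub>i\<close> is almost contained in
  \<open>A \<xi> \<gamma> \<inter> A (h \<xi>) \<gamma>\<close>; this makes sense because \<open>h\<close> does not move the countable ordinals, so that
  column \<open>h \<xi>\<close> of \<open>h p\<close> is column \<open>\<xi>\<close> of \<open>p\<close>.  By the first paragraph there is a descending sequence
  \<open>p n\<close> in \<open>N\<^sub>i\<close> that meets all dense sets in \<open>N\<^sub>i\<close>, where the new elements of finitely many columns
  are kept inside these intersections minus a growing finite set.  A promise \<open>(v, f)\<close> of \<open>p n\<close> is
  kept in the limit because uncountably many \<open>\<alpha>\<close> omit the same finite part of \<open>A \<xi> \<gamma>\<close>.  As the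
  promises of \<open>h (p n)\<close> are treated in the same way, all \<open>p n\<close> and all \<open>h (p n)\<close> have a common lower bound.
\<close>

section \<open>Sets of the universe\<close>

lemma subset_in_range_elts: "X \<subseteq> Y \<Longrightarrow> Y \<in> range elts \<Longrightarrow> X \<in> range elts"
  using separation by blast

lemma image_in_range_elts: "X \<in> range elts \<Longrightarrow> f ` X \<in> range elts"
  for f :: "'v::set_universe \<Rightarrow> 'v"
  by (erule rangeE) (simp only: replacement)

lemma UN_in_range_elts:
  fixes X :: "'v::set_universe set" and F :: "'v \<Rightarrow> 'v set"
  assumes "X \<in> range elts" and "\<And>x. x \<in> X \<Longrightarrow> F x \<in> range elts"
  shows "(\<Union>x\<in>X. F x) \<in> range elts"
proof -
  obtain y where y: "elts y = (\<lambda>x. set_of (F x)) ` X"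
    using image_in_range_elts[OF assms(1), of "\<lambda>x. set_of (F x)"] by force
  have "(\<Union>z\<in>elts y. elts z) = (\<Union>x\<in>X. F x)"
    using assms(2) by (simp add: y)
  then show ?thesis
    using union[of y] by simp
qed

lemma powerset_in_range_elts: "X \<in> range elts \<Longrightarrow> {y. elts y \<subseteq> X} \<in> range elts"
  by (erule rangeE) (simp only: powerset)

lemma product_in_range_elts:
  assumes "X \<in> range elts" and "Y \<in> range elts"
  shows "{pair x y | x y. x \<in> X \<and> y \<in> Y} \<in> range elts"
proof -
  have "(\<Union>x\<in>X. pair x ` Y) \<in> range elts"
    by (intro UN_in_range_elts image_in_range_elts assms)
  moreover have "(\<Union>x\<in>X. pair x ` Y) = {pair x y | x y. x \<in> X \<and> y \<in> Y}" by auto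
  ultimately show ?thesis by simp
qed

text \<open>An infinite set of the universe contains a copy of \<open>nat\<close>, and replacement
  carries that copy to X along an enumeration. Hence \<open>set_of\<close> has its intended value on
  every countable collection.\<close>

lemma countable_in_range_elts:
  assumes "countable X"
  shows "X \<in> range (elts :: 'v::set_universe \<Rightarrow> 'v set)"
proof (cases "X = {}")
  case True
  then show ?thesis using separation[of "{}"] by simp
next
  case False
  obtain x :: 'v where "infinite (elts x)" using infinity by blast
  then obtain g :: "nat \<Rightarrow> 'v" where g: "inj g" "range g \<subseteq> elts x"
    using infinite_countable_subset by blast
  have "range g \<in> range elts" using g(2) separation by blast
  then have "(\<lambda>y. from_nat_into X (inv g y)) ` range g \<in> range elts"
    by (rule image_in_range_elts)
  moreover have "(\<lambda>y. from_nat_into X (inv g y)) ` range g = range (from_nat_into X)"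
    using g(1) by (simp add: image_image)
  ultimately show ?thesis
    using range_from_nat_into[OF False assms] by simp
qed

lemma elts_set_of_countable [simp]: "countable X \<Longrightarrow> elts (set_of X) = X"
  by (simp add: countable_in_range_elts)

lemma elts_zero [simp]: "elts zero = {}"
  by (simp add: zero_def)

lemma elts_one [simp]: "elts one = {zero}"
  by (simp add: one_def)

lemma elts_pair: "elts (pair x y) = {set_of {x, x}, set_of {x, y}}"
  by (simp add: pair_def)

lemma elts_restriction:
  "elts (restriction f X) = {pair x y | x y. pair x y \<in> elts f \<and> x \<in> X}"
proof -
  have "{pair x y | x y. pair x y \<in> elts f \<and> x \<in> X} \<subseteq> elts f" by blast
  then show ?thesis
    unfolding restriction_def by (intro elts_set_of separation)
qed

lemma fdom_restriction [simp]: "fdom (restriction f X) = fdom f \<inter> X"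
  by (auto simp: fdom_def elts_restriction)

lemma is_function_restriction: "is_function f \<Longrightarrow> is_function (restriction f X)"
  unfolding is_function_def elts_restriction by auto

lemma app_eq: "is_function f \<Longrightarrow> pair x y \<in> elts f \<Longrightarrow> app f x = y"
  unfolding is_function_def app_def by blast

lemma app_restriction:
  assumes "x \<in> X"
  shows "app (restriction f X) x = app f x"
  using assms by (simp add: app_def elts_restriction)

lemma restriction_fdom [simp]: "is_function f \<Longrightarrow> fdom f \<subseteq> X \<Longrightarrow> restriction f X = f"
  by (rule extensionality) (auto 4 4 simp: elts_restriction is_function_def fdom_def)

lemma restriction_restriction: "restriction (restriction f X) Y = restriction f (X \<inter> Y)"
  by (rule extensionality) (auto simp: elts_restriction)

definition graph :: "'v::set_universe set \<Rightarrow> ('v \<Rightarrow> 'v) \<Rightarrow> 'v" where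
  "graph X F = set_of ((\<lambda>x. pair x (F x)) ` X)"

lemma
  assumes "X \<in> range elts"
  shows elts_graph: "elts (graph X F) = (\<lambda>x. pair x (F x)) ` X"
    and is_function_graph: "is_function (graph X F)"
    and fdom_graph: "fdom (graph X F) = X"
    and app_graph: "x \<in> X \<Longrightarrow> app (graph X F) x = F x"
proof -
  show *: "elts (graph X F) = (\<lambda>x. pair x (F x)) ` X"
    unfolding graph_def by (intro elts_set_of image_in_range_elts assms)
  show f: "is_function (graph X F)" by (auto simp: is_function_def *)
  show "fdom (graph X F) = X" by (auto simp: fdom_def *)
  show "x \<in> X \<Longrightarrow> app (graph X F) x = F x"
    by (rule app_eq[OF f]) (simp add: *)
qed


section \<open>The countable ordinals\<close>

lemma not_in_self: "x \<notin> elts x"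
  using wf_not_refl[OF foundation, of x] by simp

lemma Ordinal_elts: "Ordinal \<alpha> \<Longrightarrow> \<beta> \<in> elts \<alpha> \<Longrightarrow> Ordinal \<beta>"
  unfolding Ordinal_def transitive_set_def by blast

lemma Ordinal_trans: "Ordinal \<alpha> \<Longrightarrow> \<beta> \<in> elts \<alpha> \<Longrightarrow> \<gamma> \<in> elts \<beta> \<Longrightarrow> \<gamma> \<in> elts \<alpha>"
  unfolding Ordinal_def transitive_set_def by blast

lemma elts_induct [case_names step]:
  assumes "\<And>x. (\<And>y. y \<in> elts x \<Longrightarrow> Q y) \<Longrightarrow> Q x"
  shows "Q x"
  using wf_induct_rule[OF foundation, of Q x] assms by simp

lemma Ordinal_linear:
  "Ordinal \<alpha> \<Longrightarrow> Ordinal \<beta> \<Longrightarrow> \<alpha> \<in> elts \<beta> \<or> \<alpha> = \<beta> \<or> \<beta> \<in> elts \<alpha>"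
proof (induction \<alpha> arbitrary: \<beta> rule: elts_induct)
  case (step \<alpha>)
  note outer_IH = step.IH and outer_prems = step.prems
  from step.prems(2) show ?case
  proof (induction \<beta> rule: elts_induct)
    case (step \<beta>)
    show ?case
    proof (rule ccontr)
      assume neg: "\<not> ?case"
      have "elts \<alpha> = elts \<beta>"
      proof
        show "elts \<alpha> \<subseteq> elts \<beta>"
        proof
          fix x assume x: "x \<in> elts \<alpha>"
          then have "x \<in> elts \<beta> \<or> x = \<beta> \<or> \<beta> \<in> elts x"
            using outer_IH Ordinal_elts[OF outer_prems(1)] step.prems by blast
          then show "x \<in> elts \<beta>"
            using neg x Ordinal_trans[OF outer_prems(1) x] by blast
        qed
        show "elts \<beta> \<subseteq> elts \<alpha>"
        proof
          fix x assume x: "x \<in> elts \<beta>"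
          then have "\<alpha> \<in> elts x \<or> \<alpha> = x \<or> x \<in> elts \<alpha>"
            using step.IH Ordinal_elts[OF step.prems] by blast
          then show "x \<in> elts \<alpha>"
            using neg x Ordinal_trans[OF step.prems x] by blast
        qed
      qed
      then show False using extensionality neg by blast
    qed
  qed
qed

text \<open>The uniqueness part of the Mostowski collapse: by induction on membership, k fixes every
  element of a.\<close>

lemma membership_iso_transitive_sets:
  assumes tr: "transitive_set a" "transitive_set b"
    and k: "k ` elts a = elts b" "\<And>x y. x \<in> elts a \<Longrightarrow> y \<in> elts a \<Longrightarrow> k x \<in> elts (k y) \<longleftrightarrow> x \<in> elts y"
  shows "a = b"
proof -
  have kfix: "x \<in> elts a \<longrightarrow> k x = x" for x
  proof (induction x rule: elts_induct)
    case (step x)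
    show ?case
    proof
      assume x: "x \<in> elts a"
      have sub: "elts x \<subseteq> elts a" using tr(1) x unfolding transitive_set_def by blast
      have "elts (k x) \<subseteq> elts b" using tr(2) k(1) x unfolding transitive_set_def by blast
      then have "elts (k x) = k ` elts x"
        unfolding k(1)[symmetric] using k(2) x sub by blast
      also have "\<dots> = elts x" using step sub by force
      finally show "k x = x" by (rule extensionality)
    qed
  qed
  have "elts a = elts b" using kfix k(1) by force
  then show ?thesis by (rule extensionality)
qed

text \<open>
  A countable ordinal is determined by the isomorphic copy of its order on a subset of a fixed
  infinite set, so replacement applies to the set of relations on that set.
\<close>

lemma countable_ordinals_in_range_elts:
  "{\<alpha>. Ordinal \<alpha> \<and> countable (elts \<alpha>)} \<in> range (elts :: 'v::set_universe \<Rightarrow> 'v set)"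
proof -
  obtain x :: 'v where x: "infinite (elts x)" using infinity by blast
  \<comment> \<open>The order is coded reflexively so that the underlying set can be read off from
    the diagonal pairs; the strict order would not distinguish the ordinals zero and one.\<close>
  define code where "code g \<alpha> = {pair (g a) (g b) | a b. a \<in> elts \<alpha> \<and> b \<in> elts \<alpha> \<and> (a \<in> elts b \<or> a = b)}"
    for g :: "'v \<Rightarrow> 'v" and \<alpha>
  define C where "C \<alpha> r \<longleftrightarrow> Ordinal \<alpha> \<and> (\<exists>g. inj_on g (elts \<alpha>) \<and> elts r = code g \<alpha>)" for \<alpha> r :: 'v
  define Q where "Q = {r :: 'v. elts r \<subseteq> {pair a b | a b. a \<in> elts x \<and> b \<in> elts x}}"
  have Q: "Q \<in> range elts"
    unfolding Q_def by (intro powerset_in_range_elts product_in_range_elts rangeI)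
  have uniq: "\<alpha> = \<beta>" if "C \<alpha> r" "C \<beta> r" for \<alpha> \<beta> r
  proof -
    obtain g where g: "inj_on g (elts \<alpha>)" "elts r = code g \<alpha>" using \<open>C \<alpha> r\<close> C_def by blast
    obtain g' where g': "inj_on g' (elts \<beta>)" "elts r = code g' \<beta>" using \<open>C \<beta> r\<close> C_def by blast
    have eq: "code g \<alpha> = code g' \<beta>" using g g' by simp
    have dg: "g ` elts \<alpha> = {u. pair u u \<in> code g \<alpha>}"
      using g(1) by (auto simp: code_def inj_on_def)
    have dg': "g' ` elts \<beta> = {u. pair u u \<in> code g' \<beta>}"
      using g'(1) by (auto simp: code_def inj_on_def)
    have im: "g ` elts \<alpha> = g' ` elts \<beta>" using dg dg' eq by simp
    define k where "k a = inv_into (elts \<beta>) g' (g a)" for a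
    have k1: "k a \<in> elts \<beta>" "g' (k a) = g a" if "a \<in> elts \<alpha>" for a
    proof -
      have "g a \<in> g' ` elts \<beta>" using that im by blast
      then show "k a \<in> elts \<beta>" "g' (k a) = g a"
        unfolding k_def by (rule inv_into_into, rule f_inv_into_f)
    qed
    have k2: "\<exists>a\<in>elts \<alpha>. b = k a" if b: "b \<in> elts \<beta>" for b
    proof -
      obtain a where a: "a \<in> elts \<alpha>" "g' b = g a" using im b by blast
      then have "g' (k a) = g' b" using k1 by simp
      then show ?thesis using a k1 g'(1) b by (metis inj_onD)
    qed
    have code: "pair (g a) (g b) \<in> code g \<alpha> \<longleftrightarrow> a \<in> elts b \<or> a = b"
      if "a \<in> elts \<alpha>" "b \<in> elts \<alpha>" for a b
      using that g(1) unfolding code_def by (auto dest: inj_onD)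
    have code': "pair (g' a) (g' b) \<in> code g' \<beta> \<longleftrightarrow> a \<in> elts b \<or> a = b"
      if "a \<in> elts \<beta>" "b \<in> elts \<beta>" for a b
      using that g'(1) unfolding code_def by (auto dest: inj_onD)
    have mem: "k a \<in> elts (k b) \<longleftrightarrow> a \<in> elts b" if "a \<in> elts \<alpha>" "b \<in> elts \<alpha>" for a b
    proof -
      have "k a \<in> elts (k b) \<or> k a = k b \<longleftrightarrow> a \<in> elts b \<or> a = b"
        using code[OF that] code'[OF k1(1)[OF that(1)] k1(1)[OF that(2)]] k1(2) that eq by simp
      moreover have "k a = k b \<longleftrightarrow> a = b" using k1 that g(1) by (metis inj_onD)
      ultimately show ?thesis using not_in_self by metis
    qed
    show ?thesis
    proof (rule membership_iso_transitive_sets)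
      show "transitive_set \<alpha>" "transitive_set \<beta>"
        using \<open>C \<alpha> r\<close> \<open>C \<beta> r\<close> unfolding C_def Ordinal_def by blast+
      show "k ` elts \<alpha> = elts \<beta>" using k1 k2 by blast
    qed (rule mem)
  qed
  have "{\<alpha>. Ordinal \<alpha> \<and> countable (elts \<alpha>)} \<subseteq> (\<lambda>r. THE \<alpha>. C \<alpha> r) ` Q"
  proof
    fix \<alpha> :: 'v assume "\<alpha> \<in> {\<alpha>. Ordinal \<alpha> \<and> countable (elts \<alpha>)}"
    then have \<alpha>: "Ordinal \<alpha>" "countable (elts \<alpha>)" by auto
    obtain f :: "nat \<Rightarrow> 'v" where f: "inj f" "range f \<subseteq> elts x"
      using x infinite_countable_subset by blast
    define g where "g = f \<circ> to_nat_on (elts \<alpha>)"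
    have g: "inj_on g (elts \<alpha>)" "g ` elts \<alpha> \<subseteq> elts x"
      using f \<alpha>(2) unfolding g_def by (auto intro: comp_inj_on inj_on_subset)
    have "code g \<alpha> \<subseteq> {pair a b | a b. a \<in> elts x \<and> b \<in> elts x}"
      using g(2) unfolding code_def by blast
    moreover from this have "code g \<alpha> \<in> range elts"
      by (rule subset_in_range_elts) (intro product_in_range_elts rangeI)
    ultimately have "set_of (code g \<alpha>) \<in> Q" "C \<alpha> (set_of (code g \<alpha>))"
      using g(1) \<alpha>(1) by (auto simp: Q_def C_def)
    moreover from this(2) have "(THE \<beta>. C \<beta> (set_of (code g \<alpha>))) = \<alpha>"
      by (rule the_equality) (rule uniq[OF _ \<open>C \<alpha> (set_of (code g \<alpha>))\<close>])
    ultimately show "\<alpha> \<in> (\<lambda>r. THE \<alpha>. C \<alpha> r) ` Q"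
      by (intro image_eqI[of _ _ "set_of (code g \<alpha>)"]) simp_all
  qed
  then show ?thesis
    by (rule subset_in_range_elts) (rule image_in_range_elts[OF Q])
qed

lemma elts_omega1: "elts omega1 = {\<alpha>. Ordinal \<alpha> \<and> countable (elts \<alpha>)}"
  unfolding omega1_def by (rule elts_set_of[OF countable_ordinals_in_range_elts])

lemma zero_in_omega1: "zero \<in> elts omega1"
  by (simp add: elts_omega1 Ordinal_def transitive_set_def)

lemma one_in_omega1: "one \<in> elts omega1"
  by (simp add: elts_omega1 Ordinal_def transitive_set_def)

lemma omega1_trans: "\<alpha> \<in> elts omega1 \<Longrightarrow> elts \<alpha> \<subseteq> elts omega1"
  unfolding elts_omega1
  by (auto intro: Ordinal_elts Ordinal_trans countable_subset[of _ "elts \<alpha>"])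

lemma omega1_linear:
  "\<alpha> \<in> elts omega1 \<Longrightarrow> \<beta> \<in> elts omega1 \<Longrightarrow> \<alpha> \<in> elts \<beta> \<or> \<alpha> = \<beta> \<or> \<beta> \<in> elts \<alpha>"
  by (simp add: elts_omega1 Ordinal_linear)

lemma countable_elts_omega1: "\<alpha> \<in> elts omega1 \<Longrightarrow> countable (elts \<alpha>)"
  by (simp add: elts_omega1)

lemma countable_not_above: "\<gamma> \<in> elts omega1 \<Longrightarrow> countable {\<alpha> \<in> elts omega1. \<gamma> \<notin> elts \<alpha>}"
  by (rule countable_subset[where B = "insert \<gamma> (elts \<gamma>)"])
    (use omega1_linear in \<open>auto simp: countable_elts_omega1\<close>)

text \<open>The countable ordinals not above a fixed one form a countable set, so countably many
  such sets cannot exhaust omega1. This argument avoids suprema of families of ordinals.\<close>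

lemma countable_subset_bounded:
  assumes "uncountable (elts (omega1 :: 'v::set_universe))" "countable C" "C \<subseteq> elts (omega1 :: 'v)"
  obtains \<gamma> where "\<gamma> \<in> elts omega1" "C \<subseteq> elts \<gamma>"
proof -
  have "countable (\<Union>\<beta>\<in>C. {\<alpha> \<in> elts omega1. \<beta> \<notin> elts \<alpha>})"
    using assms(2,3) by (intro countable_UN) (auto intro: countable_not_above)
  then have "\<not> elts omega1 \<subseteq> (\<Union>\<beta>\<in>C. {\<alpha> \<in> elts omega1. \<beta> \<notin> elts \<alpha>})"
    using assms(1) by (auto dest: countable_subset)
  then obtain \<gamma> where "\<gamma> \<in> elts omega1" "C \<subseteq> elts \<gamma>" by blast
  then show ?thesis by (rule that)
qed

lemma Cardinal_omega1:
  assumes unc: "uncountable (elts (omega1 :: 'v::set_universe))"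
  shows "Cardinal (omega1 :: 'v)"
  unfolding Cardinal_def
proof (intro conjI ballI)
  show "Ordinal (omega1 :: 'v)"
    using omega1_trans elts_omega1
    unfolding Ordinal_def[of omega1] transitive_set_def[of omega1] by (auto simp: Ordinal_def)
  fix \<alpha> :: 'v assume \<alpha>: "\<alpha> \<in> elts omega1"
  then have "countable (elts \<alpha>)" by (rule countable_elts_omega1)
  then have "\<not> elts (omega1 :: 'v) \<lesssim> elts \<alpha>"
    using unc by (meson countable_lepoll)
  then show "elts \<alpha> \<prec> elts (omega1 :: 'v)"
    using omega1_trans[OF \<alpha>] by (simp add: lesspoll_def subset_imp_lepoll)
      (use eqpoll_imp_lepoll eqpoll_sym in blast)
qed


section \<open>The order of the forcing\<close>

lemma is_condition_pair:
  "is_condition \<kappa> I (pair a \<Phi>) \<longleftrightarrow>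
     is_function a \<and> countable (fdom a)
     \<and> fdom a \<subseteq> {pair \<xi> \<zeta> | \<xi> \<zeta>. \<xi> \<in> elts \<kappa> \<and> \<zeta> \<in> elts omega1}
     \<and> fran a \<subseteq> {zero, one}
     \<and> (\<forall>\<xi>\<in>elts \<kappa>. column (pair a \<Phi>) \<xi> \<in> I \<xi>)
     \<and> countable (elts \<Phi>)
     \<and> (\<forall>z\<in>elts \<Phi>. \<exists>v f. z = pair v f \<and> elts v \<subseteq> elts \<kappa> \<and> finite (elts v) \<and> promise f)"
  unfolding is_condition_def pair_inject by auto

lemma is_condition_collapse: "is_condition \<kappa> I p \<Longrightarrow> p = pair (first p) (second p)"
  unfolding is_condition_def by force

lemma is_condition_iff:
  "is_condition \<kappa> I p \<longleftrightarrow> p = pair (first p) (second p)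
     \<and> is_function (first p) \<and> countable (fdom (first p))
     \<and> fdom (first p) \<subseteq> {pair \<xi> \<zeta> | \<xi> \<zeta>. \<xi> \<in> elts \<kappa> \<and> \<zeta> \<in> elts omega1}
     \<and> fran (first p) \<subseteq> {zero, one}
     \<and> (\<forall>\<xi>\<in>elts \<kappa>. column p \<xi> \<in> I \<xi>)
     \<and> countable (elts (second p))
     \<and> (\<forall>z\<in>elts (second p). \<exists>v f. z = pair v f \<and> elts v \<subseteq> elts \<kappa> \<and> finite (elts v) \<and> promise f)"
  unfolding is_condition_def
proof (rule iffI, elim exE conjE, goal_cases)
  case (1 a \<Phi>)
  then show ?case by simp
next
  case 2
  then show ?case by (intro exI)
qed

lemma column_pair: "column (pair a \<Phi>) \<xi> = {\<zeta>\<in>elts omega1. pair (pair \<xi> \<zeta>) one \<in> elts a}"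
  by (simp add: column_def)

lemma column_mono: "elts (first p) \<subseteq> elts (first q) \<Longrightarrow> column p \<xi> \<subseteq> column q \<xi>"
  unfolding column_def by blast

lemma elts_function_eq:
  assumes "is_function a"
  shows "elts a = (\<lambda>x. pair x (app a x)) ` fdom a"
proof
  show "elts a \<subseteq> (\<lambda>x. pair x (app a x)) ` fdom a"
  proof
    fix z assume z: "z \<in> elts a"
    then obtain x y where "z = pair x y" using assms unfolding is_function_def by blast
    then show "z \<in> (\<lambda>x. pair x (app a x)) ` fdom a"
      using z app_eq[OF assms] unfolding fdom_def by force
  qed
  show "(\<lambda>x. pair x (app a x)) ` fdom a \<subseteq> elts a"
    using app_eq[OF assms] unfolding fdom_def by auto
qed

lemma is_condition_countable_first:
  assumes "is_condition \<kappa> I p"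
  shows "countable (elts (first p))"
  using assms elts_function_eq[of "first p"] unfolding is_condition_iff by simp

lemma is_condition_countable_second:
  assumes "is_condition \<kappa> I p"
  shows "countable (elts (second p))"
  using assms unfolding is_condition_iff by (elim conjE)

lemma is_condition_first_elts:
  assumes "is_condition \<kappa> I p" "z \<in> elts (first p)"
  obtains \<xi> \<zeta> e where "z = pair (pair \<xi> \<zeta>) e" "\<xi> \<in> elts \<kappa>" "\<zeta> \<in> elts omega1" "e \<in> {zero, one}"
proof -
  obtain x e where z: "z = pair x e"
    using assms unfolding is_condition_iff is_function_def by blast
  have "x \<in> fdom (first p)" "e \<in> fran (first p)"
    using assms(2) unfolding z fdom_def fran_def by blast+
  then show ?thesis
    using assms(1) z that unfolding is_condition_iff by blast
qed

lemma is_condition_second_elts: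
  assumes "is_condition \<kappa> I p" "pair v f \<in> elts (second p)"
  shows "elts v \<subseteq> elts \<kappa>" "finite (elts v)" "promise f"
  using assms unfolding is_condition_iff by fastforce+

lemma promise_elts:
  assumes "promise f" "z \<in> elts f"
  obtains \<alpha> u where "z = pair \<alpha> u" "\<alpha> \<in> elts omega1" "elts u \<subseteq> elts omega1" "finite (elts u)"
proof -
  from assms(1) have f: "is_function f" "fdom f \<subseteq> elts omega1"
    "\<And>\<alpha>. \<alpha> \<in> fdom f \<Longrightarrow> elts (app f \<alpha>) \<subseteq> elts \<alpha>" "\<And>\<alpha>. \<alpha> \<in> fdom f \<Longrightarrow> finite (elts (app f \<alpha>))"
    unfolding promise_def by blast+
  obtain \<alpha> where \<alpha>: "\<alpha> \<in> fdom f" "z = pair \<alpha> (app f \<alpha>)"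
    using assms(2) elts_function_eq[OF f(1)] by auto
  have "\<alpha> \<in> elts omega1" using \<alpha>(1) f(2) by (rule rev_subsetD)
  moreover have "elts (app f \<alpha>) \<subseteq> elts omega1"
    by (rule subset_trans[OF f(3)[OF \<alpha>(1)] omega1_trans[OF \<open>\<alpha> \<in> elts omega1\<close>]])
  ultimately show ?thesis using that[OF \<alpha>(2)] f(4)[OF \<alpha>(1)] by simp
qed

text \<open>Conditions lie in a set built from \<kappa> and omega1 by products and power sets. This
  guarantees that the \<open>set_of\<close> terms in \<open>P_forcing\<close> denote what they
  display.\<close>

lemma conditions_in_range_elts: "{p. is_condition \<kappa> I p} \<in> range elts"
proof -
  let ?X = "{pair x y | x y. x \<in> {pair \<xi> \<zeta> | \<xi> \<zeta>. \<xi> \<in> elts \<kappa> \<and> \<zeta> \<in> elts omega1} \<and> y \<in> {zero, one}}"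
  let ?F = "{f. elts f \<subseteq> {pair \<alpha> u | \<alpha> u. \<alpha> \<in> elts omega1 \<and> u \<in> {u. elts u \<subseteq> elts omega1}}}"
  let ?Y = "{pair v f | v f. v \<in> {v. elts v \<subseteq> elts \<kappa>} \<and> f \<in> ?F}"
  let ?Z = "{pair a \<Phi> | a \<Phi>. a \<in> {a. elts a \<subseteq> ?X} \<and> \<Phi> \<in> {\<Phi>. elts \<Phi> \<subseteq> ?Y}}"
  have "?Z \<in> range elts"
    by (intro product_in_range_elts powerset_in_range_elts rangeI pairing)
  moreover have "{p. is_condition \<kappa> I p} \<subseteq> ?Z"
  proof
    fix p assume "p \<in> {p. is_condition \<kappa> I p}"
    then have p: "is_condition \<kappa> I p" by simp
    have "elts (first p) \<subseteq> ?X"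
    proof
      fix z assume "z \<in> elts (first p)"
      from is_condition_first_elts[OF p this] obtain \<xi> \<zeta> e
        where "z = pair (pair \<xi> \<zeta>) e" "\<xi> \<in> elts \<kappa>" "\<zeta> \<in> elts omega1" "e \<in> {zero, one}" .
      then show "z \<in> ?X" by simp
    qed
    moreover have "elts (second p) \<subseteq> ?Y"
    proof
      fix z assume z: "z \<in> elts (second p)"
      then obtain v f where vf: "z = pair v f" "elts v \<subseteq> elts \<kappa>" "promise f"
        using p unfolding is_condition_iff by (elim conjE ballE[of _ _ z]) auto
      have "elts f \<subseteq> {pair \<alpha> u | \<alpha> u. \<alpha> \<in> elts omega1 \<and> u \<in> {u. elts u \<subseteq> elts omega1}}"
        by (rule subsetI, erule promise_elts[OF vf(3)]) simp
      then show "z \<in> ?Y" using vf by simp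
    qed
    ultimately show "p \<in> ?Z"
      by (subst is_condition_collapse[OF p]) simp
  qed
  ultimately show ?thesis by (rule subset_in_range_elts[rotated])
qed

lemma carrier_P_forcing [simp]: "carrier (P_forcing \<kappa> I A) = {p. is_condition \<kappa> I p}"
  unfolding carrier_def P_forcing_def by (simp add: conditions_in_range_elts)

lemma elts_second_P_forcing:
  "elts (second (P_forcing \<kappa> I A)) = {pair q p | q p. is_condition \<kappa> I q \<and> is_condition \<kappa> I p \<and> extends A q p}"
    (is "_ = ?O")
proof -
  have "?O \<subseteq> {pair q p | q p. q \<in> {p. is_condition \<kappa> I p} \<and> p \<in> {p. is_condition \<kappa> I p}}"
    by blast
  then have "?O \<in> range elts"
    by (rule subset_in_range_elts) (intro product_in_range_elts conditions_in_range_elts)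
  then show ?thesis unfolding P_forcing_def by simp
qed

lemma below_P_forcing:
  "below (P_forcing \<kappa> I A) q p \<longleftrightarrow> is_condition \<kappa> I q \<and> is_condition \<kappa> I p \<and> extends A q p"
  unfolding below_def elts_second_P_forcing by auto

section \<open>Extension of conditions is a preorder\<close>

lemma promise_restriction:
  assumes "promise f" "uncountable (fdom f \<inter> Y)"
  shows "promise (restriction f Y)"
  using assms unfolding promise_def
  by (auto simp: is_function_restriction app_restriction)

lemma Y_set_subset: "Y_set A v f q p \<subseteq> fdom f"
  unfolding Y_set_def by blast

lemma extends_refl:
  assumes "is_condition \<kappa> I p"
  shows "extends A p p"
proof -
  have "Y_set A v f p p = fdom f" for v f unfolding Y_set_def by simp
  moreover have "promise f" if "pair v f \<in> elts (second p)" for v f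
    using is_condition_second_elts[OF assms that] by simp
  ultimately show ?thesis unfolding extends_def promise_def by simp
qed

text \<open>Along p, q, r the new elements of r over p split into those of q over p and those of r
  over q. Testing the restricted promise against r over q is therefore the same as testing f against
  r over p; transitivity of the order rests on this.\<close>

lemma Y_set_trans:
  assumes "elts (first p) \<subseteq> elts (first q)" "elts (first q) \<subseteq> elts (first r)"
  shows "Y_set A v (restriction f (Y_set A v f q p)) r q = Y_set A v f r p"
proof -
  have split: "column r \<xi> - column p \<xi> \<subseteq> S \<longleftrightarrow> column q \<xi> - column p \<xi> \<subseteq> S \<and> column r \<xi> - column q \<xi> \<subseteq> S"
    for \<xi> S
    using column_mono[OF assms(1), of \<xi>] column_mono[OF assms(2), of \<xi>] by blast
  show ?thesis
  proof (rule set_eqI)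
    fix \<alpha>
    show "\<alpha> \<in> Y_set A v (restriction f (Y_set A v f q p)) r q \<longleftrightarrow> \<alpha> \<in> Y_set A v f r p"
    proof (cases "\<alpha> \<in> Y_set A v f q p")
      case True
      then show ?thesis
        unfolding Y_set_def[of _ _ _ r] by (simp add: app_restriction split) (simp add: Y_set_def)
    next
      case False
      then show ?thesis
        unfolding Y_set_def[of _ _ _ r] by (simp add: split) (auto simp: Y_set_def)
    qed
  qed
qed

lemma
  assumes "extends A q p"
  shows extends_first: "elts (first p) \<subseteq> elts (first q)"
    and extends_second: "elts (second p) \<subseteq> elts (second q)"
    and extends_promise: "pair v f \<in> elts (second p) \<Longrightarrow> uncountable (Y_set A v f q p)"
      "pair v f \<in> elts (second p) \<Longrightarrow> pair v (restriction f (Y_set A v f q p)) \<in> elts (second q)"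
  using assms unfolding extends_def by simp_all

lemma extends_trans:
  assumes "extends A r q" "extends A q p"
  shows "extends A r p"
proof -
  have sub: "elts (first p) \<subseteq> elts (first q)" "elts (first q) \<subseteq> elts (first r)"
    using assms by (auto dest: extends_first)
  show ?thesis
    unfolding extends_def
  proof (intro conjI allI impI)
    show "elts (first p) \<subseteq> elts (first r)" "elts (second p) \<subseteq> elts (second r)"
      using assms by (auto dest: extends_first extends_second)
    fix v f assume "pair v f \<in> elts (second p)"
    from extends_promise(2)[OF assms(2) this]
    have "uncountable (Y_set A v (restriction f (Y_set A v f q p)) r q)"
      "pair v (restriction (restriction f (Y_set A v f q p)) (Y_set A v (restriction f (Y_set A v f q p)) r q))
         \<in> elts (second r)"
      by (rule extends_promise[OF assms(1)])+
    moreover have "Y_set A v f q p \<inter> Y_set A v f r p = Y_set A v f r p"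
      using Y_set_trans[OF sub, of A v f] Y_set_subset[of A v "restriction f (Y_set A v f q p)" r q]
      by auto
    ultimately show "uncountable (Y_set A v f r p)"
      "pair v (restriction f (Y_set A v f r p)) \<in> elts (second r)"
      by (simp_all add: Y_set_trans[OF sub] restriction_restriction)
  qed
qed

section \<open>P-ideals and their generating sequences\<close>

lemma
  assumes "P_ideal J"
  shows P_ideal_countable: "X \<in> J \<Longrightarrow> X \<subseteq> elts omega1 \<and> countable X"
    and P_ideal_Union: "F \<subseteq> J \<Longrightarrow> finite F \<Longrightarrow> \<Union>F \<in> J"
    and P_ideal_subset: "X \<in> J \<Longrightarrow> Y \<subseteq> X \<Longrightarrow> Y \<in> J"
    and P_ideal_almost_eq: "X \<in> J \<Longrightarrow> Y \<in> countable_subsets_omega1 \<Longrightarrow> Y =\<^sup>* X \<Longrightarrow> Y \<in> J"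
proof -
  have *: "J \<subseteq> countable_subsets_omega1" "\<forall>F\<subseteq>J. finite F \<longrightarrow> \<Union>F \<in> J" "\<forall>X\<in>J. \<forall>Y\<subseteq>X. Y \<in> J"
    "\<forall>X\<in>J. \<forall>Y\<in>countable_subsets_omega1. Y =\<^sup>* X \<longrightarrow> Y \<in> J"
    using assms unfolding P_ideal_def by - (elim conjE, assumption)+
  show "X \<in> J \<Longrightarrow> X \<subseteq> elts omega1 \<and> countable X"
    using subsetD[OF *(1)] unfolding countable_subsets_omega1_def by simp
  show "F \<subseteq> J \<Longrightarrow> finite F \<Longrightarrow> \<Union>F \<in> J"
    by (rule *(2)[rule_format])
  show "X \<in> J \<Longrightarrow> Y \<subseteq> X \<Longrightarrow> Y \<in> J"
    by (rule *(3)[rule_format])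
  show "X \<in> J \<Longrightarrow> Y \<in> countable_subsets_omega1 \<Longrightarrow> Y =\<^sup>* X \<Longrightarrow> Y \<in> J"
    by (rule *(4)[rule_format])
qed

lemma
  assumes "generating_sequence J B"
  shows generating_sequence_mem: "\<alpha> \<in> elts omega1 \<Longrightarrow> B \<alpha> \<in> J"
    and generating_sequence_subset: "\<alpha> \<in> elts omega1 \<Longrightarrow> B \<alpha> \<subseteq> elts \<alpha>"
    and generating_sequence_mono: "\<beta> \<in> elts omega1 \<Longrightarrow> \<alpha> \<in> elts \<beta> \<Longrightarrow> B \<alpha> \<subseteq>\<^sup>* B \<beta>"
    and generating_sequence_cofinal: "X \<in> J \<Longrightarrow> \<exists>\<alpha>\<in>elts omega1. X \<subseteq> B \<alpha>"
  using assms unfolding generating_sequence_def by simp_all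

text \<open>The uncountability of omega1 is assumed here and is derived from CH in
  \<open>theorem1\<close>.\<close>

locale ideal_forcing =
  fixes \<kappa> :: "'v::set_universe"
    and I :: "'v \<Rightarrow> 'v set set"
    and A :: "'v \<Rightarrow> 'v \<Rightarrow> 'v set"
  assumes uncountable_omega1: "uncountable (elts (omega1 :: 'v))"
    and P_ideal: "\<xi> \<in> elts \<kappa> \<Longrightarrow> P_ideal (I \<xi>)"
    and generating: "\<xi> \<in> elts \<kappa> \<Longrightarrow> generating_sequence (I \<xi>) (A \<xi>)"
begin

abbreviation cond :: "'v \<Rightarrow> bool" where
  "cond \<equiv> is_condition \<kappa> I"

abbreviation \<P> :: 'v where
  "\<P> \<equiv> P_forcing \<kappa> I A"

lemma ideal_subset: "\<xi> \<in> elts \<kappa> \<Longrightarrow> X \<in> I \<xi> \<Longrightarrow> Y \<subseteq> X \<Longrightarrow> Y \<in> I \<xi>"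
  by (rule P_ideal_subset[OF P_ideal])

lemma ideal_countable: "\<xi> \<in> elts \<kappa> \<Longrightarrow> X \<in> I \<xi> \<Longrightarrow> X \<subseteq> elts omega1 \<and> countable X"
  by (rule P_ideal_countable[OF P_ideal])

lemma ideal_Un:
  assumes "\<xi> \<in> elts \<kappa>" "X \<in> I \<xi>" "Y \<in> I \<xi>"
  shows "X \<union> Y \<in> I \<xi>"
  using P_ideal_Union[OF P_ideal[OF assms(1)], of "{X, Y}"] assms by simp

lemma ideal_finite:
  assumes "\<xi> \<in> elts \<kappa>" "finite F" "F \<subseteq> elts omega1"
  shows "F \<in> I \<xi>"
proof (rule P_ideal_almost_eq[OF P_ideal[OF assms(1)]])
  show "{} \<in> I \<xi>" using P_ideal_Union[OF P_ideal[OF assms(1)], of "{}"] by simp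
  show "F =\<^sup>* {}" using assms(2) by (simp add: almost_eq_def almost_subset_def)
  show "F \<in> countable_subsets_omega1"
    using assms by (simp add: countable_subsets_omega1_def countable_finite)
qed

lemma generating_in_ideal: "\<xi> \<in> elts \<kappa> \<Longrightarrow> \<alpha> \<in> elts omega1 \<Longrightarrow> A \<xi> \<alpha> \<in> I \<xi>"
  by (rule generating_sequence_mem[OF generating])

lemma generating_subset: "\<xi> \<in> elts \<kappa> \<Longrightarrow> \<alpha> \<in> elts omega1 \<Longrightarrow> A \<xi> \<alpha> \<subseteq> elts \<alpha>"
  by (rule generating_sequence_subset[OF generating])

lemma countable_generating: "\<xi> \<in> elts \<kappa> \<Longrightarrow> \<alpha> \<in> elts omega1 \<Longrightarrow> countable (A \<xi> \<alpha>)"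
  by (rule countable_subset[OF generating_subset countable_elts_omega1])

lemma generating_almost_mono:
  "\<xi> \<in> elts \<kappa> \<Longrightarrow> \<beta> \<in> elts omega1 \<Longrightarrow> \<alpha> \<in> elts \<beta> \<Longrightarrow> A \<xi> \<alpha> \<subseteq>\<^sup>* A \<xi> \<beta>"
  by (rule generating_sequence_mono[OF generating])

text \<open>Each X lies in some \<open>A \<xi> \<alpha>\<close>. The countably many indices \<alpha>
  have a common bound \<gamma>, and almost monotonicity moves each of them up to \<gamma>. A single
  \<gamma> thus serves different ideals at once.\<close>

lemma countably_many_bounded:
  assumes "countable C" "\<And>\<xi> X. (\<xi>, X) \<in> C \<Longrightarrow> \<xi> \<in> elts \<kappa> \<and> X \<in> I \<xi>"
  obtains \<gamma> where "\<gamma> \<in> elts omega1" "\<And>\<xi> X. (\<xi>, X) \<in> C \<Longrightarrow> X \<subseteq>\<^sup>* A \<xi> \<gamma>"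
proof -
  have "\<forall>z\<in>C. \<exists>\<alpha>\<in>elts omega1. snd z \<subseteq> A (fst z) \<alpha>"
  proof
    fix z assume "z \<in> C"
    then have "fst z \<in> elts \<kappa>" "snd z \<in> I (fst z)" using assms(2)[of "fst z" "snd z"] by simp_all
    then show "\<exists>\<alpha>\<in>elts omega1. snd z \<subseteq> A (fst z) \<alpha>"
      by (rule generating_sequence_cofinal[OF generating])
  qed
  then obtain \<alpha> where "\<forall>z\<in>C. \<alpha> z \<in> elts omega1 \<and> snd z \<subseteq> A (fst z) (\<alpha> z)"
    by (auto simp: Bex_def dest: bchoice)
  then have \<alpha>: "\<And>z. z \<in> C \<Longrightarrow> \<alpha> z \<in> elts omega1" "\<And>z. z \<in> C \<Longrightarrow> snd z \<subseteq> A (fst z) (\<alpha> z)"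
    by simp_all
  obtain \<gamma> where \<gamma>: "\<gamma> \<in> elts omega1" "\<alpha> ` C \<subseteq> elts \<gamma>"
    by (rule countable_subset_bounded[OF uncountable_omega1, of "\<alpha> ` C"]) (use assms(1) \<alpha>(1) in auto)
  have "X \<subseteq>\<^sup>* A \<xi> \<gamma>" if "(\<xi>, X) \<in> C" for \<xi> X
  proof -
    have "A \<xi> (\<alpha> (\<xi>, X)) \<subseteq>\<^sup>* A \<xi> \<gamma>"
      by (rule generating_almost_mono) (use assms(2)[OF that] \<gamma> that in auto)
    then have "finite (A \<xi> (\<alpha> (\<xi>, X)) - A \<xi> \<gamma>)" unfolding almost_subset_def .
    moreover have "X - A \<xi> \<gamma> \<subseteq> A \<xi> (\<alpha> (\<xi>, X)) - A \<xi> \<gamma>" using \<alpha>(2)[OF that] by auto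
    ultimately show ?thesis unfolding almost_subset_def by (rule finite_subset[rotated])
  qed
  then show ?thesis using \<gamma>(1) that by blast
qed

section \<open>Constructing conditions and promises\<close>

lemma column_in_ideal: "cond p \<Longrightarrow> \<xi> \<in> elts \<kappa> \<Longrightarrow> column p \<xi> \<in> I \<xi>"
  by (simp add: is_condition_iff)

text \<open>Conditions serve as containers for prescribed members of the ideals. Only values
  \<open>one\<close> are recorded, so the columns outside w are empty, and there are no
  promises.\<close>

lemma condition_with_columns:
  assumes "finite w" "w \<subseteq> elts \<kappa>" "\<And>\<xi>. \<xi> \<in> w \<Longrightarrow> X \<xi> \<in> I \<xi>"
  obtains x where "cond x" "\<And>\<xi>. \<xi> \<in> w \<Longrightarrow> column x \<xi> = X \<xi>"
proof -
  let ?S = "\<Union>\<xi>\<in>w. pair \<xi> ` X \<xi>"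
  have X: "X \<xi> \<subseteq> elts omega1" "countable (X \<xi>)" if "\<xi> \<in> w" for \<xi>
    using ideal_countable[OF subsetD[OF assms(2) that] assms(3)[OF that]] by simp_all
  have S: "countable ?S"
    using assms(1) X by (intro countable_UN countable_image) (auto intro: countable_finite)
  note S' = countable_in_range_elts[OF S]
  let ?a = "graph ?S (\<lambda>_. one)"
  have col: "column (pair ?a zero) \<xi> = (if \<xi> \<in> w then X \<xi> else {})" for \<xi>
    using X by (auto simp: column_pair elts_graph[OF S'])
  have "fran ?a \<subseteq> {zero, one}"
    unfolding fran_def elts_graph[OF S'] by auto
  moreover have "?S \<subseteq> {pair \<xi> \<zeta> | \<xi> \<zeta>. \<xi> \<in> elts \<kappa> \<and> \<zeta> \<in> elts omega1}"
    using X assms(2) by blast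
  moreover have "(if \<xi> \<in> w then X \<xi> else {}) \<in> I \<xi>" if "\<xi> \<in> elts \<kappa>" for \<xi>
    using that assms(3) ideal_finite[of \<xi> "{}"] by simp
  ultimately have "cond (pair ?a zero)"
    unfolding is_condition_pair col by (simp add: is_function_graph[OF S'] fdom_graph[OF S'] S)
  then show ?thesis using that[of "pair ?a zero"] col by simp
qed

text \<open>The columns do not change, so every Y-set is the whole domain of its promise and the
  restricted promises are the old ones.\<close>

lemma condition_add_promise:
  assumes p: "cond p" and v: "elts v \<subseteq> elts \<kappa>" "finite (elts v)" and f: "promise f"
  defines "p' \<equiv> pair (first p) (set_of (insert (pair v f) (elts (second p))))"
  shows "cond p'" "extends A p' p" "pair v f \<in> elts (second p')" "first p' = first p"
proof -
  have c: "countable (insert (pair v f) (elts (second p)))"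
    using p unfolding is_condition_iff by simp
  have col: "column p' = column p" unfolding p'_def column_def by simp
  have p2: "elts (second p') = insert (pair v f) (elts (second p))"
    unfolding p'_def by (simp only: second_pair elts_set_of_countable[OF c])
  show "pair v f \<in> elts (second p')" using p2 by simp
  show f1: "first p' = first p" unfolding p'_def by simp
  have p'': "p' = pair (first p') (second p')" unfolding p'_def by simp
  show "cond p'"
    unfolding is_condition_iff[of \<kappa> I p'] f1 p2 col
    using p p'' v f unfolding is_condition_iff[of \<kappa> I p] f1 by auto
  have Y: "Y_set A v f p' p = fdom f" for v f unfolding Y_set_def col by simp
  have "promise f" if "pair v f \<in> elts (second p)" for v f
    using is_condition_second_elts[OF p that] by simp
  then show "extends A p' p"
    unfolding extends_def f1 p2 Y promise_def by auto
qed

text \<open>The promise takes the value g at all ordinals above a bound \<gamma> of g, where g is a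
  subset of the argument as required. Thus every finite subset of omega1 occurs as a value of a
  promise.\<close>

lemma constant_promise:
  fixes g :: "'v set"
  assumes "finite g" "g \<subseteq> elts omega1"
  obtains f \<alpha> u :: 'v where "promise f" "pair \<alpha> u \<in> elts f" "elts u = g"
proof -
  obtain \<gamma> where \<gamma>: "\<gamma> \<in> elts omega1" "g \<subseteq> elts \<gamma>"
    by (rule countable_subset_bounded[OF uncountable_omega1, of g]) (simp_all add: assms countable_finite)
  define Z where "Z = {\<alpha> \<in> elts omega1. \<gamma> \<in> elts \<alpha>}"
  have Z: "Z \<in> range elts" unfolding Z_def by (rule separation[of _ omega1]) blast
  have "Z = elts omega1 - {\<alpha> \<in> elts omega1. \<gamma> \<notin> elts \<alpha>}" unfolding Z_def by blast
  then have unc: "uncountable Z"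
    using uncountable_minus_countable[OF uncountable_omega1 countable_not_above[OF \<gamma>(1)]] by simp
  have u: "elts (set_of g) = g" by (simp add: assms(1) countable_finite)
  have sub: "g \<subseteq> elts \<alpha>" if "\<alpha> \<in> Z" for \<alpha>
    using that \<gamma>(2) Ordinal_trans[of \<alpha> \<gamma>] unfolding Z_def elts_omega1 by blast
  let ?f = "graph Z (\<lambda>_. set_of g)"
  have "promise ?f"
    unfolding promise_def
    using unc sub assms(1) by (auto simp: is_function_graph[OF Z] fdom_graph[OF Z] app_graph[OF Z] u Z_def[symmetric])
      (auto simp: Z_def)
  moreover obtain \<alpha> where "\<alpha> \<in> Z" using unc by fastforce
  ultimately show ?thesis using that[of ?f \<alpha> "set_of g"] u by (simp add: elts_graph[OF Z])
qed

text \<open>Finiteness becomes a formula with \<open>P\<close> as its only parameter.\<close>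

lemma finite_subset_oracle:
  "finite (elts g) \<and> elts g \<subseteq> elts omega1 \<longleftrightarrow>
     (\<exists>p v f \<alpha>. cond p \<and> pair v f \<in> elts (second p) \<and> pair \<alpha> g \<in> elts f)"
  (is "?L \<longleftrightarrow> ?R")
proof
  assume ?L
  then obtain f \<alpha> u where f: "promise f" "pair \<alpha> u \<in> elts f" "elts u = elts g"
    using constant_promise by metis
  obtain x where x: "cond x" by (rule condition_with_columns[of "{}"]) auto
  have "\<exists>p. cond p \<and> pair zero f \<in> elts (second p)"
    using condition_add_promise[OF x _ _ f(1), of zero] by auto
  then show ?R using f extensionality[OF f(3)] by blast
next
  assume ?R
  then obtain p v f \<alpha> where *: "cond p" "pair v f \<in> elts (second p)" "pair \<alpha> g \<in> elts f" by blast
  have "promise f" by (rule is_condition_second_elts(3)[OF *(1,2)])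
  from promise_elts[OF this *(3)] show ?L by auto
qed

text \<open>The reservoir x is chosen before g. In \<open>dense_meets_Ni\<close> the set g is the
  finite part of the columns of x outside prescribed sets, so it is known only after x has been
  found in the model.\<close>

lemma dense_reservoir:
  assumes p: "cond p" and w: "elts w \<subseteq> elts \<kappa>" "finite (elts w)"
    and D: "\<And>p. cond p \<Longrightarrow> \<exists>d\<in>D. extends A d p"
  obtains x where "cond x" "\<And>g. finite g \<Longrightarrow> g \<subseteq> elts omega1 \<Longrightarrow>
    \<exists>q\<in>D. extends A q p \<and> (\<forall>\<xi>\<in>elts w. column q \<xi> - column p \<xi> \<subseteq> column x \<xi> - g)"
proof -
  define good where "good \<beta> g \<longleftrightarrow> (\<exists>q\<in>D. extends A q p \<and> (\<forall>\<xi>\<in>elts w. column q \<xi> - column p \<xi> \<subseteq> A \<xi> \<beta> - elts g))" for \<beta> g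
  define Z where "Z = {\<beta>\<in>elts omega1. \<exists>g. elts g \<subseteq> elts \<beta> \<and> finite (elts g) \<and> \<not> good \<beta> g}"
  have "Z \<subseteq> elts omega1" unfolding Z_def by blast
  then have Zset: "Z \<in> range elts" by (rule separation)
  have "countable Z"
  proof (rule ccontr)
    assume unc: "uncountable Z"
    have "\<forall>\<beta>\<in>Z. \<exists>g. elts g \<subseteq> elts \<beta> \<and> finite (elts g) \<and> \<not> good \<beta> g"
      unfolding Z_def by simp
    then obtain G where "\<forall>\<beta>\<in>Z. elts (G \<beta>) \<subseteq> elts \<beta> \<and> finite (elts (G \<beta>)) \<and> \<not> good \<beta> (G \<beta>)"
      by (auto dest: bchoice)
    then have G: "\<And>\<beta>. \<beta> \<in> Z \<Longrightarrow> elts (G \<beta>) \<subseteq> elts \<beta>"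
      "\<And>\<beta>. \<beta> \<in> Z \<Longrightarrow> finite (elts (G \<beta>))" "\<And>\<beta>. \<beta> \<in> Z \<Longrightarrow> \<not> good \<beta> (G \<beta>)"
      by simp_all
    define f where "f = graph Z G"
    have f: "promise f"
      unfolding promise_def f_def fdom_graph[OF Zset]
      using G(1,2) unc \<open>Z \<subseteq> elts omega1\<close>
      by (simp add: is_function_graph[OF Zset] app_graph[OF Zset])
    \<comment> \<open>The columns of p' and p agree. Any \<beta> in the uncountable Y-set of an
      extension q of p' in D therefore makes q a witness for
      \<open>good \<beta> (G \<beta>)\<close>, contrary to the choice of G.\<close>
    define p' where "p' = pair (first p) (set_of (insert (pair w f) (elts (second p))))"
    note p' = condition_add_promise[OF p w f, folded p'_def]
    obtain q where q: "q \<in> D" "extends A q p'" using D[OF p'(1)] by blast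
    have "uncountable (Y_set A w f q p')" by (rule extends_promise(1)[OF q(2) p'(3)])
    then obtain \<beta> where \<beta>: "\<beta> \<in> Y_set A w f q p'" by (metis countable_empty ex_in_conv)
    then have "\<beta> \<in> Z" unfolding Y_set_def f_def fdom_graph[OF Zset] by blast
    have "column p' = column p" using p'(4) by (simp add: column_def fun_eq_iff)
    then have "good \<beta> (G \<beta>)"
      unfolding good_def using q \<beta> extends_trans[OF q(2) p'(2)]
      by (auto simp: Y_set_def f_def fdom_graph[OF Zset] app_graph[OF Zset])
    then show False using G(3)[OF \<open>\<beta> \<in> Z\<close>] by blast
  qed
  then have "\<not> elts omega1 \<subseteq> Z" using uncountable_omega1 countable_subset by blast
  then obtain \<beta> where \<beta>: "\<beta> \<in> elts omega1" "\<beta> \<notin> Z" by blast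
  obtain x where x: "cond x" "\<And>\<xi>. \<xi> \<in> elts w \<Longrightarrow> column x \<xi> = A \<xi> \<beta>"
    by (rule condition_with_columns[OF w(2,1), of "\<lambda>\<xi>. A \<xi> \<beta>"]) (use w \<beta> generating_in_ideal in blast)+
  have "\<exists>q\<in>D. extends A q p \<and> (\<forall>\<xi>\<in>elts w. column q \<xi> - column p \<xi> \<subseteq> column x \<xi> - g)"
    if g: "finite g" "g \<subseteq> elts omega1" for g
  proof -
    \<comment> \<open>Membership in Z only tests finite subsets of \<beta>. Cutting g down to
      \<beta> loses nothing, because \<open>A \<xi> \<beta>\<close> is a subset of \<beta>.\<close>
    have e: "elts (set_of (g \<inter> elts \<beta>)) = g \<inter> elts \<beta>" by (simp add: g(1) countable_finite)
    then have "good \<beta> (set_of (g \<inter> elts \<beta>))" using \<beta> g(1) unfolding Z_def by auto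
    then obtain q where q: "q \<in> D" "extends A q p"
      "\<And>\<xi>. \<xi> \<in> elts w \<Longrightarrow> column q \<xi> - column p \<xi> \<subseteq> A \<xi> \<beta> - (g \<inter> elts \<beta>)"
      unfolding good_def e by blast
    moreover have "A \<xi> \<beta> - (g \<inter> elts \<beta>) \<subseteq> column x \<xi> - g" if "\<xi> \<in> elts w" for \<xi>
      using x(2)[OF that] generating_subset[of \<xi> \<beta>] that w \<beta> by blast
    ultimately show ?thesis by blast
  qed
  then show ?thesis using that x(1) by blast
qed

text \<open>A countable set has only countably many finite subsets, so the finite obstruction
  \<open>G \<alpha>\<close> has the same value E for uncountably many \<alpha>, and all of these
  survive if the new elements avoid E. Since r is arbitrary, the lemma applies to the limit before
  it is known to be a condition.\<close>

lemma promise_kept_by_finite_set: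
  assumes p: "cond p" and q: "extends A q p" and vf: "pair v f \<in> elts (second p)"
    and \<gamma>: "\<gamma> \<in> elts omega1"
  shows "\<exists>E. finite E \<and> (\<forall>r. elts (first q) \<subseteq> elts (first r) \<longrightarrow>
       (\<forall>\<xi>\<in>elts v. column r \<xi> - column q \<xi> \<subseteq> A \<xi> \<gamma> - E) \<longrightarrow> uncountable (Y_set A v f r p))"
proof -
  note v = is_condition_second_elts[OF p vf]
  define Y where "Y = Y_set A v f q p"
  define Z where "Z = Y - {\<alpha> \<in> elts omega1. \<gamma> \<notin> elts \<alpha>}"
  have Y: "Y \<subseteq> fdom f" "uncountable Y"
    using extends_promise(1)[OF q vf] unfolding Y_def by (auto simp: Y_set_def)
  have Y1: "Y \<subseteq> elts omega1" using Y(1) v(3) unfolding promise_def by blast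
  have Z: "uncountable Z"
    unfolding Z_def by (rule uncountable_minus_countable[OF Y(2) countable_not_above[OF \<gamma>]])
  \<comment> \<open>\<open>G \<alpha>\<close> collects what has to be removed from the sets
    \<open>A \<xi> \<gamma>\<close> to fit them into what the promise allows at \<alpha>. For
    \<alpha> above \<gamma> it is finite by almost monotonicity.\<close>
  define G where "G \<alpha> = (\<Union>\<xi>\<in>elts v. A \<xi> \<gamma> - (A \<xi> \<alpha> - elts (app f \<alpha>)))" for \<alpha>
  have "G \<alpha> \<in> {F. F \<subseteq> (\<Union>\<xi>\<in>elts v. A \<xi> \<gamma>) \<and> finite F}" if "\<alpha> \<in> Z" for \<alpha>
  proof -
    have "\<alpha> \<in> elts omega1" "\<gamma> \<in> elts \<alpha>" "\<alpha> \<in> fdom f" using that Y Y1 unfolding Z_def by blast+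
    have "finite (A \<xi> \<gamma> - (A \<xi> \<alpha> - elts (app f \<alpha>)))" if "\<xi> \<in> elts v" for \<xi>
    proof -
      have "finite (A \<xi> \<gamma> - A \<xi> \<alpha>)"
        using generating_almost_mono[OF _ \<open>\<alpha> \<in> elts omega1\<close> \<open>\<gamma> \<in> elts \<alpha>\<close>] that v(1)
        unfolding almost_subset_def by blast
      moreover have "finite (elts (app f \<alpha>))"
        using v(3) \<open>\<alpha> \<in> fdom f\<close> unfolding promise_def by blast
      moreover have "A \<xi> \<gamma> - (A \<xi> \<alpha> - elts (app f \<alpha>)) \<subseteq> (A \<xi> \<gamma> - A \<xi> \<alpha>) \<union> elts (app f \<alpha>)" by blast
      ultimately show ?thesis by (meson finite_Un finite_subset)
    qed
    then have "finite (G \<alpha>)" unfolding G_def using v(2) by blast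
    then show ?thesis unfolding G_def by blast
  qed
  then have "G ` Z \<subseteq> {F. F \<subseteq> (\<Union>\<xi>\<in>elts v. A \<xi> \<gamma>) \<and> finite F}" by blast
  moreover have "countable {F. F \<subseteq> (\<Union>\<xi>\<in>elts v. A \<xi> \<gamma>) \<and> finite F}"
  proof -
    have "countable (\<Union>\<xi>\<in>elts v. A \<xi> \<gamma>)"
      using v(1,2) \<gamma> by (intro countable_UN countable_generating) (auto intro: countable_finite)
    from countable_Collect_finite_subset[OF this] show ?thesis by (simp add: conj_commute)
  qed
  ultimately have c: "countable (G ` Z)" by (rule countable_subset)
  have "\<exists>E\<in>G ` Z. uncountable {\<alpha>\<in>Z. G \<alpha> = E}"
  proof (rule ccontr)
    assume "\<not> ?thesis"
    then have "countable (\<Union>E\<in>G ` Z. {\<alpha>\<in>Z. G \<alpha> = E})" using c by (intro countable_UN) auto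
    moreover have "(\<Union>E\<in>G ` Z. {\<alpha>\<in>Z. G \<alpha> = E}) = Z" by blast
    ultimately show False using Z by simp
  qed
  then obtain E where E: "E \<in> G ` Z" "uncountable {\<alpha>\<in>Z. G \<alpha> = E}" by blast
  show ?thesis
  proof (intro exI[of _ E] conjI allI impI)
    show "finite E" using E(1) \<open>G ` Z \<subseteq> _\<close> by blast
    fix r assume r: "elts (first q) \<subseteq> elts (first r)"
      "\<forall>\<xi>\<in>elts v. column r \<xi> - column q \<xi> \<subseteq> A \<xi> \<gamma> - E"
    have "{\<alpha>\<in>Z. G \<alpha> = E} \<subseteq> Y_set A v (restriction f Y) r q"
    proof
      fix \<alpha> assume \<alpha>: "\<alpha> \<in> {\<alpha>\<in>Z. G \<alpha> = E}"
      then have "\<alpha> \<in> Y" unfolding Z_def by blast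
      moreover have "column r \<xi> - column q \<xi> \<subseteq> A \<xi> \<alpha> - elts (app f \<alpha>)" if "\<xi> \<in> elts v" for \<xi>
        using r(2)[rule_format, OF that] \<alpha> that unfolding G_def by blast
      ultimately show "\<alpha> \<in> Y_set A v (restriction f Y) r q"
        using Y(1) unfolding Y_set_def by (auto simp: app_restriction)
    qed
    also have "\<dots> = Y_set A v f r p"
      unfolding Y_def by (rule Y_set_trans[OF _ r(1)]) (use q in \<open>simp add: extends_def\<close>)
    finally show "uncountable (Y_set A v f r p)" using E(2) by (auto dest: countable_subset)
  qed
qed

end


section \<open>Definability\<close>

text \<open>Definability is taken semantically, so closure properties replace explicit formulas.
  Parameters are not built in: they are entries of the assignment.\<close>

definition definable :: "'v::set_universe set \<Rightarrow> ((nat \<Rightarrow> 'v) \<Rightarrow> bool) \<Rightarrow> bool" where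
  "definable M R \<longleftrightarrow> (\<exists>\<phi>. \<forall>s. range s \<subseteq> M \<longrightarrow> (sat M s \<phi> \<longleftrightarrow> R s))"

lemma definable_mem: "definable M (\<lambda>s. s i \<in> elts (s j))"
  unfolding definable_def by (rule exI[of _ "Mem i j"]) simp

lemma definable_eq: "definable M (\<lambda>s. s i = s j)"
  unfolding definable_def by (rule exI[of _ "Eq i j"]) simp

lemma definable_not:
  assumes "definable M R"
  shows "definable M (\<lambda>s. \<not> R s)"
proof -
  obtain \<phi> where "\<forall>s. range s \<subseteq> M \<longrightarrow> (sat M s \<phi> \<longleftrightarrow> R s)" using assms unfolding definable_def by blast
  then show ?thesis unfolding definable_def by (intro exI[of _ "Neg \<phi>"]) simp
qed

lemma definable_conj:
  assumes "definable M R" "definable M S"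
  shows "definable M (\<lambda>s. R s \<and> S s)"
proof -
  obtain \<phi> where "\<forall>s. range s \<subseteq> M \<longrightarrow> (sat M s \<phi> \<longleftrightarrow> R s)" using assms(1) unfolding definable_def by blast
  moreover obtain \<psi> where "\<forall>s. range s \<subseteq> M \<longrightarrow> (sat M s \<psi> \<longleftrightarrow> S s)" using assms(2) unfolding definable_def by blast
  ultimately show ?thesis unfolding definable_def by (intro exI[of _ "Conj \<phi> \<psi>"]) simp
qed

lemma definable_cong:
  assumes "definable M R" "\<And>s. range s \<subseteq> M \<Longrightarrow> R s \<longleftrightarrow> S s"
  shows "definable M S"
  using assms unfolding definable_def by simp

lemma definable_disj:
  assumes "definable M R" "definable M S"
  shows "definable M (\<lambda>s. R s \<or> S s)"
  by (rule definable_cong[OF definable_not[OF definable_conj[OF assms[THEN definable_not]]]]) simp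

lemma definable_imp:
  assumes "definable M R" "definable M S"
  shows "definable M (\<lambda>s. R s \<longrightarrow> S s)"
  by (rule definable_cong[OF definable_disj[OF definable_not[OF assms(1)] assms(2)]]) simp

lemma definable_iff:
  assumes "definable M R" "definable M S"
  shows "definable M (\<lambda>s. R s \<longleftrightarrow> S s)"
  by (rule definable_cong[OF definable_conj[OF definable_imp[OF assms] definable_imp[OF assms(2,1)]]]) blast

lemma range_case_nat: "x \<in> M \<Longrightarrow> range s \<subseteq> M \<Longrightarrow> range (case_nat x s) \<subseteq> M"
  by (auto split: nat.split dest: subsetD[OF _ rangeI])

text \<open>The body is read with variable 0 as the quantified element and the old variables shifted
  by one, which matches \<open>case_nat\<close> in \<open>sat\<close>.\<close>

lemma definable_all:
  assumes "definable M (\<lambda>s. R (s 0) (\<lambda>n. s (Suc n)))"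
  shows "definable M (\<lambda>s. \<forall>x\<in>M. R x s)"
proof -
  obtain \<phi> where \<phi>: "\<forall>s. range s \<subseteq> M \<longrightarrow> (sat M s \<phi> \<longleftrightarrow> R (s 0) (\<lambda>n. s (Suc n)))"
    using assms unfolding definable_def by blast
  have "sat M (case_nat x s) \<phi> \<longleftrightarrow> R x s" if "x \<in> M" "range s \<subseteq> M" for x s
    using \<phi>[rule_format, OF range_case_nat[OF that]] by simp
  then show ?thesis unfolding definable_def by (intro exI[of _ "All \<phi>"]) simp
qed

lemma definable_ex:
  assumes "definable M (\<lambda>s. R (s 0) (\<lambda>n. s (Suc n)))"
  shows "definable M (\<lambda>s. \<exists>x\<in>M. R x s)"
  by (rule definable_cong[OF definable_not[OF definable_all[OF definable_not[OF assms]]]]) simp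

lemmas definable_intros =
  definable_mem definable_eq definable_not definable_conj definable_disj definable_imp definable_iff
  definable_all definable_ex

text \<open>\<open>first\<close> is a description with an unspecified value off pairs. This relation
  is false there and has a formula over every transitive class.\<close>

definition in_first :: "'v::set_universe \<Rightarrow> 'v \<Rightarrow> bool" where
  "in_first x z \<longleftrightarrow> (\<exists>a b. z = pair a b \<and> x \<in> elts a)"

definition in_second :: "'v::set_universe \<Rightarrow> 'v \<Rightarrow> bool" where
  "in_second x z \<longleftrightarrow> (\<exists>a b. z = pair a b \<and> x \<in> elts b)"

lemma in_first_pair [simp]: "in_first x (pair a b) \<longleftrightarrow> x \<in> elts a"
  and in_second_pair [simp]: "in_second x (pair a b) \<longleftrightarrow> x \<in> elts b"
  unfolding in_first_def in_second_def by auto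

definition pair_in_second :: "'v::set_universe \<Rightarrow> 'v \<Rightarrow> 'v \<Rightarrow> bool" where
  "pair_in_second x y z \<longleftrightarrow> in_second (pair x y) z"

definition triple_in_first :: "'v::set_universe \<Rightarrow> 'v \<Rightarrow> 'v \<Rightarrow> 'v \<Rightarrow> bool" where
  "triple_in_first x y e z \<longleftrightarrow> in_first (pair (pair x y) e) z"

text \<open>Transitivity makes bounded quantifiers expressible by quantifiers over M and keeps the
  components of pairs inside M.\<close>

locale transitive_class =
  fixes M :: "'v::set_universe set"
  assumes transitive_class: "x \<in> M \<Longrightarrow> y \<in> elts x \<Longrightarrow> y \<in> M"
begin

lemma pair_components:
  assumes "pair x y \<in> M"
  shows "x \<in> M" "y \<in> M"
proof -
  have "set_of {x, y} \<in> M"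
    using transitive_class[OF assms, of "set_of {x, y}"] by (simp add: elts_pair)
  then show "x \<in> M" "y \<in> M"
    using transitive_class[of "set_of {x, y}"] by simp_all
qed

lemma definable_ball:
  assumes "definable M (\<lambda>s. R (s 0) (\<lambda>n. s (Suc n)))"
  shows "definable M (\<lambda>s. \<forall>x\<in>elts (s i). R x s)"
proof -
  have "definable M (\<lambda>s. \<forall>x\<in>M. x \<in> elts (s i) \<longrightarrow> R x s)"
    by (intro definable_all definable_imp definable_mem assms)
  then show ?thesis
    by (rule definable_cong) (use transitive_class in blast)
qed

lemma definable_bex:
  assumes "definable M (\<lambda>s. R (s 0) (\<lambda>n. s (Suc n)))"
  shows "definable M (\<lambda>s. \<exists>x\<in>elts (s i). R x s)"
  by (rule definable_cong[OF definable_not[OF definable_ball[OF definable_not[OF assms]]]]) simp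

text \<open>M is not assumed to be closed under pairing, so z is described through its own elements
  u and v, which stand for the singleton of x and for the unordered pair of x and y.\<close>

lemma definable_is_pair: "definable M (\<lambda>s. s i = pair (s j) (s k))"
proof -
  have eq: "z = pair x y \<longleftrightarrow> (\<exists>u\<in>elts z. \<exists>v\<in>elts z. (\<forall>t\<in>elts z. t = u \<or> t = v)
      \<and> x \<in> elts u \<and> (\<forall>t\<in>elts u. t = x)
      \<and> x \<in> elts v \<and> y \<in> elts v \<and> (\<forall>t\<in>elts v. t = x \<or> t = y))" (is "_ \<longleftrightarrow> ?R") for x y z :: 'v
  proof
    assume "z = pair x y"
    then show ?R by (simp add: elts_pair)
  next
    assume ?R
    then obtain u v where uv: "u \<in> elts z" "v \<in> elts z" "\<forall>t\<in>elts z. t = u \<or> t = v"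
      "x \<in> elts u" "\<forall>t\<in>elts u. t = x" "x \<in> elts v" "y \<in> elts v" "\<forall>t\<in>elts v. t = x \<or> t = y"
      by blast
    have "elts u = {x, x}" using uv(4,5) by blast
    moreover have "elts v = {x, y}" using uv(6-8) by blast
    ultimately have "pair x y = set_of {u, v}" unfolding pair_def by (metis set_of_elts)
    moreover have "elts z = {u, v}" using uv(1-3) by blast
    ultimately have "elts z = elts (pair x y)" by simp
    then show "z = pair x y" by (rule extensionality)
  qed
  show ?thesis
    unfolding eq by (intro definable_intros definable_bex definable_ball)
qed

lemma definable_in_first: "definable M (\<lambda>s. in_first (s i) (s j))"
proof -
  have "definable M (\<lambda>s. \<exists>a\<in>M. \<exists>b\<in>M. s j = pair a b \<and> s i \<in> elts a)"
    by (intro definable_intros definable_is_pair)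
  then show ?thesis
  proof (rule definable_cong)
    fix s :: "nat \<Rightarrow> 'v" assume "range s \<subseteq> M"
    then have "s j \<in> M" by blast
    then show "(\<exists>a\<in>M. \<exists>b\<in>M. s j = pair a b \<and> s i \<in> elts a) \<longleftrightarrow> in_first (s i) (s j)"
      unfolding in_first_def by (metis pair_components)
  qed
qed

lemma definable_in_second: "definable M (\<lambda>s. in_second (s i) (s j))"
proof -
  have "definable M (\<lambda>s. \<exists>a\<in>M. \<exists>b\<in>M. s j = pair a b \<and> s i \<in> elts b)"
    by (intro definable_intros definable_is_pair)
  then show ?thesis
  proof (rule definable_cong)
    fix s :: "nat \<Rightarrow> 'v" assume "range s \<subseteq> M"
    then have "s j \<in> M" by blast
    then show "(\<exists>a\<in>M. \<exists>b\<in>M. s j = pair a b \<and> s i \<in> elts b) \<longleftrightarrow> in_second (s i) (s j)"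
      unfolding in_second_def by (metis pair_components)
  qed
qed

lemma definable_pair_mem: "definable M (\<lambda>s. pair (s i) (s j) \<in> elts (s k))"
proof -
  have "definable M (\<lambda>s. \<exists>z\<in>elts (s k). z = pair (s i) (s j))"
    by (intro definable_intros definable_bex definable_is_pair)
  then show ?thesis by (rule definable_cong) simp
qed

lemma in_first_mem: "z \<in> M \<Longrightarrow> in_first x z \<Longrightarrow> x \<in> M"
  unfolding in_first_def using pair_components transitive_class by blast

lemma in_second_mem: "z \<in> M \<Longrightarrow> in_second x z \<Longrightarrow> x \<in> M"
  unfolding in_second_def using pair_components transitive_class by blast

lemma definable_pair_in_second: "definable M (\<lambda>s. pair_in_second (s i) (s j) (s k))"
proof -
  have "definable M (\<lambda>s. \<exists>z\<in>M. z = pair (s i) (s j) \<and> in_second z (s k))"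
    by (intro definable_intros definable_is_pair definable_in_second)
  then show ?thesis
  proof (rule definable_cong)
    fix s :: "nat \<Rightarrow> 'v" assume "range s \<subseteq> M"
    then have "s k \<in> M" by blast
    then show "(\<exists>z\<in>M. z = pair (s i) (s j) \<and> in_second z (s k)) \<longleftrightarrow> pair_in_second (s i) (s j) (s k)"
      unfolding pair_in_second_def using in_second_mem by auto
  qed
qed

lemma definable_triple_in_first: "definable M (\<lambda>s. triple_in_first (s i) (s j) (s m) (s k))"
proof -
  have "definable M (\<lambda>s. \<exists>z\<in>M. \<exists>y\<in>M. y = pair (s i) (s j) \<and> z = pair y (s m) \<and> in_first z (s k))"
    by (intro definable_intros definable_is_pair definable_in_first)
  then show ?thesis
  proof (rule definable_cong)
    fix s :: "nat \<Rightarrow> 'v" assume "range s \<subseteq> M"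
    then have "s k \<in> M" by blast
    then show "(\<exists>z\<in>M. \<exists>y\<in>M. y = pair (s i) (s j) \<and> z = pair y (s m) \<and> in_first z (s k))
        \<longleftrightarrow> triple_in_first (s i) (s j) (s m) (s k)"
      unfolding triple_in_first_def using in_first_mem[of "s k" "pair (pair (s i) (s j)) (s m)"]
        pair_components(1)[of "pair (s i) (s j)" "s m"] by auto
  qed
qed

lemma definable_is_one: "definable M (\<lambda>s. s i = one)"
proof -
  have eq: "x = one \<longleftrightarrow> (\<exists>z\<in>elts x. (\<forall>t\<in>elts z. t \<noteq> t) \<and> (\<forall>t\<in>elts x. t = z))" for x :: 'v
  proof
    assume "x = one"
    then show "\<exists>z\<in>elts x. (\<forall>t\<in>elts z. t \<noteq> t) \<and> (\<forall>t\<in>elts x. t = z)" by simp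
  next
    assume "\<exists>z\<in>elts x. (\<forall>t\<in>elts z. t \<noteq> t) \<and> (\<forall>t\<in>elts x. t = z)"
    then obtain z where z: "z \<in> elts x" "\<forall>t\<in>elts z. t \<noteq> t" "\<forall>t\<in>elts x. t = z" by blast
    have "elts z = elts zero" using z(2) unfolding elts_zero by blast
    then have "z = zero" by (rule extensionality)
    moreover have "elts x = {z}" using z(1,3) by blast
    ultimately have "elts x = elts one" by simp
    then show "x = one" by (rule extensionality)
  qed
  show ?thesis
    unfolding eq by (intro definable_intros definable_bex definable_ball)
qed

text \<open>
  A form of countability that needs no \<open>\<omega>\<close>: \<open>c\<close> is the orbit of \<open>e\<close> under a partial function \<open>r\<close>.
  If \<open>e\<close> and \<open>r\<close> belong to an elementary submodel, then so does the whole orbit.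
\<close>

definition enumerated :: "'v \<Rightarrow> bool" where
  "enumerated c \<longleftrightarrow> (\<exists>e\<in>elts c. \<exists>r\<in>M.
     (\<forall>x\<in>M. \<forall>y\<in>M. \<forall>z\<in>M. pair x y \<in> elts r \<and> pair x z \<in> elts r \<longrightarrow> y = z)
     \<and> (\<forall>t\<in>M. e \<in> elts t \<and> (\<forall>x\<in>elts t. \<forall>y\<in>elts c. pair x y \<in> elts r \<longrightarrow> y \<in> elts t)
           \<longrightarrow> (\<forall>x\<in>elts c. x \<in> elts t)))"

lemma definable_enumerated: "definable M (\<lambda>s. enumerated (s i))"
  unfolding enumerated_def
  by (intro definable_intros definable_bex definable_ball definable_pair_mem)

lemmas definable_bounded_intros = definable_intros definable_bex definable_ball definable_is_pair
  definable_pair_mem definable_in_first definable_in_second definable_pair_in_second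
  definable_triple_in_first definable_is_one definable_enumerated

end


section \<open>The sets \<open>H(\<lambda>)\<close>\<close>

lemma trcl_elts_unfold: "trcl_elts x = elts x \<union> (\<Union>y\<in>elts x. trcl_elts y)"
proof -
  have "{(u, w). u \<in> elts w}\<^sup>+ = {(u, w). u \<in> elts w} \<union> {(u, w). u \<in> elts w}\<^sup>+ O {(u, w). u \<in> elts w}"
    by (rule trancl_unfold)
  then show ?thesis unfolding trcl_elts_def by auto
qed

lemma trcl_elts_mono: "elts y \<subseteq> elts x \<Longrightarrow> trcl_elts y \<subseteq> trcl_elts x"
  using trcl_elts_unfold[of x] trcl_elts_unfold[of y] by blast

lemma trcl_elts_mem: "y \<in> elts x \<Longrightarrow> trcl_elts y \<subseteq> trcl_elts x"
  using trcl_elts_unfold[of x] by blast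

text \<open>Comparability of cardinals reduces strict smallness to the absence of an injection, so
  membership in \<open>hereditary l\<close> passes to smaller closures by composing
  injections.\<close>

lemma lesspoll_iff: "X \<prec> Y \<longleftrightarrow> \<not> Y \<lesssim> X"
proof
  assume "X \<prec> Y"
  then show "\<not> Y \<lesssim> X" by (meson lepoll_antisym lesspoll_def)
next
  assume *: "\<not> Y \<lesssim> X"
  have "(card_of X, card_of Y) \<in> ordLeq \<or> (card_of Y, card_of X) \<in> ordLeq"
    by (rule ordLeq_total[OF card_of_Well_order card_of_Well_order])
  then have "X \<lesssim> Y" using * unfolding lepoll_def card_of_ordLeq[symmetric] by blast
  moreover have "\<not> X \<approx> Y" using * by (meson eqpoll_imp_lepoll eqpoll_sym)
  ultimately show "X \<prec> Y" unfolding lesspoll_def by blast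
qed

lemma lesspoll_iff_ordLess: "X \<prec> Y \<longleftrightarrow> (card_of X, card_of Y) \<in> ordLess"
proof -
  have "Y \<lesssim> X \<longleftrightarrow> (card_of Y, card_of X) \<in> ordLeq"
    unfolding lepoll_def by (rule card_of_ordLeq)
  moreover have "\<not> (card_of Y, card_of X) \<in> ordLeq \<longleftrightarrow> (card_of X, card_of Y) \<in> ordLess"
    by (rule not_ordLeq_iff_ordLess[OF card_of_Well_order card_of_Well_order])
  ultimately show ?thesis using lesspoll_iff[of X Y] by blast
qed

lemma lesspoll_Un:
  assumes "infinite L" "X \<prec> L" "Y \<prec> L"
  shows "X \<union> Y \<prec> L"
  using assms card_of_Un_ordLess_infinite unfolding lesspoll_iff_ordLess by blast

locale uncountable_H =
  fixes l :: "'v::set_universe"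
  assumes uncountable_l: "uncountable (elts l)"
begin

abbreviation "H \<equiv> hereditary l"

sublocale transitive_class H
proof
  fix x y :: 'v assume "x \<in> H" "y \<in> elts x"
  then show "y \<in> H"
    unfolding hereditary_def lesspoll_iff using trcl_elts_mem[of y x]
    by simp (meson lepoll_trans subset_imp_lepoll)
qed

lemma hereditary_subset:
  assumes "x \<in> H" "elts y \<subseteq> elts x"
  shows "y \<in> H"
  using assms(1) trcl_elts_mono[OF assms(2)] unfolding hereditary_def lesspoll_iff
  by simp (meson lepoll_trans subset_imp_lepoll)

lemma hereditary_extend:
  assumes "x \<in> H" "y \<in> H" "countable C" "trcl_elts z \<subseteq> C \<union> trcl_elts x \<union> trcl_elts y"
  shows "z \<in> H"
proof -
  have inf: "infinite (elts l)" using uncountable_l countable_finite by blast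
  have "C \<prec> elts l" unfolding lesspoll_iff
    using assms(3) uncountable_l by (meson countable_lepoll)
  then have "C \<union> trcl_elts x \<union> trcl_elts y \<prec> elts l"
    using assms(1,2) unfolding hereditary_def by (intro lesspoll_Un[OF inf]) simp_all
  then show ?thesis
    unfolding hereditary_def lesspoll_iff using assms(4)
    by simp (meson lepoll_trans subset_imp_lepoll)
qed

lemma elts_insert: "elts (set_of (insert y (elts x))) = insert y (elts x)" for x y :: 'v
proof -
  have "elts (set_of {x, set_of {y, y}}) = {x, set_of {y, y}}" "elts (set_of {y, y}) = {y}" by simp_all
  then have "insert y (elts x) = (\<Union>z\<in>elts (set_of {x, set_of {y, y}}). elts z)" by auto
  then show ?thesis using union[of "set_of {x, set_of {y, y}}"] by simp
qed

lemma hereditary_insert: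
  assumes "x \<in> H" "y \<in> H"
  shows "set_of (insert y (elts x)) \<in> H"
proof (rule hereditary_extend[OF assms, of "{y}"])
  show "trcl_elts (set_of (insert y (elts x))) \<subseteq> {y} \<union> trcl_elts x \<union> trcl_elts y"
    using trcl_elts_unfold[of x] trcl_elts_unfold[of "set_of (insert y (elts x))"]
    unfolding elts_insert by blast
qed simp

text \<open>Besides the closure of c, the closure of r contains only the countably many pairs and
  their elements. The elements of a pair over c are subsets of c, so they add nothing
  further.\<close>

lemma countable_relation_hereditary:
  assumes c: "c \<in> H" "countable (elts c)" and r: "elts r \<subseteq> {pair x y | x y. x \<in> elts c \<and> y \<in> elts c}"
  shows "r \<in> H"
proof (rule hereditary_extend[OF c(1) c(1)])
  let ?P = "(\<lambda>(x, y). pair x y) ` (elts c \<times> elts c)"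
  have sub: "elts r \<subseteq> ?P" using r by auto
  have P: "countable ?P" using c(2) by simp
  then show "countable (?P \<union> (\<Union>z\<in>?P. elts z))"
    by (intro countable_Un countable_UN) (auto simp: elts_pair)
  have pc: "trcl_elts (pair x y) \<subseteq> elts (pair x y) \<union> trcl_elts c" if xy: "x \<in> elts c" "y \<in> elts c" for x y
  proof -
    have "trcl_elts u \<subseteq> trcl_elts c" if "u \<in> elts (pair x y)" for u
    proof -
      have "elts u \<subseteq> elts c" using that xy by (auto simp: elts_pair)
      then show ?thesis by (rule trcl_elts_mono)
    qed
    then show ?thesis using trcl_elts_unfold[of "pair x y"] by blast
  qed
  show "trcl_elts r \<subseteq> ?P \<union> (\<Union>z\<in>?P. elts z) \<union> trcl_elts c \<union> trcl_elts c"
  proof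
    fix u assume "u \<in> trcl_elts r"
    then consider "u \<in> elts r" | z where "z \<in> elts r" "u \<in> trcl_elts z"
      using trcl_elts_unfold[of r] by blast
    then show "u \<in> ?P \<union> (\<Union>z\<in>?P. elts z) \<union> trcl_elts c \<union> trcl_elts c"
    proof cases
      case 1
      then show ?thesis using sub by blast
    next
      case 2
      then obtain x y where xy: "z = pair x y" "x \<in> elts c" "y \<in> elts c" using r by blast
      then have "z \<in> ?P" by force
      then show ?thesis using 2(2) pc[OF xy(2,3)] unfolding xy(1) by blast
    qed
  qed
qed

text \<open>For r take the successor relation in the order of indices under an injection of c into
  \<open>nat\<close>, and for e the element of least index. Finite sets c are covered as
  well.\<close>

lemma countable_enumerated:
  assumes c: "c \<in> H" "countable (elts c)" "elts c \<noteq> {}"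
  shows "enumerated c"
proof -
  define n where "n = to_nat_on (elts c)"
  have n: "inj_on n (elts c)" unfolding n_def by (rule inj_on_to_nat_on[OF c(2)])
  define R where "R = {pair x y | x y. x \<in> elts c \<and> y \<in> elts c \<and> n x < n y \<and> (\<forall>z\<in>elts c. n x < n z \<longrightarrow> n y \<le> n z)}"
  have sub: "R \<subseteq> {pair x y | x y. x \<in> elts c \<and> y \<in> elts c}" unfolding R_def by blast
  then have "R \<in> range elts"
    by (rule subset_in_range_elts) (intro product_in_range_elts rangeI)
  then have eR: "elts (set_of R) = R" by simp
  then have "set_of R \<in> H"
    using countable_relation_hereditary[OF c(1,2), of "set_of R"] sub by simp
  have R: "pair x y \<in> R \<longleftrightarrow> x \<in> elts c \<and> y \<in> elts c \<and> n x < n y \<and> (\<forall>z\<in>elts c. n x < n z \<longrightarrow> n y \<le> n z)" for x y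
    unfolding R_def by auto
  obtain e where e: "e \<in> elts c" "\<And>x. x \<in> elts c \<Longrightarrow> n e \<le> n x"
    using c(3) ex_has_least_nat[of "\<lambda>x. x \<in> elts c" _ n] by blast
  have reach: "x \<in> elts t"
    if x: "x \<in> elts c" and t: "e \<in> elts t" "\<forall>x\<in>elts t. \<forall>y\<in>elts c. pair x y \<in> R \<longrightarrow> y \<in> elts t" for x t
    using x
  proof (induction "n x" arbitrary: x rule: less_induct)
    case less
    show ?case
    proof (cases "x = e")
      case True
      then show ?thesis using t(1) by simp
    next
      case False
      \<comment> \<open>An element of largest index below that of x is the predecessor of x under R.
        The set is nonempty because it contains e.\<close>
      let ?B = "{y\<in>elts c. n y < n x}"
      have "n e < n x" using False e less.prems n by (metis inj_onD le_neq_implies_less)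
      then have ne: "e \<in> ?B" using e(1) by simp
      have "\<And>y. y \<in> ?B \<longrightarrow> n y \<le> n x" by simp
      then obtain y where y: "y \<in> ?B" "\<And>z. z \<in> ?B \<Longrightarrow> n z \<le> n y"
        using ex_has_greatest_nat[of "\<lambda>y. y \<in> ?B" e n "n x"] ne by blast
      have "pair y x \<in> R"
        unfolding R using y less.prems
        by (auto simp: not_less[symmetric])
      moreover have "y \<in> elts t" using y(1) less.hyps by simp
      ultimately show ?thesis using t(2) less.prems by blast
    qed
  qed
  have "y = z" if "pair x y \<in> R \<and> pair x z \<in> R" for x y z
  proof -
    have "y \<in> elts c" "z \<in> elts c" using that unfolding R by simp_all
    moreover have "n y = n z" using that unfolding R by (intro antisym) simp_all
    ultimately show ?thesis using n unfolding inj_on_def by blast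
  qed
  then have f: "\<forall>x\<in>H. \<forall>y\<in>H. \<forall>z\<in>H. pair x y \<in> elts (set_of R) \<and> pair x z \<in> elts (set_of R) \<longrightarrow> y = z"
    unfolding eR by (intro ballI impI)
  have "\<forall>t\<in>H. e \<in> elts t \<and> (\<forall>x\<in>elts t. \<forall>y\<in>elts c. pair x y \<in> elts (set_of R) \<longrightarrow> y \<in> elts t)
      \<longrightarrow> (\<forall>x\<in>elts c. x \<in> elts t)"
    unfolding eR by (intro ballI impI, elim conjE, rule reach)
  then show ?thesis
    unfolding enumerated_def
    by - (rule bexI[OF _ e(1)], rule bexI[OF _ \<open>set_of R \<in> H\<close>], rule conjI[OF f])
qed

end


section \<open>Elementary submodels and their isomorphisms\<close>

text \<open>One direction of the Tarski-Vaught criterion, for definable relations. Six parameters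
  are what \<open>dense_meets_Ni\<close> requires; shorter lists are padded by repetition.\<close>

lemma elementary_submodel_witness:
  assumes N: "elementary_submodel N M"
    and R: "definable M (\<lambda>s. R (s 0) (s 1) (s 2) (s 3) (s 4) (s 5) (s 6))"
    and params: "a \<in> N" "b \<in> N" "c \<in> N" "d \<in> N" "e \<in> N" "f \<in> N"
    and ex: "\<exists>x\<in>M. R x a b c d e f"
  shows "\<exists>x\<in>N. R x a b c d e f"
proof -
  let ?s = "case_nat a (case_nat b (case_nat c (case_nat d (case_nat e (\<lambda>_. f)))))"
  note num = eval_nat_numeral
  have s: "range ?s \<subseteq> N" using params by (intro range_case_nat) auto
  have "definable M (\<lambda>s. \<exists>x\<in>M. R x (s 0) (s 1) (s 2) (s 3) (s 4) (s 5))"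
    by (rule definable_ex) (use R in \<open>simp add: num\<close>)
  then obtain \<psi> where \<psi>: "\<And>s. range s \<subseteq> M \<Longrightarrow> sat M s \<psi> \<longleftrightarrow> (\<exists>x\<in>M. R x (s 0) (s 1) (s 2) (s 3) (s 4) (s 5))"
    unfolding definable_def by blast
  obtain \<phi> where \<phi>: "\<And>s. range s \<subseteq> M \<Longrightarrow> sat M s \<phi> \<longleftrightarrow> R (s 0) (s 1) (s 2) (s 3) (s 4) (s 5) (s 6)"
    using R unfolding definable_def by blast
  have NM: "N \<subseteq> M" using N unfolding elementary_submodel_def by blast
  have "sat M ?s (Neg (All (Neg \<phi>)))"
    using ex \<phi>[OF range_case_nat[of _ M ?s]] s NM by (auto simp: num subset_trans)
  then have "sat N ?s (Neg (All (Neg \<phi>)))"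
    using N s unfolding elementary_submodel_def by metis
  then obtain x where x: "x \<in> N" "sat N (case_nat x ?s) \<phi>" by auto
  have r: "range (case_nat x ?s) \<subseteq> N" by (rule range_case_nat[OF x(1) s])
  then have "sat M (case_nat x ?s) \<phi>" using N x(2) unfolding elementary_submodel_def by metis
  then show ?thesis using \<phi>[of "case_nat x ?s"] r NM x(1) by (auto simp: num subset_trans)
qed

lemma membership_iso_sat:
  assumes h: "membership_iso h N N'" and s: "range s \<subseteq> N"
  shows "sat N s \<phi> \<longleftrightarrow> sat N' (h \<circ> s) \<phi>"
  using s
proof (induction \<phi> arbitrary: s)
  case (Mem m n)
  then show ?case using h unfolding membership_iso_def by (simp add: image_subset_iff)
next
  case (Eq m n)
  then have "s m \<in> N" "s n \<in> N" by blast+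
  then show ?case using h unfolding membership_iso_def bij_betw_def by (auto dest: inj_onD)
next
  case (All \<phi>)
  have N': "N' = h ` N" using h unfolding membership_iso_def bij_betw_def by blast
  have "sat N (case_nat x s) \<phi> \<longleftrightarrow> sat N' (case_nat (h x) (h \<circ> s)) \<phi>" if "x \<in> N" for x
  proof -
    have "h \<circ> case_nat x s = case_nat (h x) (h \<circ> s)" by (auto simp: fun_eq_iff split: nat.split)
    then show ?thesis using All.IH[OF range_case_nat[OF that All.prems]] by simp
  qed
  then show ?case unfolding N' by (simp add: comp_def)
qed auto

text \<open>Truth passes from M down to N by elementarity, along h to N', and back up to M. Thus h
  preserves definable relations of M between elements of N although it acts on N alone.\<close>

lemma isomorphic_submodels_transfer:
  assumes N: "elementary_submodel N M" "elementary_submodel N' M" and h: "membership_iso h N N'"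
    and R: "definable M (\<lambda>s. R (s 0) (s 1) (s 2) (s 3) (s 4))"
    and params: "a \<in> N" "b \<in> N" "c \<in> N" "d \<in> N" "e \<in> N"
  shows "R (h a) (h b) (h c) (h d) (h e) \<longleftrightarrow> R a b c d e"
proof -
  let ?s = "case_nat a (case_nat b (case_nat c (case_nat d (\<lambda>_. e))))"
  note num = eval_nat_numeral
  have s: "range ?s \<subseteq> N" using params by (intro range_case_nat) auto
  have hN: "h ` N = N'" using h unfolding membership_iso_def bij_betw_def by blast
  then have hs: "range (h \<circ> ?s) \<subseteq> N'" using s by auto
  obtain \<phi> where \<phi>: "\<And>s. range s \<subseteq> M \<Longrightarrow> sat M s \<phi> \<longleftrightarrow> R (s 0) (s 1) (s 2) (s 3) (s 4)"
    using R unfolding definable_def by blast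
  have NM: "N \<subseteq> M" "N' \<subseteq> M" using N unfolding elementary_submodel_def by blast+
  have "R a b c d e \<longleftrightarrow> sat M ?s \<phi>" using \<phi>[of ?s] s NM by (simp add: num subset_trans)
  also have "\<dots> \<longleftrightarrow> sat N ?s \<phi>" using N(1) s unfolding elementary_submodel_def by metis
  also have "\<dots> \<longleftrightarrow> sat N' (h \<circ> ?s) \<phi>" by (rule membership_iso_sat[OF h s])
  also have "\<dots> \<longleftrightarrow> sat M (h \<circ> ?s) \<phi>" using N(2) hs unfolding elementary_submodel_def by metis
  also have "\<dots> \<longleftrightarrow> R (h a) (h b) (h c) (h d) (h e)"
    using \<phi>[of "h \<circ> ?s"] hs NM by (simp add: num subset_trans)
  finally show ?thesis by simp
qed

locale elementary_in_H = uncountable_H l for l :: "'v::set_universe" +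
  fixes N :: "'v set"
  assumes elementary: "elementary_submodel N H"
begin

lemma N_subset: "N \<subseteq> H"
  using elementary unfolding elementary_submodel_def by blast

lemmas witness = elementary_submodel_witness[OF elementary]

lemma pair_components_N:
  assumes "pair x y \<in> N"
  shows "x \<in> N" "y \<in> N"
proof -
  have xy: "x \<in> H" "y \<in> H" using assms N_subset pair_components by blast+
  have "\<exists>x'\<in>N. \<exists>y'\<in>H. pair x y = pair x' y'"
    by (rule witness[where R = "\<lambda>x' z _ _ _ _ _. \<exists>y'\<in>H. z = pair x' y'", OF _ assms assms assms assms assms assms])
      (use xy in \<open>intro definable_bounded_intros | blast\<close>)+
  then show "x \<in> N" by simp
  have "\<exists>y'\<in>N. \<exists>x'\<in>H. pair x y = pair x' y'"
    by (rule witness[where R = "\<lambda>y' z _ _ _ _ _. \<exists>x'\<in>H. z = pair x' y'", OF _ assms assms assms assms assms assms])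
      (use xy in \<open>intro definable_bounded_intros | blast\<close>)+
  then show "y \<in> N" by simp
qed

lemma zero_N: "zero \<in> N"
proof -
  obtain a where a: "a \<in> N" using elementary unfolding elementary_submodel_def by blast
  have "zero \<in> H" using a N_subset hereditary_subset[of a zero] by auto
  then have "\<exists>x\<in>H. \<forall>t\<in>elts x. t \<noteq> t" by (intro bexI) simp_all
  then have "\<exists>x\<in>N. \<forall>t\<in>elts x. t \<noteq> t"
    by (intro witness[where R = "\<lambda>x _ _ _ _ _ _. \<forall>t\<in>elts x. t \<noteq> t", OF _ a a a a a a])
      (intro definable_bounded_intros)
  then obtain x where x: "x \<in> N" "elts x = elts zero" by auto
  from x(1) show ?thesis unfolding extensionality[OF x(2)] .
qed

lemma insert_N:
  assumes x: "x \<in> N" and y: "y \<in> N"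
  shows "set_of (insert y (elts x)) \<in> N"
proof -
  have H: "x \<in> H" "y \<in> H" using assms N_subset by blast+
  have "\<exists>z\<in>H. \<forall>t\<in>H. t \<in> elts z \<longleftrightarrow> t \<in> elts x \<or> t = y"
    by (rule bexI[OF _ hereditary_insert[OF H]]) (auto simp: elts_insert)
  then have "\<exists>z\<in>N. \<forall>t\<in>H. t \<in> elts z \<longleftrightarrow> t \<in> elts x \<or> t = y"
    by (intro witness[where R = "\<lambda>z x y _ _ _ _. \<forall>t\<in>H. t \<in> elts z \<longleftrightarrow> t \<in> elts x \<or> t = y", OF _ x y y y y y])
      (intro definable_bounded_intros)
  then obtain z where z: "z \<in> N" "\<And>t. t \<in> H \<Longrightarrow> t \<in> elts z \<longleftrightarrow> t \<in> elts x \<or> t = y" by blast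
  have "elts z \<subseteq> H" "elts x \<subseteq> H" using z(1) N_subset H transitive_class by blast+
  then have "elts z = insert y (elts x)" using z(2) H by auto
  then have "z = set_of (insert y (elts x))" by (metis set_of_elts)
  then show ?thesis using z(1) by simp
qed

lemma finite_N: "finite F \<Longrightarrow> F \<subseteq> N \<Longrightarrow> set_of F \<in> N"
proof (induction F rule: finite_induct)
  case empty
  then show ?case using zero_N by (simp add: zero_def)
next
  case (insert y F)
  then have "elts (set_of F) = F" by (simp add: countable_finite)
  then show ?case using insert insert_N[of "set_of F" y] by simp
qed

text \<open>Elementarity provides e and r in N. The orbit T of e is a subset of c, hence in H, and
  it is closed under r, so it is all of c. Each step of the orbit stays in N, because the value of r
  at an element of N is unique.\<close>

lemma enumerated_subset_N:
  assumes c: "c \<in> N" and enum: "enumerated c"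
  shows "elts c \<subseteq> N"
proof -
  have cH: "c \<in> H" using c N_subset by blast
  define enum where "enum e r c \<longleftrightarrow> e \<in> elts c
     \<and> (\<forall>x\<in>H. \<forall>y\<in>H. \<forall>z\<in>H. pair x y \<in> elts r \<and> pair x z \<in> elts r \<longrightarrow> y = z)
     \<and> (\<forall>t\<in>H. e \<in> elts t \<and> (\<forall>x\<in>elts t. \<forall>y\<in>elts c. pair x y \<in> elts r \<longrightarrow> y \<in> elts t)
           \<longrightarrow> (\<forall>x\<in>elts c. x \<in> elts t))" for e r c
  have def_enum: "definable H (\<lambda>s. enum (s i) (s j) (s k))" for i j k
    unfolding enum_def by (intro definable_bounded_intros)
  have "\<exists>e\<in>H. \<exists>r\<in>H. enum e r c"
    using assms(2) transitive_class[OF cH] unfolding enumerated_def enum_def by blast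
  then have "\<exists>e\<in>N. \<exists>r\<in>H. enum e r c"
    by (intro witness[where R = "\<lambda>e c _ _ _ _ _. \<exists>r\<in>H. enum e r c", OF _ c c c c c c])
      (intro definable_bounded_intros def_enum)
  then obtain e where e: "e \<in> N" "\<exists>r\<in>H. enum e r c" by blast
  have "\<exists>r\<in>N. enum e r c"
    by (rule witness[where R = "\<lambda>r e c _ _ _ _. enum e r c", OF _ e(1) c c c c c]) (rule def_enum e(2))+
  then obtain r where r: "r \<in> N" "enum e r c" by blast
  then have ec: "e \<in> elts c" and func: "\<And>x y z. x \<in> H \<Longrightarrow> y \<in> H \<Longrightarrow> z \<in> H \<Longrightarrow> pair x y \<in> elts r \<Longrightarrow> pair x z \<in> elts r \<Longrightarrow> y = z"
    and cl: "\<And>t x. t \<in> H \<Longrightarrow> e \<in> elts t \<Longrightarrow> \<forall>x\<in>elts t. \<forall>y\<in>elts c. pair x y \<in> elts r \<longrightarrow> y \<in> elts t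
           \<Longrightarrow> x \<in> elts c \<Longrightarrow> x \<in> elts t"
    unfolding enum_def by blast+
  let ?S = "{(x, y). pair x y \<in> elts r \<and> y \<in> elts c}"
  define T where "T = {y. (e, y) \<in> ?S\<^sup>*}"
  have T: "T \<subseteq> elts c"
  proof
    fix y assume "y \<in> T"
    then have "(e, y) \<in> ?S\<^sup>*" unfolding T_def by simp
    then show "y \<in> elts c" by cases (use ec in auto)
  qed
  have eT: "elts (set_of T) = T" by (rule elts_set_of[OF separation[OF T]])
  have "elts c \<subseteq> T"
  proof
    fix x assume "x \<in> elts c"
    then have "x \<in> elts (set_of T)"
    proof (rule cl[rotated 3])
      show "set_of T \<in> H" by (rule hereditary_subset[OF cH]) (simp add: eT T)
      show "e \<in> elts (set_of T)" unfolding eT by (simp add: T_def)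
      show "\<forall>x\<in>elts (set_of T). \<forall>y\<in>elts c. pair x y \<in> elts r \<longrightarrow> y \<in> elts (set_of T)"
        unfolding eT by (auto simp: T_def intro: rtrancl.rtrancl_into_rtrancl)
    qed
    then show "x \<in> T" unfolding eT .
  qed
  moreover have "y \<in> N" if "(e, y) \<in> ?S\<^sup>*" for y
    using that
  proof (induction rule: rtrancl_induct)
    case base
    then show ?case by (rule e(1))
  next
    case (step x y)
    then have xy: "pair x y \<in> elts r" "y \<in> elts c" by simp_all
    have yH: "y \<in> H" by (rule transitive_class[OF cH xy(2)])
    then have "\<exists>y\<in>H. pair x y \<in> elts r" using xy(1) by blast
    then have "\<exists>y\<in>N. pair x y \<in> elts r"
      by (intro witness[where R = "\<lambda>y x r _ _ _ _. pair x y \<in> elts r", OF _ step.IH r(1) c c c c])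
        (intro definable_bounded_intros)
    then obtain y' where y': "y' \<in> N" "pair x y' \<in> elts r" by blast
    have "y' = y"
      by (rule func[of x]) (use step.IH y' yH xy N_subset in auto)
    then show ?case using y'(1) by simp
  qed
  ultimately show ?thesis unfolding T_def by blast
qed

lemma countable_subset_N:
  assumes "c \<in> N" "countable (elts c)"
  shows "elts c \<subseteq> N"
proof (cases "elts c = {}")
  case False
  then show ?thesis
    using enumerated_subset_N[OF assms(1)] countable_enumerated[OF _ assms(2)] assms(1) N_subset by blast
qed simp

end

locale isomorphic_submodels = Ni: elementary_in_H l Ni + Nj: elementary_in_H l Nj
  for l :: "'v::set_universe" and Ni Nj :: "'v set" +
  fixes h :: "'v \<Rightarrow> 'v"
  assumes iso: "membership_iso h Ni Nj"
begin

lemmas transfer_h = isomorphic_submodels_transfer[OF Ni.elementary Nj.elementary iso]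

lemma h_in: "x \<in> Ni \<Longrightarrow> h x \<in> Nj"
  using iso unfolding membership_iso_def bij_betw_def by blast

lemma h_inj: "x \<in> Ni \<Longrightarrow> y \<in> Ni \<Longrightarrow> h x = h y \<longleftrightarrow> x = y"
  using iso unfolding membership_iso_def bij_betw_def by (auto dest: inj_onD)

lemma h_mem: "x \<in> Ni \<Longrightarrow> y \<in> Ni \<Longrightarrow> h x \<in> elts (h y) \<longleftrightarrow> x \<in> elts y"
  using iso unfolding membership_iso_def by blast

lemma h_surj: "y \<in> Nj \<Longrightarrow> \<exists>x\<in>Ni. y = h x"
  using iso unfolding membership_iso_def bij_betw_def by blast

lemma h_pair:
  assumes "pair x y \<in> Ni"
  shows "h (pair x y) = pair (h x) (h y)"
proof -
  note xy = Ni.pair_components_N[OF assms]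
  have "h (pair x y) = pair (h x) (h y) \<longleftrightarrow> pair x y = pair x y"
    by (rule transfer_h[where R = "\<lambda>z x y _ _. z = pair x y", OF _ assms xy assms assms])
      (rule Ni.definable_is_pair)
  then show ?thesis by simp
qed

text \<open>By transfer \<open>h c\<close> is enumerated too, so its elements lie in Nj, the range
  of h. Both sets being contained in their models, h acts on c pointwise.\<close>

lemma h_countable:
  assumes c: "c \<in> Ni" "countable (elts c)"
  shows "elts (h c) = h ` elts c"
proof -
  have sub: "elts c \<subseteq> Ni" by (rule Ni.countable_subset_N[OF c])
  have "elts (h c) \<subseteq> Nj"
  \<comment> \<open>An enumeration starts at an element, so the empty set needs a formula of its
    own.\<close>
  proof (cases "elts c = {}")
    case True
    have "(\<forall>t\<in>elts (h c). t \<noteq> t) \<longleftrightarrow> (\<forall>t\<in>elts c. t \<noteq> t)"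
      by (rule transfer_h[where R = "\<lambda>c _ _ _ _. \<forall>t\<in>elts c. t \<noteq> t", OF _ c(1) c(1) c(1) c(1) c(1)])
        (intro Ni.definable_bounded_intros)
    then show ?thesis using True by auto
  next
    case False
    have "Ni.enumerated (h c) \<longleftrightarrow> Ni.enumerated c"
      by (rule transfer_h[where R = "\<lambda>c _ _ _ _. Ni.enumerated c", OF _ c(1) c(1) c(1) c(1) c(1)])
        (rule Ni.definable_enumerated)
    moreover have "Ni.enumerated c"
      using Ni.countable_enumerated[OF _ c(2) False] c(1) Ni.N_subset by blast
    ultimately show ?thesis using Nj.enumerated_subset_N[OF h_in[OF c(1)]] by blast
  qed
  then show ?thesis
    using h_surj h_mem[OF _ c(1)] sub by blast
qed

text \<open>By induction on membership: a countable ordinal in Ni is a subset of Ni, so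
  \<open>h_countable\<close> computes its image from elements that are already known to be
  fixed.\<close>

lemma h_omega1: "\<zeta> \<in> Ni \<Longrightarrow> \<zeta> \<in> elts omega1 \<Longrightarrow> h \<zeta> = \<zeta>"
proof (induction \<zeta> rule: elts_induct)
  case (step \<zeta>)
  note c = countable_elts_omega1[OF step.prems(2)]
  have "elts (h \<zeta>) = h ` elts \<zeta>" by (rule h_countable[OF step.prems(1) c])
  also have "\<dots> = elts \<zeta>"
    using step.IH Ni.countable_subset_N[OF step.prems(1) c] omega1_trans[OF step.prems(2)] by force
  finally show ?case by (rule extensionality)
qed

end


section \<open>Forcing statements about the generic filter\<close>

locale forcing_preorder =
  fixes P :: "'v::set_universe"
  assumes below_refl: "p \<in> carrier P \<Longrightarrow> below P p p"
    and below_trans: "below P r q \<Longrightarrow> below P q p \<Longrightarrow> below P r p"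
begin

lemma below_carrier: "below P q p \<Longrightarrow> q \<in> carrier P" "below P q p \<Longrightarrow> p \<in> carrier P"
  unfolding below_def by simp_all

lemma elts_check_name: "elts (check_name P x) = {pair (check_name P y) p | y p. y \<in> elts x \<and> p \<in> carrier P}"
proof -
  have "{pair z p | z p. z \<in> check_name P ` elts x \<and> p \<in> carrier P} \<in> range elts"
    unfolding carrier_def by (intro product_in_range_elts image_in_range_elts rangeI)
  moreover have "{pair z p | z p. z \<in> check_name P ` elts x \<and> p \<in> carrier P}
      = {pair (check_name P y) p | y p. y \<in> elts x \<and> p \<in> carrier P}" by blast
  ultimately show ?thesis by (subst check_name_unfold) simp
qed

lemma pair_in_check_name:
  "pair \<pi> s \<in> elts (check_name P x) \<longleftrightarrow> (\<exists>y\<in>elts x. \<pi> = check_name P y) \<and> s \<in> carrier P"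
  unfolding elts_check_name by auto

lemma forces_eq_check_name_refl: "p \<in> carrier P \<Longrightarrow> forces_eq P p (check_name P x) (check_name P x)"
proof (induction x arbitrary: p rule: elts_induct)
  case (step x)
  have *: "\<exists>q \<rho> t. below P q r \<and> pair \<rho> t \<in> elts (check_name P x) \<and> below P q t \<and> forces_eq P q \<pi> \<rho>"
      "\<exists>q \<rho> t. below P q r \<and> pair \<rho> t \<in> elts (check_name P x) \<and> below P q t \<and> forces_eq P q \<rho> \<pi>"
    if "pair \<pi> s \<in> elts (check_name P x)" "below P r s" for \<pi> s r
  proof -
    from that(1) obtain y where y: "y \<in> elts x" "\<pi> = check_name P y"
      unfolding pair_in_check_name by (elim conjE bexE)
    have r: "below P r r" using that(2) below_carrier(1) below_refl by blast
    moreover have "pair \<pi> s \<in> elts (check_name P x)" by (rule that(1))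
    moreover have "forces_eq P r \<pi> \<pi>" unfolding y(2) using step.IH[OF y(1)] below_carrier(1)[OF r] .
    ultimately show "\<exists>q \<rho> t. below P q r \<and> pair \<rho> t \<in> elts (check_name P x) \<and> below P q t \<and> forces_eq P q \<pi> \<rho>"
      "\<exists>q \<rho> t. below P q r \<and> pair \<rho> t \<in> elts (check_name P x) \<and> below P q t \<and> forces_eq P q \<rho> \<pi>"
      using that(2) by blast+
  qed
  show ?case by (rule forces_eqI[OF step.prems]) (rule *, assumption+)+
qed

text \<open>In a canonical name every element is paired with all conditions, in particular with p
  itself. Applying the clauses of forced equality at p matches each element of x with one of y and
  conversely.\<close>

lemma forces_eq_check_nameD: "forces_eq P p (check_name P x) (check_name P y) \<Longrightarrow> x = y"
proof (induction x arbitrary: p y rule: elts_induct)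
  case (step x)
  from step.prems have p: "p \<in> carrier P" by cases
  have l: "\<exists>q \<rho> t. below P q r \<and> pair \<rho> t \<in> elts (check_name P y) \<and> below P q t \<and> forces_eq P q \<pi> \<rho>"
    if "pair \<pi> s \<in> elts (check_name P x)" "below P r p" "below P r s" for \<pi> s r
    using step.prems by cases (use that in blast)
  have r: "\<exists>q \<pi> s. below P q r \<and> pair \<pi> s \<in> elts (check_name P x) \<and> below P q s \<and> forces_eq P q \<pi> \<rho>"
    if "pair \<rho> t \<in> elts (check_name P y)" "below P r p" "below P r t" for \<rho> t r
    using step.prems by cases (use that in blast)
  show ?case
  proof (intro extensionality equalityI subsetI)
    fix u assume u: "u \<in> elts x"
    then have "pair (check_name P u) p \<in> elts (check_name P x)" using p by (auto simp: pair_in_check_name)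
    from l[OF this below_refl[OF p] below_refl[OF p]] obtain q \<rho> t
      where q: "pair \<rho> t \<in> elts (check_name P y)" "forces_eq P q (check_name P u) \<rho>" by blast
    then obtain v where "v \<in> elts y" "\<rho> = check_name P v" using pair_in_check_name by blast
    then show "u \<in> elts y" using q(2) step.IH[OF u] by blast
  next
    fix v assume v: "v \<in> elts y"
    then have "pair (check_name P v) p \<in> elts (check_name P y)" using p by (auto simp: pair_in_check_name)
    from r[OF this below_refl[OF p] below_refl[OF p]] obtain q \<pi> s
      where q: "pair \<pi> s \<in> elts (check_name P x)" "forces_eq P q \<pi> (check_name P v)" by blast
    then obtain u where "u \<in> elts x" "\<pi> = check_name P u" using pair_in_check_name by blast
    then show "v \<in> elts x" using q(2) step.IH by blast
  qed
qed

lemma elts_generic_name: "elts (generic_name P) = {pair (check_name P p) p | p. p \<in> carrier P}"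
proof -
  have "(\<lambda>p. pair (check_name P p) p) ` carrier P \<in> range elts"
    unfolding carrier_def by (intro image_in_range_elts rangeI)
  moreover have "(\<lambda>p. pair (check_name P p) p) ` carrier P = {pair (check_name P p) p | p. p \<in> carrier P}" by blast
  ultimately show ?thesis unfolding generic_name_def by simp
qed

text \<open>By \<open>forces_eq_check_nameD\<close> the only member of the generic name that can be
  forced equal to the name of r is the one paired with r. What remains is density below p of the
  conditions below r; this does not require p to be below r.\<close>

lemma forces_mem_generic:
  assumes "r \<in> carrier P"
  shows "forces_mem P p (check_name P r) (generic_name P) \<longleftrightarrow>
    p \<in> carrier P \<and> (\<forall>p'. below P p' p \<longrightarrow> (\<exists>q. below P q p' \<and> below P q r))"
proof -
  have "(\<exists>q \<sigma> s. below P q p' \<and> pair \<sigma> s \<in> elts (generic_name P) \<and> below P q s \<and> forces_eq P q (check_name P r) \<sigma>)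
      \<longleftrightarrow> (\<exists>q. below P q p' \<and> below P q r)" (is "?L \<longleftrightarrow> ?R") for p'
  proof
    assume ?L
    then obtain q \<sigma> s where q: "below P q p'" "pair \<sigma> s \<in> elts (generic_name P)" "below P q s"
      "forces_eq P q (check_name P r) \<sigma>" by blast
    then have "\<sigma> = check_name P s" unfolding elts_generic_name by auto
    then have "r = s" using q(4) forces_eq_check_nameD by blast
    then show ?R using q(1,3) by blast
  next
    assume ?R
    then obtain q where q: "below P q p'" "below P q r" by blast
    moreover have "pair (check_name P r) r \<in> elts (generic_name P)"
      unfolding elts_generic_name using assms by blast
    moreover have "forces_eq P q (check_name P r) (check_name P r)"
      by (rule forces_eq_check_name_refl[OF below_carrier(1)[OF q(1)]])
    ultimately show ?L by blast
  qed
  then show ?thesis unfolding forces_mem_def by simp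
qed

lemma forces_mem_generic_below:
  assumes "below P p r"
  shows "forces_mem P p (check_name P r) (generic_name P)"
proof -
  have "\<exists>q. below P q p' \<and> below P q r" if "below P p' p" for p'
    using below_refl[OF below_carrier(1)[OF that]] below_trans[OF that assms] by blast
  then show ?thesis
    using forces_mem_generic[OF below_carrier(2)[OF assms]] below_carrier(1)[OF assms] by blast
qed

lemma forces_Imp:
  assumes "\<And>p. below P p q \<Longrightarrow> forces P p s \<phi> \<Longrightarrow> forces P p s \<psi>"
  shows "forces P q s (Imp \<phi> \<psi>)"
  unfolding Imp_def using assms below_refl below_carrier(1) by simp blast

text \<open>If q is below both conditions, everything below q forces both memberships; if q is
  incompatible with both, nothing below q forces either.\<close>

lemma forces_generic_iff:
  assumes r: "r \<in> carrier P" "r' \<in> carrier P"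
    and q: "below P q r \<and> below P q r' \<or> (\<forall>t. below P t q \<longrightarrow> \<not> below P t r \<and> \<not> below P t r')"
  shows "forces P q (case_nat (check_name P r) (case_nat (check_name P r') (\<lambda>_. generic_name P)))
     (Iff (Mem 0 2) (Mem 1 2))"
proof -
  let ?s = "case_nat (check_name P r) (case_nat (check_name P r') (\<lambda>_. generic_name P))"
  have s: "forces P p ?s (Mem 0 2) \<longleftrightarrow> forces_mem P p (check_name P r) (generic_name P)"
    "forces P p ?s (Mem 1 2) \<longleftrightarrow> forces_mem P p (check_name P r') (generic_name P)" for p
    by (simp_all add: eval_nat_numeral)
  have "forces_mem P p (check_name P r) (generic_name P) \<longleftrightarrow> forces_mem P p (check_name P r') (generic_name P)"
    if p: "below P p q" for p
    using q
  proof
    assume "below P q r \<and> below P q r'"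
    then show ?thesis using forces_mem_generic_below below_trans[OF p] by blast
  next
    assume neg: "\<forall>t. below P t q \<longrightarrow> \<not> below P t r \<and> \<not> below P t r'"
    have "below P p p" by (rule below_refl[OF below_carrier(1)[OF p]])
    then show ?thesis
      unfolding forces_mem_generic[OF r(1)] forces_mem_generic[OF r(2)]
      using neg below_trans[OF _ p] by blast
  qed
  then show ?thesis
    unfolding Iff_def forces.simps(4) by (intro conjI forces_Imp) (simp_all only: s)
qed

end


section \<open>The construction of the generic condition\<close>

lemma (in ideal_forcing) forcing_preorder_P: "forcing_preorder \<P>"
  by unfold_locales (auto simp: below_P_forcing extends_refl intro: extends_trans)

lemma (in ideal_forcing) in_first_P: "in_first p \<P> \<longleftrightarrow> cond p"
  unfolding P_forcing_def by (simp add: conditions_in_range_elts)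

lemma (in ideal_forcing) pair_in_second_P: "pair_in_second q p \<P> \<longleftrightarrow> cond q \<and> cond p \<and> extends A q p"
proof -
  have "\<P> = pair (first \<P>) (second \<P>)" by (simp add: P_forcing_def)
  then have "pair_in_second q p \<P> \<longleftrightarrow> pair q p \<in> elts (second \<P>)"
    unfolding pair_in_second_def by (metis in_second_pair)
  then show ?thesis unfolding elts_second_P_forcing by auto
qed

section \<open>The action of the isomorphism on conditions\<close>

locale pic_setting = ideal_forcing \<kappa> I A + isomorphic_submodels l Ni Nj h
  for \<kappa> :: "'v::set_universe" and I :: "'v \<Rightarrow> 'v set set" and A :: "'v \<Rightarrow> 'v \<Rightarrow> 'v set"
    and l :: 'v and Ni Nj :: "'v set" and h :: "'v \<Rightarrow> 'v" +
  assumes countable_Ni: "countable Ni"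
    and P_Ni: "\<P> \<in> Ni" and P_Nj: "\<P> \<in> Nj"
    and h_id: "x \<in> Ni \<Longrightarrow> x \<in> Nj \<Longrightarrow> h x = x"
begin

sublocale forcing_preorder \<P>
  by (rule forcing_preorder_P)

abbreviation "H \<equiv> hereditary l"

lemma h_P: "h \<P> = \<P>"
  by (rule h_id[OF P_Ni P_Nj])

lemma carrier_H: "cond p \<Longrightarrow> p \<in> H"
  using Ni.in_first_mem[of \<P> p] P_Ni Ni.N_subset in_first_P by blast

lemma cond_h: "p \<in> Ni \<Longrightarrow> cond (h p) \<longleftrightarrow> cond p"
  using transfer_h[where R = "\<lambda>p P _ _ _. in_first p P" and a = p and b = \<P> and c = \<P> and d = \<P> and e = \<P>]
  by (simp add: P_Ni h_P in_first_P Ni.definable_in_first)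

lemma extends_h: "p \<in> Ni \<Longrightarrow> q \<in> Ni \<Longrightarrow> cond p \<Longrightarrow> cond q \<Longrightarrow> extends A (h q) (h p) \<longleftrightarrow> extends A q p"
  using transfer_h[where R = "\<lambda>p q P _ _. pair_in_second q p P" and a = p and b = q and c = \<P> and d = \<P> and e = \<P>]
  by (simp add: P_Ni h_P pair_in_second_P Ni.definable_pair_in_second cond_h)

text \<open>Conditions belong to H, so a common extension may be sought there. Compatibility is then
  definable from \<open>\<P>\<close>, which h fixes.\<close>

lemma incompatible_h:
  assumes "p \<in> Ni" "r \<in> Ni"
  shows "(\<exists>t. below \<P> t (h p) \<and> below \<P> t (h r)) \<longleftrightarrow> (\<exists>t. below \<P> t p \<and> below \<P> t r)"
proof -
  have "definable H (\<lambda>s. \<exists>t\<in>H. pair_in_second t (s 0) (s 2) \<and> pair_in_second t (s 1) (s 2))"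
    by (intro Ni.definable_bounded_intros)
  then have "(\<exists>t\<in>H. pair_in_second t (h p) (h \<P>) \<and> pair_in_second t (h r) (h \<P>))
      \<longleftrightarrow> (\<exists>t\<in>H. pair_in_second t p \<P> \<and> pair_in_second t r \<P>)"
    using transfer_h[where R = "\<lambda>p r P _ _. \<exists>t\<in>H. pair_in_second t p P \<and> pair_in_second t r P"
        and a = p and b = r and c = \<P> and d = \<P> and e = \<P>] assms P_Ni by blast
  then show ?thesis
    unfolding h_P pair_in_second_P below_P_forcing using carrier_H by blast
qed

lemma condition_Ni:
  assumes "p \<in> Ni" "cond p"
  shows "first p \<in> Ni" "second p \<in> Ni" "elts (first p) \<subseteq> Ni" "elts (second p) \<subseteq> Ni"
proof -
  have "pair (first p) (second p) \<in> Ni" using is_condition_collapse[OF assms(2)] assms(1) by simp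
  note c = Ni.pair_components_N[OF this]
  show "first p \<in> Ni" "second p \<in> Ni" by (fact c)+
  show "elts (first p) \<subseteq> Ni"
    by (rule Ni.countable_subset_N[OF c(1) is_condition_countable_first[OF assms(2)]])
  have "countable (elts (second p))" by (rule is_condition_countable_second[OF assms(2)])
  then show "elts (second p) \<subseteq> Ni" by (rule Ni.countable_subset_N[OF c(2)])
qed

lemma condition_Nj:
  assumes "p \<in> Nj" "cond p"
  shows "elts (first p) \<subseteq> Nj"
proof -
  have "pair (first p) (second p) \<in> Nj" using is_condition_collapse[OF assms(2)] assms(1) by simp
  note c = Nj.pair_components_N[OF this]
  show ?thesis
    by (rule Nj.countable_subset_N[OF c(1) is_condition_countable_first[OF assms(2)]])
qed

lemma h_condition:
  assumes "p \<in> Ni" "cond p"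
  shows "elts (first (h p)) = h ` elts (first p)" "elts (second (h p)) = h ` elts (second p)"
proof -
  have p: "pair (first p) (second p) = p" using is_condition_collapse[OF assms(2)] by simp
  have "h p = pair (h (first p)) (h (second p))" using h_pair[of "first p" "second p"] assms(1) p by simp
  then have *: "first (h p) = h (first p)" "second (h p) = h (second p)" by simp_all
  have "countable (elts (second p))" by (rule is_condition_countable_second[OF assms(2)])
  then show "elts (second (h p)) = h ` elts (second p)"
    unfolding * by (rule h_countable[OF condition_Ni(2)[OF assms]])
  show "elts (first (h p)) = h ` elts (first p)"
    unfolding * by (rule h_countable[OF condition_Ni(1)[OF assms] is_condition_countable_first[OF assms(2)]])
qed

text \<open>The elements \<open>pair (pair \<xi> \<zeta>) e\<close> of \<open>a\<^sub>p\<close>: only the first coordinate is moved by \<open>h\<close>.\<close>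

lemma condition_entry:
  assumes "p \<in> Ni" "cond p" "z \<in> elts (first p)"
  obtains \<xi> \<zeta> e where "z = pair (pair \<xi> \<zeta>) e" "h z = pair (pair (h \<xi>) \<zeta>) e" "\<xi> \<in> Ni"
    "\<xi> \<in> elts \<kappa>" "h \<xi> \<in> elts \<kappa>" "\<zeta> \<in> elts omega1"
proof -
  from is_condition_first_elts[OF assms(2,3)] obtain \<xi> \<zeta> e
    where z: "z = pair (pair \<xi> \<zeta>) e" "\<xi> \<in> elts \<kappa>" "\<zeta> \<in> elts omega1" "e \<in> {zero, one}" .
  have zN: "pair (pair \<xi> \<zeta>) e \<in> Ni" using condition_Ni(3)[OF assms(1,2)] assms(3) z(1) by blast
  note 1 = Ni.pair_components_N[OF zN]
  note 2 = Ni.pair_components_N[OF 1(1)]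
  have "e \<in> elts omega1" using z(4) zero_in_omega1 one_in_omega1 by auto
  then have hz: "h z = pair (pair (h \<xi>) \<zeta>) e"
    unfolding z(1) h_pair[OF zN] h_pair[OF 1(1)] by (simp add: h_omega1 1 2 z(3))
  have "h z \<in> elts (first (h p))" unfolding h_condition(1)[OF assms(1,2)] using assms(3) by (rule imageI)
  moreover have "cond (h p)" using cond_h assms by simp
  ultimately obtain \<xi>' \<zeta>' e' where "h z = pair (pair \<xi>' \<zeta>') e'" "\<xi>' \<in> elts \<kappa>"
    using is_condition_first_elts by metis
  then have "h \<xi> \<in> elts \<kappa>" using hz by simp
  then show ?thesis using that z hz 2(1) by blast
qed

lemma column_h:
  assumes "p \<in> Ni" "cond p" "\<xi> \<in> Ni"
  shows "column (h p) (h \<xi>) = column p \<xi>"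
proof -
  have "pair (pair (h \<xi>) \<zeta>) one \<in> h ` elts (first p) \<longleftrightarrow> pair (pair \<xi> \<zeta>) one \<in> elts (first p)" for \<zeta>
  proof
    assume "pair (pair (h \<xi>) \<zeta>) one \<in> h ` elts (first p)"
    then obtain z where z: "z \<in> elts (first p)" "h z = pair (pair (h \<xi>) \<zeta>) one" by force
    obtain \<xi>' \<zeta>' e where *: "z = pair (pair \<xi>' \<zeta>') e" "h z = pair (pair (h \<xi>') \<zeta>') e" "\<xi>' \<in> Ni"
      by (rule condition_entry[OF assms(1,2) z(1)])
    then have "\<xi>' = \<xi>" "\<zeta>' = \<zeta>" "e = one" using z(2) h_inj[OF _ assms(3)] by simp_all
    then show "pair (pair \<xi> \<zeta>) one \<in> elts (first p)" using z(1) * by simp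
  next
    assume z: "pair (pair \<xi> \<zeta>) one \<in> elts (first p)"
    obtain \<xi>' \<zeta>' e where *: "pair (pair \<xi> \<zeta>) one = pair (pair \<xi>' \<zeta>') e"
      "h (pair (pair \<xi> \<zeta>) one) = pair (pair (h \<xi>') \<zeta>') e"
      by (rule condition_entry[OF assms(1,2) z])
    then have "pair (pair (h \<xi>) \<zeta>) one = h (pair (pair \<xi> \<zeta>) one)" by simp
    then show "pair (pair (h \<xi>) \<zeta>) one \<in> h ` elts (first p)" using z by (rule image_eqI)
  qed
  then show ?thesis unfolding column_def h_condition(1)[OF assms(1,2)] by simp
qed

text \<open>The sets \<open>C \<xi>\<close> need not belong to Ni. They enter only through the
  finite set g by which the columns of a reservoir x in Ni exceed them, and finite subsets of Ni are
  elements of Ni. Elementarity is used twice, first for x and then for q.\<close>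

lemma dense_meets_Ni:
  assumes p: "p \<in> Ni" "cond p" and D: "D \<in> Ni" "dense_in \<P> (elts D)"
    and w: "finite w" "w \<subseteq> Ni" "w \<subseteq> elts \<kappa>"
    and C: "\<And>\<xi> x. \<xi> \<in> w \<Longrightarrow> x \<in> Ni \<Longrightarrow> cond x \<Longrightarrow> column x \<xi> \<subseteq>\<^sup>* C \<xi>"
  shows "\<exists>q\<in>Ni. q \<in> elts D \<and> cond q \<and> extends A q p \<and> (\<forall>\<xi>\<in>w. column q \<xi> - column p \<xi> \<subseteq> C \<xi>)"
proof -
  define W where "W = set_of w"
  have W: "elts W = w" unfolding W_def by (simp add: w(1) countable_finite)
  have WN: "W \<in> Ni" unfolding W_def by (rule Ni.finite_N[OF w(1,2)])
  have oneH: "one \<in> H" using Ni.finite_N[of "{zero, zero}"] Ni.zero_N Ni.N_subset by (auto simp: one_def)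
  \<comment> \<open>The constant \<open>one\<close> is defined inside the formula, which saves a
    parameter.\<close>
  define entry where "entry \<xi> \<zeta> x \<longleftrightarrow> (\<exists>e\<in>H. e = one \<and> triple_in_first \<xi> \<zeta> e x)" for \<xi> \<zeta> x
  define small where "small q p x g W \<longleftrightarrow>
    (\<forall>\<xi>\<in>elts W. \<forall>\<zeta>\<in>H. entry \<xi> \<zeta> q \<and> \<not> entry \<xi> \<zeta> p \<longrightarrow> entry \<xi> \<zeta> x \<and> \<zeta> \<notin> elts g)" for q p x g W
  \<comment> \<open>\<open>finite_subset_oracle\<close> relativized to H: the finite subsets of
    omega1 are the values of promises of conditions.\<close>
  define fin where "fin g P \<longleftrightarrow> (\<exists>r\<in>H. \<exists>v\<in>H. \<exists>f\<in>H. \<exists>\<alpha>\<in>H.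
    in_first r P \<and> pair_in_second v f r \<and> pair \<alpha> g \<in> elts f)" for g P
  define good where "good x P D p W \<longleftrightarrow> in_first x P \<and>
    (\<forall>g\<in>H. fin g P \<longrightarrow> (\<exists>q\<in>elts D. pair_in_second q p P \<and> small q p x g W))" for x P D p W
  note defs = entry_def small_def fin_def good_def
  have entry: "entry \<xi> \<zeta> x \<longleftrightarrow> \<zeta> \<in> column x \<xi>" if "cond x" for \<xi> \<zeta> x
  proof -
    have "entry \<xi> \<zeta> x \<longleftrightarrow> pair (pair \<xi> \<zeta>) one \<in> elts (first x)"
      unfolding entry_def triple_in_first_def using oneH
      by (subst is_condition_collapse[OF that]) simp
    moreover have "\<zeta> \<in> elts omega1" if "pair (pair \<xi> \<zeta>) one \<in> elts (first x)"
      by (rule is_condition_first_elts[OF \<open>cond x\<close> that]) simp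
    ultimately show ?thesis unfolding column_def by blast
  qed
  have columnH: "column x \<xi> \<subseteq> H" if "cond x" for x \<xi>
  proof
    fix \<zeta> assume "\<zeta> \<in> column x \<xi>"
    then have "in_first (pair (pair \<xi> \<zeta>) one) x"
      unfolding column_def by (subst is_condition_collapse[OF that]) simp
    then have "pair (pair \<xi> \<zeta>) one \<in> H" by (rule Ni.in_first_mem[OF carrier_H[OF that]])
    then show "\<zeta> \<in> H" using Ni.pair_components by blast
  qed
  have small: "small q p x g W \<longleftrightarrow> (\<forall>\<xi>\<in>w. column q \<xi> - column p \<xi> \<subseteq> column x \<xi> - elts g)"
    if "cond q" "cond x" for q x g
    unfolding small_def W entry[OF that(1)] entry[OF that(2)] entry[OF p(2)]
    using columnH[OF that(1)] by blast
  have fin: "fin g \<P> \<longleftrightarrow> finite (elts g) \<and> elts g \<subseteq> elts omega1" for g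
  proof -
    have "fin g \<P> \<longleftrightarrow> (\<exists>r v f \<alpha>. cond r \<and> pair v f \<in> elts (second r) \<and> pair \<alpha> g \<in> elts f)" (is "_ \<longleftrightarrow> ?R")
    proof
      assume "fin g \<P>"
      then obtain r v f \<alpha> where *: "cond r" "pair_in_second v f r" "pair \<alpha> g \<in> elts f"
        unfolding fin_def in_first_P by blast
      have "pair v f \<in> elts (second r)"
        using *(2) unfolding pair_in_second_def by (subst (asm) is_condition_collapse[OF *(1)]) simp
      then show ?R using * by blast
    next
      assume ?R
      then obtain r v f \<alpha> where *: "cond r" "pair v f \<in> elts (second r)" "pair \<alpha> g \<in> elts f" by blast
      have rH: "r \<in> H" by (rule carrier_H[OF *(1)])
      have s: "in_second (pair v f) r" by (subst is_condition_collapse[OF *(1)]) (simp add: *(2))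
      have "pair v f \<in> H" by (rule Ni.in_second_mem[OF rH s])
      then have vf: "v \<in> H" "f \<in> H" using Ni.pair_components by blast+
      have "pair \<alpha> g \<in> H" by (rule Ni.transitive_class[OF vf(2) *(3)])
      then have "\<alpha> \<in> H" using Ni.pair_components by blast
      then show "fin g \<P>" unfolding fin_def in_first_P pair_in_second_def using * rH s vf by blast
    qed
    then show ?thesis unfolding finite_subset_oracle by simp
  qed
  have Dd: "elts D \<subseteq> Collect cond" "\<And>p. cond p \<Longrightarrow> \<exists>d\<in>elts D. extends A d p"
    using D(2) unfolding dense_in_def carrier_P_forcing below_P_forcing by blast+
  obtain x where x: "cond x" "\<And>g. finite g \<Longrightarrow> g \<subseteq> elts omega1 \<Longrightarrow>
    \<exists>q\<in>elts D. extends A q p \<and> (\<forall>\<xi>\<in>elts W. column q \<xi> - column p \<xi> \<subseteq> column x \<xi> - g)"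
    using dense_reservoir[OF p(2), of W "elts D"] w Dd(2) unfolding W by blast
  have "good x \<P> D p W"
    unfolding good_def in_first_P fin pair_in_second_P
  proof (intro conjI ballI impI x(1), elim conjE)
    fix g :: 'v assume "finite (elts g)" "elts g \<subseteq> elts omega1"
    from x(2)[OF this] obtain q where q: "q \<in> elts D" "extends A q p"
      "\<forall>\<xi>\<in>w. column q \<xi> - column p \<xi> \<subseteq> column x \<xi> - elts g" unfolding W by blast
    moreover from q(1) have "cond q" using Dd(1) by blast
    ultimately show "\<exists>q\<in>elts D. (cond q \<and> cond p \<and> extends A q p) \<and> small q p x g W"
      using small[OF _ x(1)] p(2) by blast
  qed
  then have "\<exists>x\<in>H. good x \<P> D p W" using carrier_H[OF x(1)] by blast
  \<comment> \<open>First use of elementarity: the reservoir, valid for all finite g, is moved into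
    Ni.\<close>
  then have "\<exists>x\<in>Ni. good x \<P> D p W"
    by (intro Ni.witness[where R = "\<lambda>x P D p W _ _. good x P D p W", OF _ P_Ni D(1) p(1) WN P_Ni P_Ni])
      (unfold defs, intro Ni.definable_bounded_intros)
  then obtain x where x: "x \<in> Ni" "good x \<P> D p W" by blast
  have cx: "cond x" using x(2) unfolding good_def in_first_P by blast
  \<comment> \<open>Finite by C, since x is now in Ni. As the columns of x are subsets of Ni, this g
    is available as a parameter.\<close>
  define g where "g = (\<Union>\<xi>\<in>w. column x \<xi> - C \<xi>)"
  have g: "finite g" using w(1) C[OF _ x(1) cx] unfolding g_def almost_subset_def by blast
  have "column x \<xi> \<subseteq> Ni" for \<xi>
  proof
    fix \<zeta> assume "\<zeta> \<in> column x \<xi>"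
    then have "pair (pair \<xi> \<zeta>) one \<in> Ni" using condition_Ni(3)[OF x(1) cx] unfolding column_def by blast
    then show "\<zeta> \<in> Ni" using Ni.pair_components_N by blast
  qed
  then have gN: "set_of g \<in> Ni" by (intro Ni.finite_N[OF g]) (auto simp: g_def)
  have eg: "elts (set_of g) = g" by (simp add: g countable_finite)
  have "g \<subseteq> elts omega1" unfolding g_def column_def by blast
  then have "fin (set_of g) \<P>" unfolding fin eg using g by blast
  then have "\<exists>q\<in>elts D. pair_in_second q p \<P> \<and> small q p x (set_of g) W"
    using x(2) gN Ni.N_subset unfolding good_def by blast
  moreover have "elts D \<subseteq> H" using Ni.transitive_class D(1) Ni.N_subset by blast
  ultimately have "\<exists>q\<in>H. q \<in> elts D \<and> pair_in_second q p \<P> \<and> small q p x (set_of g) W" by blast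
  \<comment> \<open>Second use of elementarity. New elements of q lie in the column of x minus g,
    hence in \<open>C \<xi>\<close>.\<close>
  then have "\<exists>q\<in>Ni. q \<in> elts D \<and> pair_in_second q p \<P> \<and> small q p x (set_of g) W"
    by (intro Ni.witness[where R = "\<lambda>q P D p W x g. q \<in> elts D \<and> pair_in_second q p P \<and> small q p x g W",
          OF _ P_Ni D(1) p(1) WN x(1) gN])
      (unfold defs, intro Ni.definable_bounded_intros)
  then obtain q where q: "q \<in> Ni" "q \<in> elts D" "cond q" "extends A q p" "small q p x (set_of g) W"
    unfolding pair_in_second_P by blast
  have "column q \<xi> - column p \<xi> \<subseteq> C \<xi>" if "\<xi> \<in> w" for \<xi>
    using q(5) that unfolding small[OF q(3) cx] eg by (auto simp: g_def)
  then show ?thesis using q by blast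
qed

text \<open>D consists of all conditions that are below r or incompatible with r. The formula
  \<open>dec\<close> determines it uniquely from \<open>\<P>\<close> and r, so elementarity puts it
  into Ni.\<close>

lemma decides_Ni:
  assumes "r \<in> Ni" "cond r"
  obtains D where "D \<in> Ni" "dense_in \<P> (elts D)"
    "\<And>s. s \<in> elts D \<Longrightarrow> below \<P> s r \<or> \<not> (\<exists>t. below \<P> t s \<and> below \<P> t r)"
proof -
  define dec where "dec D P r \<longleftrightarrow> (\<forall>s\<in>H. s \<in> elts D \<longleftrightarrow>
    in_first s P \<and> (pair_in_second s r P \<or> \<not> (\<exists>t\<in>H. pair_in_second t s P \<and> pair_in_second t r P)))" for D P r
  let ?X = "{s. cond s \<and> (below \<P> s r \<or> \<not> (\<exists>t. below \<P> t s \<and> below \<P> t r))}"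
  have dec: "dec D \<P> r \<longleftrightarrow> elts D = ?X" if "D \<in> H" for D
  proof -
    have e: "pair_in_second s r \<P> \<longleftrightarrow> below \<P> s r" for s r
      unfolding pair_in_second_P below_P_forcing by blast
    have "(\<exists>t\<in>H. below \<P> t s \<and> below \<P> t r) \<longleftrightarrow> (\<exists>t. below \<P> t s \<and> below \<P> t r)" for s
      using carrier_H unfolding below_P_forcing by blast
    moreover have "elts D \<subseteq> H" using Ni.transitive_class[OF that] by blast
    moreover have "?X \<subseteq> H" using carrier_H by blast
    ultimately show ?thesis unfolding dec_def in_first_P e by blast
  qed
  have PH: "\<P> \<in> H" using P_Ni Ni.N_subset by blast
  then have "pair (first \<P>) (second \<P>) \<in> H" by (simp add: P_forcing_def)
  then have fH: "first \<P> \<in> H" by (rule Ni.pair_components)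
  have X: "?X \<subseteq> elts (first \<P>)" using carrier_P_forcing[of \<kappa> I A] unfolding carrier_def by blast
  have eX: "elts (set_of ?X) = ?X" by (rule elts_set_of[OF separation[OF X]])
  \<comment> \<open>The set is a subset of the carrier, a component of \<open>\<P>\<close>, and H is
    closed under subsets.\<close>
  have XH: "set_of ?X \<in> H" by (rule Ni.hereditary_subset[OF fH]) (simp only: eX X)
  then have "\<exists>D\<in>H. dec D \<P> r" using dec[OF XH] eX by blast
  then have "\<exists>D\<in>Ni. dec D \<P> r"
    by (intro Ni.witness[where R = "\<lambda>D P r _ _ _ _. dec D P r", OF _ P_Ni assms(1) P_Ni P_Ni P_Ni P_Ni])
      (unfold dec_def, intro Ni.definable_bounded_intros)
  then obtain D where D: "D \<in> Ni" "dec D \<P> r" by blast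
  then have eD: "elts D = ?X" using dec Ni.N_subset by blast
  have "\<exists>d\<in>?X. below \<P> d p" if p: "cond p" for p
  proof (cases "\<exists>t. below \<P> t p \<and> below \<P> t r")
    case True
    then obtain t where t: "below \<P> t p" "below \<P> t r" by blast
    then have "t \<in> ?X" unfolding below_P_forcing by blast
    then show ?thesis using t by blast
  next
    case False
    then show ?thesis using p below_refl[of p] by auto
  qed
  then have "dense_in \<P> (elts D)" unfolding dense_in_def eD by auto
  then show ?thesis using that[OF D(1)] eD by blast
qed

end


lemma almost_subset_Diff:
  assumes "X \<subseteq>\<^sup>* B" "finite U"
  shows "X \<subseteq>\<^sup>* B - U"
proof -
  have "X - (B - U) \<subseteq> (X - B) \<union> U" by blast
  then show ?thesis
    using assms unfolding almost_subset_def by (metis finite_Un finite_subset)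
qed

section \<open>Bookkeeping and existence of the generic sequence\<close>

context pic_setting
begin

text \<open>A single enumeration lists the dense sets, the promises and the columns that have to be
  treated.\<close>

abbreviation enum_Ni :: "nat \<Rightarrow> 'v" where
  "enum_Ni \<equiv> from_nat_into Ni"

lemma enum_Ni: "x \<in> Ni \<Longrightarrow> \<exists>n. enum_Ni n = x"
  using countable_Ni by (metis from_nat_into_surj)

text \<open>It is not assumed that \<kappa> belongs to Ni, so h need not map the columns in Ni into
  \<kappa>. The columns occurring in conditions of Ni, and those mentioned in their promises, all
  lie in K.\<close>

definition K :: "'v set" where
  "K = {\<xi>\<in>Ni. \<xi> \<in> elts \<kappa> \<and> h \<xi> \<in> elts \<kappa>}"

definition stage :: "nat \<Rightarrow> 'v set" where
  "stage n = {\<xi>\<in>K. \<exists>k\<le>n. \<xi> = enum_Ni k}"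

lemma finite_stage: "finite (stage n)"
  by (rule finite_subset[of _ "enum_Ni ` {..n}"]) (auto simp: stage_def)

lemma stage_mono: "m \<le> n \<Longrightarrow> stage m \<subseteq> stage n"
  unfolding stage_def using le_trans by blast

lemma finite_subset_stage:
  assumes "finite F" "F \<subseteq> K"
  shows "\<exists>n. F \<subseteq> stage n"
  using assms
proof (induction F rule: finite_induct)
  case (insert \<xi> F)
  then obtain n where n: "F \<subseteq> stage n" by blast
  obtain k where k: "enum_Ni k = \<xi>" using enum_Ni[of \<xi>] insert.prems unfolding K_def by blast
  have "\<xi> \<in> stage (max n k)" using insert.prems k unfolding stage_def
    by (auto intro: exI[of _ k])
  moreover have "stage n \<subseteq> stage (max n k)" by (rule stage_mono) simp
  ultimately show ?case using n by blast
qed simp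

text \<open>One finite set protects both the promise z of p and its image under h. In the second
  half \<open>column q \<xi>\<close> stands for \<open>column (h q) (h \<xi>)\<close>, the same set
  by \<open>column_h\<close>.\<close>

definition keeps :: "'v \<Rightarrow> 'v set \<Rightarrow> 'v \<Rightarrow> 'v \<Rightarrow> 'v \<Rightarrow> bool" where
  "keeps \<gamma> E q p z \<longleftrightarrow> finite E \<and> (\<forall>v f. z = pair v f \<longrightarrow>
     (\<forall>r. elts (first q) \<subseteq> elts (first r) \<longrightarrow>
        (\<forall>\<xi>\<in>elts v. column r \<xi> - column q \<xi> \<subseteq> A \<xi> \<gamma> - E) \<longrightarrow> uncountable (Y_set A v f r p))
     \<and> (\<forall>r. elts (first (h q)) \<subseteq> elts (first r) \<longrightarrow>
        (\<forall>\<xi>\<in>elts v. column r (h \<xi>) - column q \<xi> \<subseteq> A (h \<xi>) \<gamma> - E) \<longrightarrow>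
        uncountable (Y_set A (h v) (h f) r (h p))))"

lemma promise_Ni:
  assumes p: "p \<in> Ni" "cond p" and vf: "pair v f \<in> elts (second p)"
  shows "pair v f \<in> Ni" "pair (h v) (h f) \<in> elts (second (h p))" "elts (h v) = h ` elts v" "elts v \<subseteq> K"
proof -
  show N: "pair v f \<in> Ni" using condition_Ni(4)[OF p] vf by (rule subsetD)
  have v: "v \<in> Ni" by (rule Ni.pair_components_N(1)[OF N])
  have c: "countable (elts v)" using is_condition_second_elts(2)[OF p(2) vf] by (rule countable_finite)
  show vf': "pair (h v) (h f) \<in> elts (second (h p))"
    unfolding h_condition(2)[OF p] h_pair[OF N, symmetric] using vf by (rule imageI)
  show hv: "elts (h v) = h ` elts v" by (rule h_countable[OF v c])
  have "cond (h p)" using p cond_h by simp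
  from is_condition_second_elts(1)[OF this vf'] have "h ` elts v \<subseteq> elts \<kappa>" unfolding hv .
  moreover have "elts v \<subseteq> elts \<kappa>" by (rule is_condition_second_elts(1)[OF p(2) vf])
  moreover have "elts v \<subseteq> Ni" by (rule Ni.countable_subset_N[OF v c])
  ultimately show "elts v \<subseteq> K" unfolding K_def by auto
qed

lemma keeps_exists:
  assumes \<gamma>: "\<gamma> \<in> elts omega1" and p: "p \<in> Ni" "cond p" and q: "q \<in> Ni" "cond q" "extends A q p"
    and z: "z \<in> elts (second p)"
  shows "\<exists>E. keeps \<gamma> E q p z"
proof -
  obtain v f where vf: "z = pair v f" using p(2) z unfolding is_condition_iff by (elim conjE ballE[of _ _ z]) auto
  note zp = z[unfolded vf]
  note h = promise_Ni[OF p zp]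
  obtain E1 where E1: "finite E1"
    "\<forall>r. elts (first q) \<subseteq> elts (first r) \<longrightarrow>
       (\<forall>\<xi>\<in>elts v. column r \<xi> - column q \<xi> \<subseteq> A \<xi> \<gamma> - E1) \<longrightarrow> uncountable (Y_set A v f r p)"
    using promise_kept_by_finite_set[OF p(2) q(3) zp \<gamma>] by blast
  have hp: "cond (h p)" "extends A (h q) (h p)" using p q cond_h extends_h by simp_all
  obtain E2 where E2: "finite E2"
    "\<forall>r. elts (first (h q)) \<subseteq> elts (first r) \<longrightarrow>
       (\<forall>\<xi>\<in>elts (h v). column r \<xi> - column (h q) \<xi> \<subseteq> A \<xi> \<gamma> - E2) \<longrightarrow>
       uncountable (Y_set A (h v) (h f) r (h p))"
    using promise_kept_by_finite_set[OF hp h(2) \<gamma>] by blast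
  have "keeps \<gamma> (E1 \<union> E2) q p (pair v f)"
    unfolding keeps_def
  proof (intro conjI allI impI, goal_cases)
    case 1
    show ?case using E1(1) E2(1) by simp
  next
    case (2 v' f' r)
    then have "v' = v" "f' = f" "\<forall>\<xi>\<in>elts v'. column r \<xi> - column q \<xi> \<subseteq> A \<xi> \<gamma> - E1" by auto
    then show ?case using E1(2) 2(2) by simp
  next
    case (3 v' f' r)
    then have e: "v' = v" "f' = f" by simp_all
    have "column r \<xi> - column (h q) \<xi> \<subseteq> A \<xi> \<gamma> - E2" if \<xi>: "\<xi> \<in> elts (h v)" for \<xi>
    proof -
      obtain \<eta> where \<eta>: "\<eta> \<in> elts v" "\<xi> = h \<eta>" using \<xi> unfolding h(3) by blast
      have "\<eta> \<in> Ni" using \<eta>(1) h(4) unfolding K_def by blast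
      then show ?thesis using 3(3) \<eta> unfolding e \<eta>(2) column_h[OF q(1,2) \<open>\<eta> \<in> Ni\<close>] by auto
    qed
    then show ?case unfolding e using E2(2) 3(2) by simp
  qed
  then show ?thesis unfolding vf by blast
qed

text \<open>The default makes the value finite for all arguments, so \<open>reserve\<close> makes
  sense for arbitrary sequences, as the recursion requires.\<close>

definition finite_part :: "'v \<Rightarrow> 'v \<Rightarrow> 'v \<Rightarrow> 'v \<Rightarrow> 'v set" where
  "finite_part \<gamma> q p z = (if \<exists>E. keeps \<gamma> E q p z then SOME E. keeps \<gamma> E q p z else {})"

lemma finite_part_keeps:
  assumes "\<exists>E. keeps \<gamma> E q p z"
  shows "keeps \<gamma> (finite_part \<gamma> q p z) q p z"
  unfolding finite_part_def if_P[OF assms] by (rule someI_ex[OF assms])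

lemma finite_finite_part: "finite (finite_part \<gamma> q p z)"
proof (cases "\<exists>E. keeps \<gamma> E q p z")
  case True
  from finite_part_keeps[OF this] show ?thesis unfolding keeps_def by (rule conjunct1)
next
  case False
  then show ?thesis unfolding finite_part_def by simp
qed

text \<open>The union runs over all a, b, k up to n: it covers the promise with number k of
  \<open>p b\<close>, judged from \<open>p a\<close>. Triples without this meaning remove only
  finitely many points, and the sets decrease with n.\<close>

definition reserve :: "'v \<Rightarrow> (nat \<Rightarrow> 'v) \<Rightarrow> nat \<Rightarrow> 'v \<Rightarrow> 'v set" where
  "reserve \<gamma> p n \<xi> = A \<xi> \<gamma> \<inter> A (h \<xi>) \<gamma>
     - (\<Union>a\<in>{..n}. \<Union>b\<in>{..n}. \<Union>k\<in>{..n}. finite_part \<gamma> (p a) (p b) (enum_Ni k))"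

lemma reserve_antimono: "m \<le> n \<Longrightarrow> reserve \<gamma> p n \<xi> \<subseteq> reserve \<gamma> p m \<xi>"
  unfolding reserve_def by (intro Diff_mono UN_mono) auto

text \<open>\<open>column x \<xi>\<close> is also \<open>column (h x) (h \<xi>)\<close>, so it
  belongs to both \<open>I \<xi>\<close> and \<open>I (h \<xi>)\<close>. As K and Ni are countable,
  \<open>countably_many_bounded\<close> covers all these requirements at once.\<close>

lemma bounding_ordinal:
  obtains \<gamma> where "\<gamma> \<in> elts omega1"
    "\<And>\<xi> x. \<xi> \<in> K \<Longrightarrow> x \<in> Ni \<Longrightarrow> cond x \<Longrightarrow> column x \<xi> \<subseteq>\<^sup>* A \<xi> \<gamma> \<inter> A (h \<xi>) \<gamma>"
proof -
  define S where "S = K \<times> {x\<in>Ni. cond x}"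
  define C where "C = (\<lambda>(\<xi>, x). (\<xi>, column x \<xi>)) ` S \<union> (\<lambda>(\<xi>, x). (h \<xi>, column x \<xi>)) ` S"
  have "countable K" "countable {x\<in>Ni. cond x}"
    by (rule countable_subset[OF _ countable_Ni]; auto simp: K_def)+
  then have "countable C" unfolding C_def S_def by simp
  moreover have "\<xi> \<in> elts \<kappa> \<and> X \<in> I \<xi>" if \<xi>X: "(\<xi>, X) \<in> C" for \<xi> X
  proof -
    from \<xi>X consider (1) x where "\<xi> \<in> K" "x \<in> Ni" "cond x" "X = column x \<xi>"
      | (2) \<eta> x where "\<eta> \<in> K" "x \<in> Ni" "cond x" "\<xi> = h \<eta>" "X = column x \<eta>"
      unfolding C_def S_def by auto
    then show ?thesis
    proof cases
      case 1
      then have "\<xi> \<in> elts \<kappa>" unfolding K_def by simp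
      then show ?thesis using column_in_ideal[OF 1(3)] 1(4) by simp
    next
      case 2
      then have "h \<eta> \<in> elts \<kappa>" "\<eta> \<in> Ni" unfolding K_def by simp_all
      moreover have "column x \<eta> = column (h x) (h \<eta>)" by (rule column_h[OF 2(2,3) \<open>\<eta> \<in> Ni\<close>, symmetric])
      moreover have "cond (h x)" using 2(2,3) cond_h by simp
      ultimately show ?thesis using column_in_ideal 2(4,5) by simp
    qed
  qed
  ultimately obtain \<gamma> where \<gamma>: "\<gamma> \<in> elts omega1" "\<And>\<xi> X. (\<xi>, X) \<in> C \<Longrightarrow> X \<subseteq>\<^sup>* A \<xi> \<gamma>"
    using countably_many_bounded by blast
  have "column x \<xi> \<subseteq>\<^sup>* A \<xi> \<gamma> \<inter> A (h \<xi>) \<gamma>" if "\<xi> \<in> K" "x \<in> Ni" "cond x" for \<xi> x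
  proof -
    have "(\<xi>, x) \<in> S" using that unfolding S_def by simp
    then have "(\<xi>, column x \<xi>) \<in> C" "(h \<xi>, column x \<xi>) \<in> C" unfolding C_def by force+
    from this[THEN \<gamma>(2)] show ?thesis unfolding almost_subset_def by (simp add: Diff_Int)
  qed
  then show ?thesis by (rule that[OF \<gamma>(1)])
qed

end

locale generic_sequence = pic_setting \<kappa> I A l Ni Nj h
  for \<kappa> :: "'v::set_universe" and I :: "'v \<Rightarrow> 'v set set" and A :: "'v \<Rightarrow> 'v \<Rightarrow> 'v set"
    and l :: 'v and Ni Nj :: "'v set" and h :: "'v \<Rightarrow> 'v" +
  fixes \<gamma> :: 'v and p :: "nat \<Rightarrow> 'v"
  assumes \<gamma>: "\<gamma> \<in> elts omega1"
    and p_Ni: "p n \<in> Ni" and p_cond: "cond (p n)"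
    and p_Suc: "extends A (p (Suc n)) (p n)"
    and p_dense: "dense_in \<P> (elts (enum_Ni n)) \<Longrightarrow> p (Suc n) \<in> elts (enum_Ni n)"
    and p_reserve: "\<xi> \<in> stage n \<Longrightarrow> column (p (Suc n)) \<xi> - column (p n) \<xi> \<subseteq> reserve \<gamma> p n \<xi>"

lemma (in pic_setting) generic_sequence_exists:
  assumes "p0 \<in> Ni" "cond p0"
  shows "\<exists>\<gamma> p. generic_sequence \<kappa> I A l Ni Nj h \<gamma> p \<and> p 0 = p0"
proof -
  obtain \<gamma> where \<gamma>: "\<gamma> \<in> elts omega1"
    "\<And>\<xi> x. \<xi> \<in> K \<Longrightarrow> x \<in> Ni \<Longrightarrow> cond x \<Longrightarrow> column x \<xi> \<subseteq>\<^sup>* A \<xi> \<gamma> \<inter> A (h \<xi>) \<gamma>"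
    by (rule bounding_ordinal) blast
  define step where "step f m r \<longleftrightarrow> r \<in> Ni \<and> cond r \<and> extends A r (f m)
    \<and> (dense_in \<P> (elts (enum_Ni m)) \<longrightarrow> r \<in> elts (enum_Ni m))
    \<and> (\<forall>\<xi>\<in>stage m. column r \<xi> - column (f m) \<xi> \<subseteq> reserve \<gamma> f m \<xi>)" for f m r
  define Q where "Q f n r \<longleftrightarrow> (case n of 0 \<Rightarrow> r = p0 | Suc m \<Rightarrow> step f m r)" for f n r
  have Ni_ne: "Ni \<noteq> {}" using assms(1) by blast
  have ex: "\<exists>r. step f m r" if f: "f m \<in> Ni" "cond (f m)" for f m
  proof -
    \<comment> \<open>If the set with number m is not dense, the whole carrier takes its place, so
      that \<open>dense_meets_Ni\<close> applies at every step.\<close>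
    define D where "D = (if dense_in \<P> (elts (enum_Ni m)) then enum_Ni m else first \<P>)"
    have "pair (first \<P>) (second \<P>) \<in> Ni" using P_Ni by (simp add: P_forcing_def)
    then have "first \<P> \<in> Ni" by (rule Ni.pair_components_N)
    then have D: "D \<in> Ni" unfolding D_def using from_nat_into[OF Ni_ne] by simp
    have "dense_in \<P> (carrier \<P>)" unfolding dense_in_def using below_refl by blast
    then have Dd: "dense_in \<P> (elts D)" unfolding D_def carrier_def by simp
    have "column x \<xi> \<subseteq>\<^sup>* reserve \<gamma> f m \<xi>" if "\<xi> \<in> stage m" "x \<in> Ni" "cond x" for \<xi> x
    proof -
      have "\<xi> \<in> K" using that(1) unfolding stage_def by simp
      have "finite (\<Union>a\<in>{..m}. \<Union>b\<in>{..m}. \<Union>k\<in>{..m}. finite_part \<gamma> (f a) (f b) (enum_Ni k))"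
        by (intro finite_UN_I finite_finite_part) simp_all
      then show ?thesis
        unfolding reserve_def by (rule almost_subset_Diff[OF \<gamma>(2)[OF \<open>\<xi> \<in> K\<close> that(2,3)]])
    qed
    then have "\<exists>q\<in>Ni. q \<in> elts D \<and> cond q \<and> extends A q (f m)
        \<and> (\<forall>\<xi>\<in>stage m. column q \<xi> - column (f m) \<xi> \<subseteq> reserve \<gamma> f m \<xi>)"
      by (intro dense_meets_Ni[OF f D Dd finite_stage]) (auto simp: stage_def K_def)
    then obtain q where "q \<in> Ni" "q \<in> elts D" "cond q" "extends A q (f m)"
      "\<forall>\<xi>\<in>stage m. column q \<xi> - column (f m) \<xi> \<subseteq> reserve \<gamma> f m \<xi>" by blast
    then have "step f m q" unfolding step_def D_def by (simp split: if_splits)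
    then show ?thesis by blast
  qed
  \<comment> \<open>A step consults all earlier values through \<open>reserve\<close>, so the choice
    is made by well-founded recursion; its compatibility condition says that only values below n
    matter.\<close>
  have "\<exists>f. \<forall>n. Q f n (f n)"
  proof (rule dependent_wf_choice[OF wf_less])
    fix f g :: "nat \<Rightarrow> 'v" and n r
    assume eq: "\<And>z. (z, n) \<in> {(x, y). x < y} \<Longrightarrow> f z = g z"
    show "Q f n r = Q g n r"
    proof (cases n)
      case (Suc m)
      have fg: "f a = g a" if "a \<le> m" for a using eq[of a] that Suc by simp
      then have "reserve \<gamma> f m \<xi> = reserve \<gamma> g m \<xi>" for \<xi> unfolding reserve_def by simp
      then show ?thesis unfolding Q_def Suc step_def using fg[of m] by simp
    qed (simp add: Q_def)
  next
    fix n and f :: "nat \<Rightarrow> 'v"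
    assume IH: "\<And>y. (y, n) \<in> {(x, y). x < y} \<Longrightarrow> Q f y (f y)"
    show "\<exists>r. Q f n r"
    proof (cases n)
      case (Suc m)
      have "Q f m (f m)" by (rule IH) (simp add: Suc)
      then have "f m \<in> Ni" "cond (f m)"
        unfolding Q_def step_def using assms by (auto split: nat.splits)
      from ex[of f, OF this] show ?thesis unfolding Q_def Suc by simp
    qed (simp add: Q_def)
  qed
  then obtain p where p: "\<And>n. Q p n (p n)" by blast
  have p0: "p 0 = p0" using p[of 0] by (simp add: Q_def)
  have pS: "step p n (p (Suc n))" for n using p[of "Suc n"] by (simp add: Q_def)
  have pN: "p n \<in> Ni \<and> cond (p n)" for n
    using assms p0 pS unfolding step_def by (cases n) auto
  have "generic_sequence \<kappa> I A l Ni Nj h \<gamma> p"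
    by unfold_locales (use \<gamma>(1) pN pS in \<open>simp_all add: step_def\<close>)
  then show ?thesis using p0 by blast
qed

section \<open>The limit condition\<close>

context generic_sequence
begin

lemma p_extends: "m \<le> n \<Longrightarrow> extends A (p n) (p m)"
proof (induction n rule: dec_induct)
  case base
  show ?case by (rule extends_refl[OF p_cond])
next
  case (step n)
  show ?case by (rule extends_trans[OF p_Suc step.IH])
qed

lemma hp_cond: "cond (h (p n))"
  using cond_h[OF p_Ni] p_cond by blast

lemma hp_Nj: "h (p n) \<in> Nj"
  by (rule h_in[OF p_Ni])

lemma p_reserve_mono:
  assumes "m \<le> n" "\<xi> \<in> stage m"
  shows "column (p n) \<xi> - column (p m) \<xi> \<subseteq> reserve \<gamma> p m \<xi>"
  using assms(1)
proof (induction n rule: dec_induct)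
  case (step n)
  have "\<xi> \<in> stage n" using stage_mono[OF step.hyps(1)] assms(2) by blast
  from p_reserve[OF this] reserve_antimono[OF step.hyps(1)]
  have "column (p (Suc n)) \<xi> - column (p n) \<xi> \<subseteq> reserve \<gamma> p m \<xi>" by (rule order_trans)
  then show ?case using step.IH by blast
qed simp

definition F :: "'v set" where
  "F = (\<Union>n. elts (first (p n)))"

definition X :: "'v \<Rightarrow> 'v set" where
  "X \<xi> = (\<Union>n. column (p n) \<xi>)"

definition S :: "'v set" where
  "S = range p \<union> range (\<lambda>n. h (p n))"

definition lim_first :: 'v where
  "lim_first = set_of (F \<union> h ` F)"

text \<open>\<open>Y_set\<close> sees a condition only through its columns, so
  \<open>pair lim_first zero\<close> can stand for the limit before its second component exists. The
  restricted promises over members of S are exactly those which extension of these members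
  demands.\<close>

definition lim_second :: 'v where
  "lim_second = set_of ((\<Union>r\<in>S. elts (second r)) \<union>
     (\<Union>r\<in>S. (\<lambda>z. pair (first z) (restriction (second z) (Y_set A (first z) (second z) (pair lim_first zero) r)))
        ` elts (second r)))"

definition lim :: 'v where
  "lim = pair lim_first lim_second"

lemma S_cond: "r \<in> S \<Longrightarrow> cond r"
  using p_cond hp_cond unfolding S_def by auto

lemma entry_F:
  assumes "z \<in> F"
  obtains \<xi> \<zeta> e where "z = pair (pair \<xi> \<zeta>) e" "h z = pair (pair (h \<xi>) \<zeta>) e" "\<xi> \<in> Ni"
    "\<xi> \<in> elts \<kappa>" "h \<xi> \<in> elts \<kappa>" "\<zeta> \<in> elts omega1"
proof -
  obtain n where "z \<in> elts (first (p n))" using assms unfolding F_def by blast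
  from condition_entry[OF p_Ni p_cond this] show ?thesis using that .
qed

lemma F_Ni: "F \<subseteq> Ni"
  unfolding F_def using condition_Ni(3)[OF p_Ni p_cond] by blast

lemma hF: "h ` F = (\<Union>n. elts (first (h (p n))))"
  unfolding F_def h_condition(1)[OF p_Ni p_cond] by blast

lemma hF_Nj: "h ` F \<subseteq> Nj"
  unfolding hF using condition_Nj[OF hp_Nj hp_cond] by blast

text \<open>An entry of the image lies in Nj, so its column \<xi> lies in both models and is fixed
  by h. By injectivity the entry comes from column \<xi> of F, and there h moves nothing.\<close>

lemma F_overlap:
  assumes "pair (pair \<xi> \<zeta>) e \<in> h ` F" "\<xi> \<in> Ni"
  shows "pair (pair \<xi> \<zeta>) e \<in> F"
proof -
  obtain z where z: "z \<in> F" "pair (pair \<xi> \<zeta>) e = h z" using assms(1) by blast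
  obtain \<xi>' \<zeta>' e' where *: "z = pair (pair \<xi>' \<zeta>') e'" "h z = pair (pair (h \<xi>') \<zeta>') e'" "\<xi>' \<in> Ni"
    by (rule entry_F[OF z(1)])
  have "pair (pair \<xi> \<zeta>) e \<in> Nj" using assms(1) hF_Nj by (rule rev_subsetD)
  then have "\<xi> \<in> Nj" by (rule Nj.pair_components_N(1)[OF Nj.pair_components_N(1)])
  then have "h \<xi> = \<xi>" by (rule h_id[OF assms(2)])
  then have "\<xi>' = \<xi>" using z(2) *(2) h_inj[OF *(3) assms(2)] by simp
  then show ?thesis using z * by simp
qed

text \<open>An entry from the image is pulled back along h. An entry from F has its column
  \<open>h \<xi>\<close> in both models, so \<open>h \<xi>\<close> is fixed and equals
  \<xi>.\<close>

lemma hF_shift: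
  assumes "pair (pair (h \<xi>) \<zeta>) e \<in> F \<union> h ` F" "\<xi> \<in> Ni"
  shows "pair (pair \<xi> \<zeta>) e \<in> F"
proof (cases "pair (pair (h \<xi>) \<zeta>) e \<in> h ` F")
  case True
  then obtain z where z: "z \<in> F" "pair (pair (h \<xi>) \<zeta>) e = h z" by blast
  obtain \<xi>' \<zeta>' e' where *: "z = pair (pair \<xi>' \<zeta>') e'" "h z = pair (pair (h \<xi>') \<zeta>') e'" "\<xi>' \<in> Ni"
    by (rule entry_F[OF z(1)])
  have "\<xi>' = \<xi>" "\<zeta>' = \<zeta>" "e' = e" using z(2) *(2) h_inj[OF *(3) assms(2)] by simp_all
  then show ?thesis using z(1) unfolding *(1) by simp
next
  case False
  then have F: "pair (pair (h \<xi>) \<zeta>) e \<in> F" using assms(1) by blast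
  then have "pair (pair (h \<xi>) \<zeta>) e \<in> Ni" using F_Ni by (rule rev_subsetD)
  then have "h \<xi> \<in> Ni" by (rule Ni.pair_components_N(1)[OF Ni.pair_components_N(1)])
  then have "h (h \<xi>) = h \<xi>" by (rule h_id[OF _ h_in[OF assms(2)]])
  then have "h \<xi> = \<xi>" using h_inj[OF \<open>h \<xi> \<in> Ni\<close> assms(2)] by simp
  then show ?thesis using F by simp
qed

lemma F_function:
  assumes "pair x y \<in> F" "pair x y' \<in> F"
  shows "y = y'"
proof -
  obtain m n where mn: "pair x y \<in> elts (first (p m))" "pair x y' \<in> elts (first (p n))"
    using assms unfolding F_def by blast
  have "pair x y \<in> elts (first (p (max m n)))" "pair x y' \<in> elts (first (p (max m n)))"
    using mn extends_first[OF p_extends[of m "max m n"]] extends_first[OF p_extends[of n "max m n"]] by auto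
  moreover have "is_function (first (p (max m n)))" using p_cond[of "max m n"] unfolding is_condition_iff by (elim conjE)
  ultimately show ?thesis unfolding is_function_def by blast
qed

lemma countable_F: "countable F"
  unfolding F_def using is_condition_countable_first[OF p_cond] by blast

lemma elts_lim_first: "elts lim_first = F \<union> h ` F"
  unfolding lim_first_def using countable_F by simp

lemma entry_lim:
  assumes "z \<in> F \<union> h ` F"
  obtains r where "r \<in> S" "z \<in> elts (first r)"
proof -
  from assms consider n where "z \<in> elts (first (p n))" | n where "z \<in> elts (first (h (p n)))"
    unfolding hF unfolding F_def by blast
  then show ?thesis
  proof cases
    case (1 n)
    show ?thesis by (rule that[OF _ 1]) (simp add: S_def)
  next
    case (2 n)
    show ?thesis by (rule that[OF _ 2]) (simp add: S_def)
  qed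
qed

text \<open>Conflicts are reduced to F, the union of an increasing sequence of functions:
  \<open>F_overlap\<close> treats an entry of F against one of its image, and
  \<open>hF_shift\<close> treats two entries of the image.\<close>

lemma is_function_lim_first: "is_function lim_first"
  unfolding is_function_def elts_lim_first
proof (intro conjI ballI allI impI)
  fix z assume "z \<in> F \<union> h ` F"
  then obtain r where r: "r \<in> S" "z \<in> elts (first r)" by (rule entry_lim)
  show "\<exists>x y. z = pair x y" by (rule is_condition_first_elts[OF S_cond[OF r(1)] r(2)]) blast
next
  have mixed: "y = y'" if y: "pair x y \<in> F" and y': "pair x y' \<in> h ` F" for x y y'
  proof -
    obtain \<xi> \<zeta> e where *: "pair x y = pair (pair \<xi> \<zeta>) e" "\<xi> \<in> Ni" by (rule entry_F[OF y])
    then have x: "x = pair \<xi> \<zeta>" by simp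
    have "pair x y' \<in> F" using y' *(2) unfolding x by (rule F_overlap)
    then show ?thesis by (rule F_function[OF y])
  qed
  have hh: "y = y'" if y: "pair x y \<in> h ` F" and y': "pair x y' \<in> h ` F" for x y y'
  proof -
    obtain z where z: "z \<in> F" "pair x y = h z" using y by blast
    obtain \<xi> \<zeta> e where *: "z = pair (pair \<xi> \<zeta>) e" "h z = pair (pair (h \<xi>) \<zeta>) e" "\<xi> \<in> Ni"
      by (rule entry_F[OF z(1)])
    then have x: "x = pair (h \<xi>) \<zeta>" "y = e" using z(2) by simp_all
    have "pair (pair \<xi> \<zeta>) y' \<in> F" using y' *(3) unfolding x(1) by (intro hF_shift) simp_all
    moreover have "pair (pair \<xi> \<zeta>) y \<in> F" using z(1) *(1) x(2) by simp
    ultimately show ?thesis using F_function by blast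
  qed
  fix x y y' assume "pair x y \<in> F \<union> h ` F \<and> pair x y' \<in> F \<union> h ` F"
  then show "y = y'" using F_function[of x y y'] mixed[of x y y'] mixed[of x y' y] hh[of x y y'] by blast
qed

lemma column_lim:
  assumes "\<xi> \<in> Ni"
  shows "column lim \<xi> = X \<xi>" "column lim (h \<xi>) = X \<xi>"
proof -
  have X: "X \<xi> = {\<zeta>\<in>elts omega1. pair (pair \<xi> \<zeta>) one \<in> F}"
    unfolding X_def column_def F_def by blast
  show "column lim \<xi> = X \<xi>"
    unfolding lim_def column_pair elts_lim_first X using F_overlap[OF _ assms] by blast
  have "pair (pair (h \<xi>) \<zeta>) one \<in> h ` F" if F: "pair (pair \<xi> \<zeta>) one \<in> F" for \<zeta>
  proof -
    obtain \<xi>' \<zeta>' e' where *: "pair (pair \<xi> \<zeta>) one = pair (pair \<xi>' \<zeta>') e'"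
      "h (pair (pair \<xi> \<zeta>) one) = pair (pair (h \<xi>') \<zeta>') e'"
      by (rule entry_F[OF F])
    then have "pair (pair (h \<xi>) \<zeta>) one = h (pair (pair \<xi> \<zeta>) one)" by simp
    then show ?thesis using F by (rule image_eqI)
  qed
  then show "column lim (h \<xi>) = X \<xi>"
    unfolding lim_def column_pair elts_lim_first X using hF_shift[OF _ assms] by blast
qed

lemma X_reserve:
  assumes "\<xi> \<in> stage n"
  shows "X \<xi> - column (p n) \<xi> \<subseteq> reserve \<gamma> p n \<xi>"
proof -
  have "column (p m) \<xi> - column (p n) \<xi> \<subseteq> reserve \<gamma> p n \<xi>" for m
  proof (cases "n \<le> m")
    case True
    then show ?thesis by (rule p_reserve_mono[OF _ assms])
  next
    case False
    then have "column (p m) \<xi> \<subseteq> column (p n) \<xi>"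
      by (intro column_mono extends_first[OF p_extends]) simp
    then show ?thesis by blast
  qed
  then show ?thesis unfolding X_def by blast
qed

text \<open>Once \<xi> has entered a stage, its column grows only inside
  \<open>A \<xi> \<gamma> \<inter> A (h \<xi>) \<gamma>\<close>. Both ideals matter, because
  \<open>X \<xi>\<close> is column \<xi> and also column \<open>h \<xi>\<close> of the
  limit.\<close>

lemma X_in_ideal:
  assumes "\<xi> \<in> K"
  shows "X \<xi> \<in> I \<xi>" "X \<xi> \<in> I (h \<xi>)"
proof -
  obtain n where n: "{\<xi>} \<subseteq> stage n" using finite_subset_stage[of "{\<xi>}"] assms by auto
  have \<xi>: "\<xi> \<in> Ni" "\<xi> \<in> elts \<kappa>" "h \<xi> \<in> elts \<kappa>" using assms unfolding K_def by simp_all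
  have X: "X \<xi> \<subseteq> column (p n) \<xi> \<union> (A \<xi> \<gamma> \<inter> A (h \<xi>) \<gamma>)"
    using X_reserve[of \<xi> n] n unfolding reserve_def by auto
  show "X \<xi> \<in> I \<xi>"
  proof (rule ideal_subset[OF \<xi>(2)])
    show "column (p n) \<xi> \<union> A \<xi> \<gamma> \<in> I \<xi>"
      by (intro ideal_Un column_in_ideal generating_in_ideal p_cond \<xi> \<gamma>)
    show "X \<xi> \<subseteq> column (p n) \<xi> \<union> A \<xi> \<gamma>" using X by auto
  qed
  show "X \<xi> \<in> I (h \<xi>)"
  proof (rule ideal_subset[OF \<xi>(3)])
    have "column (h (p n)) (h \<xi>) \<union> A (h \<xi>) \<gamma> \<in> I (h \<xi>)"
      by (intro ideal_Un column_in_ideal generating_in_ideal hp_cond \<xi> \<gamma>)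
    then show "column (p n) \<xi> \<union> A (h \<xi>) \<gamma> \<in> I (h \<xi>)" unfolding column_h[OF p_Ni p_cond \<xi>(1)] .
    show "X \<xi> \<subseteq> column (p n) \<xi> \<union> A (h \<xi>) \<gamma>" using X by auto
  qed
qed

text \<open>A nonempty column of the limit has an index in K or in the image of K, so
  \<open>X_in_ideal\<close> applies.\<close>

lemma column_lim_in_ideal:
  assumes "\<xi> \<in> elts \<kappa>"
  shows "column lim \<xi> \<in> I \<xi>"
proof (cases "column lim \<xi> = {}")
  case True
  then show ?thesis using ideal_finite[OF assms, of "{}"] by simp
next
  case False
  then obtain \<zeta> where "pair (pair \<xi> \<zeta>) one \<in> F \<union> h ` F"
    unfolding lim_def column_pair elts_lim_first by blast
  then consider "pair (pair \<xi> \<zeta>) one \<in> F" | z where "z \<in> F" "pair (pair \<xi> \<zeta>) one = h z" by blast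
  then show ?thesis
  proof cases
    case 1
    obtain \<xi>' \<zeta>' e' where *: "pair (pair \<xi> \<zeta>) one = pair (pair \<xi>' \<zeta>') e'" "\<xi>' \<in> Ni" "\<xi>' \<in> elts \<kappa>" "h \<xi>' \<in> elts \<kappa>"
      by (rule entry_F[OF 1])
    then have "\<xi> \<in> K" unfolding K_def by simp
    moreover from this have "\<xi> \<in> Ni" unfolding K_def by simp
    ultimately show ?thesis using X_in_ideal(1) column_lim(1) by simp
  next
    case 2
    obtain \<xi>' \<zeta>' e' where *: "h z = pair (pair (h \<xi>') \<zeta>') e'" "\<xi>' \<in> Ni" "\<xi>' \<in> elts \<kappa>" "h \<xi>' \<in> elts \<kappa>"
      by (rule entry_F[OF 2(1)])
    then have "\<xi>' \<in> K" unfolding K_def by simp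
    moreover have "\<xi> = h \<xi>'" using *(1) 2(2) by simp
    ultimately show ?thesis using X_in_ideal(2) column_lim(2)[OF *(2)] by simp
  qed
qed

text \<open>A promise and its image are protected together by \<open>keeps\<close>, so it suffices
  to treat promises of \<open>p n\<close>. A promise of \<open>h (p n)\<close> is the image of one
  of these.\<close>

lemma uncountable_Y_lim:
  assumes "r \<in> S" "pair v f \<in> elts (second r)"
  shows "uncountable (Y_set A v f lim r)"
proof -
  have main: "uncountable (Y_set A v f lim (p n)) \<and> uncountable (Y_set A (h v) (h f) lim (h (p n)))"
    if vf: "pair v f \<in> elts (second (p n))" for v f n
  proof -
    note v = promise_Ni[OF p_Ni p_cond vf]
    obtain k where k: "enum_Ni k = pair v f" using enum_Ni[OF v(1)] by blast
    obtain m' where m': "elts v \<subseteq> stage m'"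
      using finite_subset_stage[OF is_condition_second_elts(2)[OF p_cond vf] v(4)] by blast
    \<comment> \<open>From m on, the promise itself exists, its number k is among those respected by
      \<open>reserve\<close>, and all columns in v are controlled. Hence everything added after
      \<open>p m\<close> avoids E.\<close>
    define m where "m = max n (max k m')"
    have "n \<le> m" "k \<le> m" "m' \<le> m" unfolding m_def by simp_all
    note m = this(1,2) subset_trans[OF m' stage_mono[OF this(3)]]
    define E where "E = finite_part \<gamma> (p m) (p n) (pair v f)"
    have keeps: "keeps \<gamma> E (p m) (p n) (pair v f)"
      unfolding E_def
      by (intro finite_part_keeps keeps_exists \<gamma> p_Ni p_cond p_extends[OF m(1)] vf)
    have "E \<subseteq> (\<Union>a\<in>{..m}. \<Union>b\<in>{..m}. \<Union>k\<in>{..m}. finite_part \<gamma> (p a) (p b) (enum_Ni k))"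
    proof -
      have "m \<in> {..m}" "n \<in> {..m}" "k \<in> {..m}" using m by simp_all
      then show ?thesis unfolding E_def k[symmetric] by blast
    qed
    then have "reserve \<gamma> p m \<xi> \<subseteq> A \<xi> \<gamma> \<inter> A (h \<xi>) \<gamma> - E" for \<xi>
      unfolding reserve_def by (rule Diff_mono[OF order_refl])
    then have X: "X \<xi> - column (p m) \<xi> \<subseteq> A \<xi> \<gamma> - E" "X \<xi> - column (p m) \<xi> \<subseteq> A (h \<xi>) \<gamma> - E"
      if "\<xi> \<in> elts v" for \<xi>
      using X_reserve[of \<xi> m] m(3) that by blast+
    have "elts v \<subseteq> Ni" using v(4) unfolding K_def by blast
    then have col: "column lim \<xi> = X \<xi>" "column lim (h \<xi>) = X \<xi>" if "\<xi> \<in> elts v" for \<xi>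
      using column_lim that by blast+
    have "elts (first (p m)) \<subseteq> elts (first lim)" "elts (first (h (p m))) \<subseteq> elts (first lim)"
      unfolding lim_def first_pair elts_lim_first hF unfolding F_def by blast+
    then show ?thesis
      using keeps[unfolded keeps_def, THEN conjunct2, rule_format, OF refl] X col by simp
  qed
  from assms(1) consider n where "r = p n" | n where "r = h (p n)" unfolding S_def by blast
  then show ?thesis
  proof cases
    case (1 n)
    then show ?thesis using main[of v f n] assms(2) by simp
  next
    case (2 n)
    then obtain z where z: "z \<in> elts (second (p n))" "pair v f = h z"
      using assms(2) h_condition(2)[OF p_Ni p_cond, of n] by auto
    obtain v' f' where vf': "z = pair v' f'"
      using p_cond[of n] z(1) unfolding is_condition_iff by (elim conjE ballE[of _ _ z]) auto
    note v' = promise_Ni[OF p_Ni p_cond z(1)[unfolded vf']]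
    have "v = h v'" "f = h f'" using z(2) unfolding vf' h_pair[OF v'(1)] by simp_all
    then show ?thesis using main[OF z(1)[unfolded vf']] 2 by simp
  qed
qed

lemma countable_S: "countable S"
  unfolding S_def by simp

lemma countable_second: "r \<in> S \<Longrightarrow> countable (elts (second r))"
  by (rule is_condition_countable_second[OF S_cond])

lemma Y_set_lim: "Y_set A v f (pair lim_first zero) r = Y_set A v f lim r"
  unfolding Y_set_def lim_def column_pair by simp

lemma countable_lim_second:
  "countable ((\<Union>r\<in>S. elts (second r)) \<union>
     (\<Union>r\<in>S. (\<lambda>z. pair (first z) (restriction (second z) (Y_set A (first z) (second z) lim r))) ` elts (second r)))"
  by (intro countable_Un countable_UN countable_image countable_S countable_second)

lemma elts_lim_second:
  "elts lim_second = (\<Union>r\<in>S. elts (second r)) \<union>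
     (\<Union>r\<in>S. (\<lambda>z. pair (first z) (restriction (second z) (Y_set A (first z) (second z) lim r))) ` elts (second r))"
  unfolding lim_second_def Y_set_lim by (rule elts_set_of_countable[OF countable_lim_second])

lemma S_second_elts:
  assumes "r \<in> S" "z \<in> elts (second r)"
  obtains v f where "z = pair v f" "elts v \<subseteq> elts \<kappa>" "finite (elts v)" "promise f"
  using S_cond[OF assms(1)] assms(2) that unfolding is_condition_iff by (elim conjE ballE[of _ _ z]) auto

lemma lim_cond: "cond lim"
  unfolding lim_def is_condition_pair
proof (intro conjI)
  show "is_function lim_first" by (rule is_function_lim_first)
  have "fdom lim_first \<subseteq> first ` elts lim_first" unfolding fdom_def by force
  moreover have "countable (elts lim_first)" unfolding elts_lim_first using countable_F by simp
  ultimately show "countable (fdom lim_first)" by (metis countable_image countable_subset)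
  show "fdom lim_first \<subseteq> {pair \<xi> \<zeta> | \<xi> \<zeta>. \<xi> \<in> elts \<kappa> \<and> \<zeta> \<in> elts omega1}"
  proof
    fix x assume "x \<in> fdom lim_first"
    then obtain y where y: "pair x y \<in> F \<union> h ` F" unfolding fdom_def elts_lim_first by blast
    then obtain r where r: "r \<in> S" "pair x y \<in> elts (first r)" by (rule entry_lim)
    show "x \<in> {pair \<xi> \<zeta> | \<xi> \<zeta>. \<xi> \<in> elts \<kappa> \<and> \<zeta> \<in> elts omega1}"
      by (rule is_condition_first_elts[OF S_cond[OF r(1)] r(2)]) simp
  qed
  show "fran lim_first \<subseteq> {zero, one}"
  proof
    fix y assume "y \<in> fran lim_first"
    then obtain x where y: "pair x y \<in> F \<union> h ` F" unfolding fran_def elts_lim_first by blast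
    then obtain r where r: "r \<in> S" "pair x y \<in> elts (first r)" by (rule entry_lim)
    show "y \<in> {zero, one}"
      by (rule is_condition_first_elts[OF S_cond[OF r(1)] r(2)]) simp
  qed
  show "\<forall>\<xi>\<in>elts \<kappa>. column (pair lim_first lim_second) \<xi> \<in> I \<xi>"
    using column_lim_in_ideal unfolding lim_def by blast
  show "countable (elts lim_second)" unfolding elts_lim_second by (rule countable_lim_second)
  show "\<forall>z\<in>elts lim_second. \<exists>v f. z = pair v f \<and> elts v \<subseteq> elts \<kappa> \<and> finite (elts v) \<and> promise f"
  proof
    fix z assume "z \<in> elts lim_second"
    then consider r where "r \<in> S" "z \<in> elts (second r)"
      | r z' where "r \<in> S" "z' \<in> elts (second r)"
          "z = pair (first z') (restriction (second z') (Y_set A (first z') (second z') lim r))"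
      unfolding elts_lim_second by blast
    then show "\<exists>v f. z = pair v f \<and> elts v \<subseteq> elts \<kappa> \<and> finite (elts v) \<and> promise f"
    proof cases
      case 1
      from S_second_elts[OF this] show ?thesis by blast
    next
      case 2
      obtain v f where vf: "z' = pair v f" "elts v \<subseteq> elts \<kappa>" "finite (elts v)" "promise f"
        by (rule S_second_elts[OF 2(1,2)])
      have "uncountable (Y_set A v f lim r)" using uncountable_Y_lim[OF 2(1)] 2(2) vf(1) by simp
      moreover have "fdom f \<inter> Y_set A v f lim r = Y_set A v f lim r" using Y_set_subset[of A v f lim r] by blast
      ultimately have "promise (restriction f (Y_set A v f lim r))"
        by (intro promise_restriction[OF vf(4)]) simp
      then show ?thesis using 2(3) vf by auto
    qed
  qed
qed

lemma lim_extends: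
  assumes "r \<in> S"
  shows "extends A lim r"
  unfolding extends_def
proof (intro conjI allI impI)
  show "elts (first r) \<subseteq> elts (first lim)"
    using assms unfolding lim_def first_pair elts_lim_first hF S_def unfolding F_def by auto
  show "elts (second r) \<subseteq> elts (second lim)"
    using assms unfolding lim_def second_pair elts_lim_second by blast
  fix v f assume vf: "pair v f \<in> elts (second r)"
  show "uncountable (Y_set A v f lim r)" by (rule uncountable_Y_lim[OF assms vf])
  have "second lim = lim_second" by (simp add: lim_def)
  then show "pair v (restriction f (Y_set A v f lim r)) \<in> elts (second lim)"
    by (simp only: elts_lim_second) (rule UnI2, rule UN_I[OF assms], rule image_eqI[OF _ vf], simp)
qed

lemma lim_below: "below \<P> lim (p n)" "below \<P> lim (h (p n))"
  unfolding below_P_forcing using lim_cond p_cond hp_cond lim_extends[of "p n"] lim_extends[of "h (p n)"]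
  by (simp_all add: S_def)

section \<open>Genericity of the limit and the statements it forces\<close>

lemma p_meets_dense:
  assumes "D \<in> Ni" "dense_in \<P> (elts D)"
  shows "\<exists>n. p n \<in> elts D"
  using enum_Ni[OF assms(1)] p_dense assms(2) by metis

lemma lim_generic: "generic_condition Ni \<P> lim"
  unfolding generic_condition_def
proof (intro conjI ballI impI)
  show "lim \<in> carrier \<P>" using lim_cond by simp
  fix D assume D: "D \<in> Ni" "dense_in \<P> (elts D)"
  obtain n where n: "p n \<in> elts D" using p_meets_dense[OF D] by blast
  have "\<exists>d\<in>elts D \<inter> Ni. \<exists>s. below \<P> s r \<and> below \<P> s d" if r: "below \<P> r lim" for r
    using n p_Ni below_refl[OF below_carrier(1)[OF r]] below_trans[OF r lim_below(1)] by blast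
  then show "predense_below \<P> (elts D \<inter> Ni) lim" unfolding predense_below_def by blast
qed

text \<open>Some \<open>p n\<close> is below r or incompatible with r, and h carries the same
  alternative to \<open>h (p n)\<close> and \<open>h r\<close>. As the limit is below both
  \<open>p n\<close> and \<open>h (p n)\<close>, it settles the two memberships alike.\<close>

lemma lim_forces_iff:
  assumes r: "r \<in> Ni" "cond r"
  shows "forces \<P> lim (case_nat (check_name \<P> r) (case_nat (check_name \<P> (h r)) (\<lambda>_. generic_name \<P>)))
    (Iff (Mem 0 2) (Mem 1 2))"
proof (rule forces_generic_iff)
  have hr: "cond (h r)" using r cond_h by simp
  show "r \<in> carrier \<P>" "h r \<in> carrier \<P>" using r hr by simp_all
  obtain D where D: "D \<in> Ni" "dense_in \<P> (elts D)"
    "\<And>s. s \<in> elts D \<Longrightarrow> below \<P> s r \<or> \<not> (\<exists>t. below \<P> t s \<and> below \<P> t r)"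
    by (rule decides_Ni[OF r]) blast
  obtain n where n: "p n \<in> elts D" using p_meets_dense[OF D(1,2)] by blast
  from D(3)[OF n] show "below \<P> lim r \<and> below \<P> lim (h r) \<or>
      (\<forall>t. below \<P> t lim \<longrightarrow> \<not> below \<P> t r \<and> \<not> below \<P> t (h r))"
  proof
    assume b: "below \<P> (p n) r"
    then have "below \<P> (h (p n)) (h r)"
      using extends_h[OF r(1) p_Ni r(2) p_cond] hr hp_cond unfolding below_P_forcing by simp
    then show ?thesis using b below_trans[OF lim_below(1)] below_trans[OF lim_below(2)] by blast
  next
    assume i: "\<not> (\<exists>t. below \<P> t (p n) \<and> below \<P> t r)"
    then have "\<not> (\<exists>t. below \<P> t (h (p n)) \<and> below \<P> t (h r))"
      unfolding incompatible_h[OF p_Ni r(1)] .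
    then show ?thesis using i below_trans[OF _ lim_below(1)] below_trans[OF _ lim_below(2)] by blast
  qed
qed

end

theorem theorem1:
  fixes \<kappa> :: "'v::set_universe"
    and I :: "'v \<Rightarrow> 'v set set"
    and A :: "'v \<Rightarrow> 'v \<Rightarrow> 'v set"
  assumes CH: "(UNIV :: nat set set) \<approx> elts (omega1 :: 'v)"
    and "Cardinal \<kappa>"
    and "\<And>\<xi>. \<xi> \<in> elts \<kappa> \<Longrightarrow> P_ideal (I \<xi>)"
    and "\<And>\<xi>. \<xi> \<in> elts \<kappa> \<Longrightarrow> generating_sequence (I \<xi>) (A \<xi>)"
  shows "aleph2_pic (P_forcing \<kappa> I A)"
proof -
  \<comment> \<open>CH enters here: omega1 is equipollent with the power set of \<open>nat\<close>,
    which is uncountable by Cantor's theorem.\<close>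
  have unc: "uncountable (elts (omega1 :: 'v))"
  proof
    assume "countable (elts (omega1 :: 'v))"
    then have "countable (UNIV :: nat set set)" using countable_eqpoll CH by blast
    then have "\<exists>f :: nat set \<Rightarrow> nat. inj f" unfolding countable_def by blast
    then obtain f :: "nat set \<Rightarrow> nat" where "inj f" by blast
    then have "surj (inv f)" by (rule inj_imp_surj_inv)
    then show False using Cantors_theorem[of "UNIV :: nat set"] by auto
  qed
  interpret ideal_forcing \<kappa> I A by unfold_locales (fact unc assms(3,4))+
  show ?thesis
    unfolding aleph2_pic_def
  \<comment> \<open>The threshold omega1 makes l uncountable. That \<open>\<P>\<close> lies in H(l)
    follows from its membership in Ni.\<close>
  proof (intro exI[of _ omega1] conjI allI impI Cardinal_omega1[OF unc], elim conjE)
    fix l i j Ni Nj h p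
    assume l: "elts (omega1 :: 'v) \<subseteq> elts l"
      and N: "countable Ni" "elementary_submodel Ni (hereditary l)" "elementary_submodel Nj (hereditary l)"
      and h: "membership_iso h Ni Nj" "\<forall>x\<in>Ni \<inter> Nj. h x = x"
      and P: "\<P> \<in> Ni \<inter> Nj" and p: "p \<in> Ni \<inter> carrier \<P>"
    have "uncountable (elts l)" using unc l countable_subset by blast
    then interpret pic_setting \<kappa> I A l Ni Nj h
      by unfold_locales (use N h P in auto)
    obtain \<gamma> p' where p': "generic_sequence \<kappa> I A l Ni Nj h \<gamma> p'" "p' 0 = p"
      using generic_sequence_exists[of p] p by auto
    interpret generic_sequence \<kappa> I A l Ni Nj h \<gamma> p' by (rule p'(1))
    show "\<exists>q\<in>carrier \<P>.
           (\<forall>r \<in> Ni \<inter> carrier \<P>.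
              forces \<P> q
                (case_nat (check_name \<P> r) (case_nat (check_name \<P> (h r)) (\<lambda>_. generic_name \<P>)))
                (Iff (Mem 0 2) (Mem 1 2)))
           \<and> forces \<P> q (case_nat (check_name \<P> p) (\<lambda>_. generic_name \<P>)) (Mem 0 1)
           \<and> generic_condition Ni \<P> q"
    proof (intro bexI[of _ lim] conjI ballI)
      show "lim \<in> carrier \<P>" using lim_cond by simp
      show "generic_condition Ni \<P> lim" by (rule lim_generic)
      show "forces \<P> lim (case_nat (check_name \<P> p) (\<lambda>_. generic_name \<P>)) (Mem 0 1)"
        using forces_mem_generic_below[OF lim_below(1)[of 0]] p'(2) by simp
      fix r assume "r \<in> Ni \<inter> carrier \<P>"
      then show "forces \<P> lim (case_nat (check_name \<P> r) (case_nat (check_name \<P> (h r)) (\<lambda>_. generic_name \<P>)))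
          (Iff (Mem 0 2) (Mem 1 2))"
        by (intro lim_forces_iff) simp_all
    qed
  qed
qed

end
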